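(* Let $k$ be a Hilbertian field and let $G$ be a finite group. Then there exist infinitely many distinct finite field extensions $L/k$ (with $L \subseteq \overline{k}$, where $\overline{k}$ is a fixed algebraic closure of $k$) such that $\mathrm{Aut}(L/k)$ is isomorphic to $G$.
   Context: For a finite field extension $L/k$, $\mathrm{Aut}(L/k)$ denotes the group of all field automorphisms of $L$ which fix every element of $k$; the extension $L/k$ is not required to be Galois. A field $k$ is Hilbertian if Hilbert's irreducibility theorem holds for $k$ in place of $\mathbb{Q}$; that is (in arbitrary characteristic), for every irreducible polynomial $P(T,X) \in k[T][X]$ which is separable and of degree at least $1$ in $X$ over $k(T)$, there exist infinitely many $t_0 \in k$ such that $P(t_0,X)$ is irreducible over $k$. *)

theory Defs
  imports
    "HOL-Algebra.Algebra"
    "HOL-Algebra.Algebraic_Closure_Type"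
    "HOL-Computational_Algebra.Computational_Algebra"
begin

text \<open>
  Separable means without repeated roots in an algebraic closure of the coefficient field.
\<close>

definition separable_poly :: "'a::field poly \<Rightarrow> bool" where
  "separable_poly p \<longleftrightarrow> rsquarefree (map_poly to_ac p)"

text \<open>
  In \<^typ>\<open>'k poly poly\<close> the outer variable is \<open>X\<close> and the inner one is \<open>T\<close>.
\<close>

definition specialize :: "'k::field poly poly \<Rightarrow> 'k \<Rightarrow> 'k poly" where
  "specialize P t = map_poly (\<lambda>c. poly c t) P"

definition hilbertian :: "'k::field itself \<Rightarrow> bool" where
  "hilbertian _ \<longleftrightarrow>
     (\<forall>P :: 'k poly poly.
        Factorial_Ring.irreducible P \<longrightarrow>
        separable_poly (map_poly to_fract P :: 'k poly fract poly) \<longrightarrow>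
        Polynomial.degree P \<ge> 1 \<longrightarrow>
        infinite {t. Factorial_Ring.irreducible (specialize P t)})"

definition finite_extension :: "'k::field alg_closure set \<Rightarrow> bool" where
  "finite_extension L \<longleftrightarrow>
     range to_ac \<subseteq> L \<and>
     subfield L ring_of_type_algebra \<and>
     ring.finite_dimension ring_of_type_algebra (range to_ac) L"

text \<open>
  Automorphisms are extensional on \<open>L\<close>, as in \<^const>\<open>BijGroup\<close>, so that each of them is
  represented by exactly one function.
\<close>

definition field_aut :: "'k::field alg_closure set \<Rightarrow> ('k alg_closure \<Rightarrow> 'k alg_closure) set" where
  "field_aut L =
     {\<sigma> \<in> Bij L.
        (\<forall>x\<in>L. \<forall>y\<in>L. \<sigma> (x + y) = \<sigma> x + \<sigma> y \<and> \<sigma> (x * y) = \<sigma> x * \<sigma> y) \<and>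
        (\<forall>c. \<sigma> (to_ac c) = to_ac c)}"

definition Aut :: "'k::field alg_closure set \<Rightarrow> ('k alg_closure \<Rightarrow> 'k alg_closure) monoid" where
  "Aut L = BijGroup L\<lparr>carrier := field_aut L\<rparr>"

lemma subfield_alg_closure_closed:
  fixes L :: "'k::field alg_closure set"
  assumes "subfield L ring_of_type_algebra" "x \<in> L" "y \<in> L"
  shows "x + y \<in> L" "x * y \<in> L"
proof -
  have sub: "subring L (ring_of_type_algebra :: 'k alg_closure ring)"
    using assms(1) by (rule subfieldE(1))
  show "x + y \<in> L" "x * y \<in> L"
    using subringE(6,7)[OF sub assms(2,3)] by (simp_all add: ring_of_type_algebra_def)
qed

lemma group_Aut:
  fixes L :: "'k::field alg_closure set"
  assumes "finite_extension L"
  shows "group (Aut L)"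
proof -
  interpret B: group "BijGroup L" by (rule group_BijGroup)
  have base: "to_ac c \<in> L" for c using assms by (auto simp: finite_extension_def)
  have cl: "x + y \<in> L" "x * y \<in> L" if "x \<in> L" "y \<in> L" for x y
    using assms subfield_alg_closure_closed that by (auto simp: finite_extension_def)
  have "subgroup (field_aut L) (BijGroup L)"
  proof (rule B.subgroupI)
    show "field_aut L \<subseteq> carrier (BijGroup L)"
      by (auto simp: field_aut_def BijGroup_def)
    have "(\<lambda>x\<in>L. x) \<in> field_aut L"
      by (auto simp: field_aut_def id_Bij base cl)
    then show "field_aut L \<noteq> {}" by blast
  next
    fix \<sigma> assume s: "\<sigma> \<in> field_aut L"
    then have b: "\<sigma> \<in> Bij L" and bb: "bij_betw \<sigma> L L" by (auto simp: field_aut_def Bij_def)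
    let ?\<tau> = "restrict (inv_into L \<sigma>) L"
    have inL: "inv_into L \<sigma> x \<in> L" "\<sigma> (inv_into L \<sigma> x) = x" if "x \<in> L" for x
      using b that Bij_inv_into_mem bij_betw_inv_into_right[OF bb] by auto
    have eqI: "inv_into L \<sigma> x = y" if "y \<in> L" "\<sigma> y = x" for x y
      using that bb by (auto simp: bij_betw_def)
    have "?\<tau> \<in> field_aut L"
      using s b base cl inL unfolding field_aut_def
      by (auto simp: restrict_inv_into_Bij intro!: eqI)
    then show "inv\<^bsub>BijGroup L\<^esub> \<sigma> \<in> field_aut L"
      using b by (simp add: inv_BijGroup)
  next
    fix \<sigma> \<tau> assume s: "\<sigma> \<in> field_aut L" and t: "\<tau> \<in> field_aut L"
    then have "compose L \<sigma> \<tau> \<in> field_aut L"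
      using Bij_imp_funcset[of \<tau> L]
      by (auto simp: field_aut_def compose_Bij base cl compose_eq Pi_iff)
    then show "\<sigma> \<otimes>\<^bsub>BijGroup L\<^esub> \<tau> \<in> field_aut L"
      using s t by (auto simp: BijGroup_def field_aut_def)
  qed
  then show ?thesis unfolding Aut_def by (rule B.subgroup_imp_group)
qed

end

theory Submission
  imports Defs
begin

text \<open>
  If \<open>H\<close> is a subgroup of the symmetric group \<open>S\<^sub>n\<close> and \<open>M/k\<close> is a Galois extension with group \<open>S\<^sub>n\<close>, then
  the fixed field \<open>L\<close> of \<open>H\<close> has \<open>Aut (L/k) = N(H)/H\<close>. Every finite group has this form \<open>N(H)/H\<close>: take for
  \<open>H\<close> a product of symmetric groups attached to a weighted hypergraph whose automorphism group is \<open>G\<close>.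
  The index of \<open>H\<close>, which is the number of embeddings of \<open>L\<close> into \<open>k\<close>-bar, can be made arbitrarily large,
  hence infinitely many fields \<open>L\<close> arise.

  To realize \<open>S\<^sub>n\<close> over \<open>k\<close>, interpolate in \<open>T\<close> between three separable polynomials over \<open>k\<close>: an irreducible one,
  a linear factor times an irreducible one of degree \<open>n - 1\<close>, and linear factors times an irreducible
  quadratic. The roots over each fibre lift to power series in \<open>T - t\<close>, which shows that the Galois group over
  \<open>k(T)\<close> is transitive, that a point stabilizer is transitive on the other roots, and that there is a
  transposition. The minimal polynomial of a primitive element is then specialized by the Hilbert property.
  Irreducible polynomials over \<open>k\<close> of each degree are specializations of \<open>X\<^sup>m + T X + T\<close>.
\<close>

section \<open>Subrings, partial homomorphisms and polynomials over a subring\<close>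

text \<open>Prescribing the Galois group \<open>G\<close> itself would be the inverse Galois
  problem. Since \<open>L\<close> may be non-normal, it is enough to realize symmetric groups. The
  obstacle is inseparability: the characteristic may divide the degree, and \<open>k\<close> may be
  imperfect. So every fibre in use is required to have simple roots, and the linear term T X of the
  trinomial keeps its X-derivative nonzero in every characteristic. No Galois correspondence is
  presupposed. Group elements are endomorphisms of an algebraic closure over the base field, seen
  through their action on finitely many roots; the basic descent statement is that an element of a
  separable splitting field fixed by all of them lies in the base. Fibres control the group as
  follows. The roots of a fibre that lie in \<open>k\<close> lift to series with coefficients in
  \<open>k\<close>. A set of roots stable under all elements fixing these lifts therefore reduces to
  a factor of the fibre over \<open>k\<close>, and irreducibility of the remaining factor forces
  transitivity. Embeddings are counted because the fields constructed for different \<open>H\<close>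
  are not visibly distinct, whereas a finite family of fields has bounded embedding numbers.\<close>

definition is_subring :: "'a::comm_ring_1 set \<Rightarrow> bool" where
  "is_subring K \<longleftrightarrow> 1 \<in> K \<and> (\<forall>x\<in>K. - x \<in> K) \<and> (\<forall>x\<in>K. \<forall>y\<in>K. x + y \<in> K \<and> x * y \<in> K)"

text \<open>A total function of which only the values on \<open>K\<close> matter. Field embeddings,
  endomorphisms and places, which live on a proper subring, thus share one notion.\<close>

definition hom_on :: "'a::comm_ring_1 set \<Rightarrow> ('a \<Rightarrow> 'b::comm_ring_1) \<Rightarrow> bool" where
  "hom_on K \<phi> \<longleftrightarrow> \<phi> 1 = 1 \<and> (\<forall>x\<in>K. \<forall>y\<in>K. \<phi> (x + y) = \<phi> x + \<phi> y \<and> \<phi> (x * y) = \<phi> x * \<phi> y)"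

definition coeffs_in :: "'a::comm_ring_1 set \<Rightarrow> 'a poly \<Rightarrow> bool" where
  "coeffs_in K p \<longleftrightarrow> (\<forall>i. coeff p i \<in> K)"

lemma is_subring_UNIV [simp]: "is_subring UNIV"
  by (simp add: is_subring_def)

lemma is_subringD:
  assumes "is_subring K"
  shows "1 \<in> K" "0 \<in> K" "x \<in> K \<Longrightarrow> y \<in> K \<Longrightarrow> x + y \<in> K" "x \<in> K \<Longrightarrow> y \<in> K \<Longrightarrow> x * y \<in> K"
    "x \<in> K \<Longrightarrow> - x \<in> K" "x \<in> K \<Longrightarrow> y \<in> K \<Longrightarrow> x - y \<in> K"
proof -
  show *: "1 \<in> K" "x \<in> K \<Longrightarrow> y \<in> K \<Longrightarrow> x + y \<in> K" "x \<in> K \<Longrightarrow> y \<in> K \<Longrightarrow> x * y \<in> K"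
    "x \<in> K \<Longrightarrow> - x \<in> K" for x y
    using assms by (auto simp: is_subring_def)
  from *(2)[OF *(1) *(4)[OF *(1)]] show "0 \<in> K" by simp
  show "x - y \<in> K" if "x \<in> K" "y \<in> K"
    using *(2)[OF that(1) *(4)[OF that(2)]] by simp
qed

lemma is_subring_sum: "is_subring K \<Longrightarrow> (\<And>i. i \<in> A \<Longrightarrow> f i \<in> K) \<Longrightarrow> sum f A \<in> K"
  by (induction A rule: infinite_finite_induct) (auto simp: is_subringD)

lemma is_subring_prod: "is_subring K \<Longrightarrow> (\<And>i. i \<in> A \<Longrightarrow> f i \<in> K) \<Longrightarrow> prod f A \<in> K"
  by (induction A rule: infinite_finite_induct) (auto simp: is_subringD)

lemma is_subring_power: "is_subring K \<Longrightarrow> x \<in> K \<Longrightarrow> x ^ n \<in> K"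
  by (induction n) (auto simp: is_subringD)

lemma is_subring_Int: "is_subring K \<Longrightarrow> is_subring L \<Longrightarrow> is_subring (K \<inter> L)"
  by (auto simp: is_subring_def)

lemma is_subring_Inter: "(\<And>K. K \<in> \<S> \<Longrightarrow> is_subring K) \<Longrightarrow> is_subring (\<Inter>\<S>)"
  by (auto simp: is_subring_def)

lemma hom_onD:
  assumes "hom_on K \<phi>" "is_subring K"
  shows "\<phi> 1 = 1" "\<phi> 0 = 0" "x \<in> K \<Longrightarrow> y \<in> K \<Longrightarrow> \<phi> (x + y) = \<phi> x + \<phi> y"
    "x \<in> K \<Longrightarrow> y \<in> K \<Longrightarrow> \<phi> (x * y) = \<phi> x * \<phi> y"
    "x \<in> K \<Longrightarrow> \<phi> (- x) = - \<phi> x" "x \<in> K \<Longrightarrow> y \<in> K \<Longrightarrow> \<phi> (x - y) = \<phi> x - \<phi> y"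
proof -
  show *: "\<phi> 1 = 1" "x \<in> K \<Longrightarrow> y \<in> K \<Longrightarrow> \<phi> (x + y) = \<phi> x + \<phi> y"
    "x \<in> K \<Longrightarrow> y \<in> K \<Longrightarrow> \<phi> (x * y) = \<phi> x * \<phi> y" for x y
    using assms by (auto simp: hom_on_def)
  note cl = is_subringD[OF assms(2)]
  show 0: "\<phi> 0 = 0"
    using *(2)[of 0 0] cl by simp
  show neg: "\<phi> (- x) = - \<phi> x" if "x \<in> K" for x
    using *(2)[of x "- x"] cl that 0 by (simp add: eq_neg_iff_add_eq_0 add.commute)
  show "\<phi> (x - y) = \<phi> x - \<phi> y" if "x \<in> K" "y \<in> K"
    using *(2)[of x "- y"] cl that neg by simp
qed

lemma hom_on_sum:
  "hom_on K \<phi> \<Longrightarrow> is_subring K \<Longrightarrow> (\<And>i. i \<in> A \<Longrightarrow> f i \<in> K) \<Longrightarrow> \<phi> (sum f A) = (\<Sum>i\<in>A. \<phi> (f i))"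
  by (induction A rule: infinite_finite_induct) (auto simp: hom_onD is_subring_sum)

lemma hom_on_prod:
  "hom_on K \<phi> \<Longrightarrow> is_subring K \<Longrightarrow> (\<And>i. i \<in> A \<Longrightarrow> f i \<in> K) \<Longrightarrow> \<phi> (prod f A) = (\<Prod>i\<in>A. \<phi> (f i))"
  by (induction A rule: infinite_finite_induct) (auto simp: hom_onD is_subring_prod)

lemma hom_on_power:
  "hom_on K \<phi> \<Longrightarrow> is_subring K \<Longrightarrow> x \<in> K \<Longrightarrow> \<phi> (x ^ n) = \<phi> x ^ n"
  by (induction n) (auto simp: hom_onD is_subring_power)

lemma hom_on_nonzero:
  fixes \<phi> :: "'a::field \<Rightarrow> 'b::field"
  assumes "hom_on K \<phi>" "x \<in> K" "inverse x \<in> K" "x \<noteq> 0"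
  shows "\<phi> x \<noteq> 0"
proof
  assume "\<phi> x = 0"
  moreover have "\<phi> (x * inverse x) = \<phi> x * \<phi> (inverse x)" "\<phi> 1 = 1"
    using assms unfolding hom_on_def by blast+
  ultimately show False using assms(4) by simp
qed

lemma hom_on_UNIV_inj:
  fixes \<phi> :: "'a::field \<Rightarrow> 'b::field"
  assumes "hom_on UNIV \<phi>"
  shows "inj \<phi>"
proof (rule injI)
  fix x y assume "\<phi> x = \<phi> y"
  then have "\<phi> (x - y) = 0" using hom_onD[OF assms] by simp
  then show "x = y" using hom_on_nonzero[OF assms, of "x - y"] by auto
qed

lemma hom_on_UNIV_eq_iff:
  fixes \<phi> :: "'a::field \<Rightarrow> 'b::field"
  shows "hom_on UNIV \<phi> \<Longrightarrow> \<phi> x = \<phi> y \<longleftrightarrow> x = y"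
  using hom_on_UNIV_inj by (auto dest: injD)

lemma hom_on_UNIV_inverse:
  fixes \<phi> :: "'a::field \<Rightarrow> 'b::field"
  assumes "hom_on UNIV \<phi>"
  shows "\<phi> (inverse x) = inverse (\<phi> x)"
proof (cases "x = 0")
  case True
  then show ?thesis using hom_onD[OF assms] by simp
next
  case False
  then have "\<phi> x * \<phi> (inverse x) = 1"
    using hom_onD(1,4)[OF assms] by (metis UNIV_I is_subring_UNIV right_inverse)
  then show ?thesis by (simp add: inverse_unique)
qed

lemma hom_on_comp: "hom_on K \<phi> \<Longrightarrow> hom_on L \<psi> \<Longrightarrow> (\<And>x. x \<in> K \<Longrightarrow> \<phi> x \<in> L) \<Longrightarrow> hom_on K (\<psi> \<circ> \<phi>)"
  by (auto simp: hom_on_def)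

lemma hom_on_to_ac: "hom_on K (to_ac :: 'a::field \<Rightarrow> _)"
  by (simp add: hom_on_def)

lemma coeffs_in_UNIV [simp]: "coeffs_in UNIV p"
  by (simp add: coeffs_in_def)

lemma coeffs_in_mono: "coeffs_in K p \<Longrightarrow> K \<subseteq> L \<Longrightarrow> coeffs_in L p"
  by (auto simp: coeffs_in_def)

lemma coeffs_in_pCons [simp]: "is_subring K \<Longrightarrow> coeffs_in K (pCons a p) \<longleftrightarrow> a \<in> K \<and> coeffs_in K p"
  by (auto simp: coeffs_in_def coeff_pCons split: nat.splits)

lemma coeffs_in_0 [simp]: "is_subring K \<Longrightarrow> coeffs_in K 0"
  by (simp add: coeffs_in_def is_subringD)

lemma coeffs_in_1 [simp]: "is_subring K \<Longrightarrow> coeffs_in K 1"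
  by (simp add: coeffs_in_def coeff_1 is_subringD)

lemma coeffs_in_add: "is_subring K \<Longrightarrow> coeffs_in K p \<Longrightarrow> coeffs_in K q \<Longrightarrow> coeffs_in K (p + q)"
  by (simp add: coeffs_in_def is_subringD)

lemma coeffs_in_diff: "is_subring K \<Longrightarrow> coeffs_in K p \<Longrightarrow> coeffs_in K q \<Longrightarrow> coeffs_in K (p - q)"
  by (simp add: coeffs_in_def is_subringD)

lemma coeffs_in_mult: "is_subring K \<Longrightarrow> coeffs_in K p \<Longrightarrow> coeffs_in K q \<Longrightarrow> coeffs_in K (p * q)"
  by (auto simp: coeffs_in_def coeff_mult intro!: is_subring_sum is_subringD)

lemma coeffs_in_prod: "is_subring K \<Longrightarrow> (\<And>i. i \<in> A \<Longrightarrow> coeffs_in K (f i)) \<Longrightarrow> coeffs_in K (prod f A)"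
  by (induction A rule: infinite_finite_induct) (auto simp: coeffs_in_mult)

lemma poly_in: "is_subring K \<Longrightarrow> coeffs_in K p \<Longrightarrow> x \<in> K \<Longrightarrow> poly p x \<in> K"
  by (auto simp: poly_altdef coeffs_in_def intro!: is_subring_sum is_subringD is_subring_power)

lemma coeffs_in_map_poly: "f 0 = 0 \<Longrightarrow> range f \<subseteq> K \<Longrightarrow> coeffs_in K (map_poly f p)"
  by (auto simp: coeffs_in_def coeff_map_poly)

lemma coeffs_in_range_E:
  assumes "coeffs_in (range f) p" "f 0 = 0" "\<And>x. f x = 0 \<Longrightarrow> x = 0"
  obtains q where "p = map_poly f q"
proof -
  define g where "g y = (SOME x. f x = y)" for y
  have g: "f (g y) = y" if "y \<in> range f" for y
    unfolding g_def using that by (auto intro: someI)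
  \<comment> \<open>Coefficients of \<open>map_poly g p\<close> can be read off only if
    \<open>g\<close> fixes \<open>0\<close>; the choice of preimages must therefore respect
    zero.\<close>
  have g0: "g 0 = 0" using g[of 0] assms(2,3) by (metis rangeI)
  have "map_poly f (map_poly g p) = p"
    by (rule poly_eqI) (use assms g g0 in \<open>auto simp: coeff_map_poly coeffs_in_def\<close>)
  then show ?thesis using that by metis
qed

lemma map_poly_hom_on:
  assumes "hom_on K \<phi>" "is_subring K" "coeffs_in K p" "coeffs_in K q"
  shows "map_poly \<phi> (p + q) = map_poly \<phi> p + map_poly \<phi> q"
    "map_poly \<phi> (p - q) = map_poly \<phi> p - map_poly \<phi> q"
    "map_poly \<phi> (p * q) = map_poly \<phi> p * map_poly \<phi> q"
proof -
  note h = hom_onD[OF assms(1,2)]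
  note c = assms(3,4)[unfolded coeffs_in_def]
  show "map_poly \<phi> (p + q) = map_poly \<phi> p + map_poly \<phi> q"
    "map_poly \<phi> (p - q) = map_poly \<phi> p - map_poly \<phi> q"
    by (rule poly_eqI; use h c in \<open>simp add: coeff_map_poly\<close>)+
  show "map_poly \<phi> (p * q) = map_poly \<phi> p * map_poly \<phi> q"
    by (rule poly_eqI)
       (use h c in \<open>simp add: coeff_map_poly coeff_mult hom_on_sum[OF assms(1,2)] is_subringD(4)[OF assms(2)]\<close>)
qed

lemma map_poly_hom_on_prod:
  assumes "hom_on K \<phi>" "is_subring K" "\<And>i. i \<in> A \<Longrightarrow> coeffs_in K (f i)"
  shows "map_poly \<phi> (prod f A) = (\<Prod>i\<in>A. map_poly \<phi> (f i))"
  using assms(3)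
  by (induction A rule: infinite_finite_induct)
     (auto simp: map_poly_hom_on(3)[OF assms(1,2)] coeffs_in_prod[OF assms(2)] hom_onD[OF assms(1,2)])

lemma poly_map_poly_hom_on:
  assumes "hom_on K \<phi>" "is_subring K" "coeffs_in K p" "x \<in> K"
  shows "poly (map_poly \<phi> p) (\<phi> x) = \<phi> (poly p x)"
  using assms(3)
proof (induction p)
  case (pCons a p)
  then show ?case
    using assms hom_onD[OF assms(1,2)]
    by (simp add: map_poly_pCons poly_in is_subringD)
qed (use hom_onD[OF assms(1,2)] in simp)

lemma map_poly_prod_linear:
  assumes "hom_on K \<phi>" "is_subring K" "\<And>i. i \<in> A \<Longrightarrow> f i \<in> K"
  shows "map_poly \<phi> (\<Prod>i\<in>A. [:- f i, 1:]) = (\<Prod>i\<in>A. [:- \<phi> (f i), 1:])"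
proof -
  have "map_poly \<phi> (\<Prod>i\<in>A. [:- f i, 1:]) = (\<Prod>i\<in>A. map_poly \<phi> [:- f i, 1:])"
    using assms by (intro map_poly_hom_on_prod) (auto simp: is_subringD)
  also have "\<dots> = (\<Prod>i\<in>A. [:- \<phi> (f i), 1:])"
    using assms hom_onD[OF assms(1,2)] by (intro prod.cong) (auto simp: map_poly_pCons)
  finally show ?thesis .
qed

lemma coeffs_in_prod_linear:
  "is_subring K \<Longrightarrow> (\<And>i. i \<in> A \<Longrightarrow> f i \<in> K) \<Longrightarrow> coeffs_in K (\<Prod>i\<in>A. [:- f i, 1:])"
  by (intro coeffs_in_prod) (auto simp: is_subringD)

text \<open>Dividing by a monic polynomial involves no division of coefficients, so it works over
  any subring: over intermediate fields as well as over \<open>k[T]\<close>. The alternative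
  \<open>r = 0\<close> covers a divisor of degree 0.\<close>

lemma monic_division:
  assumes "is_subring K" "coeffs_in K m" "lead_coeff m = 1" "coeffs_in K g"
  obtains q r where "coeffs_in K q" "coeffs_in K r" "g = m * q + r" "r = 0 \<or> degree r < degree m"
proof -
  have "\<exists>q r. coeffs_in K q \<and> coeffs_in K r \<and> g = m * q + r \<and> (r = 0 \<or> degree r < degree m)"
    using assms(4)
  proof (induction "degree g" arbitrary: g rule: less_induct)
    case less
    show ?case
    proof (cases "g = 0 \<or> degree g < degree m")
      case True
      then show ?thesis using less.prems assms(1) by (intro exI[of _ 0] exI[of _ g]) auto
    next
      case False
      define s where "s = monom (lead_coeff g) (degree g - degree m)"
      define h where "h = g - m * s"
      have s: "coeffs_in K s"
        using less.prems assms(1) by (auto simp: s_def coeffs_in_def is_subringD)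
      have h: "coeffs_in K h"
        using less.prems s assms by (auto simp: h_def intro!: coeffs_in_diff coeffs_in_mult)
      have deg: "degree s = degree g - degree m" "s \<noteq> 0"
        using False by (auto simp: s_def degree_monom_eq)
      have cg: "coeff (m * s) (degree g) = lead_coeff g"
        using False assms(3) by (simp add: s_def coeff_monom_mult mult.commute[of m])
      have dms: "degree (m * s) \<le> degree g"
        using degree_mult_le[of m s] False deg by simp
      have dh: "h = 0 \<or> degree h < degree g"
      proof (cases "degree g = 0")
        case True
        then have "degree h = 0" using dms degree_diff_le[of g 0 "m * s"] by (simp add: h_def)
        moreover have "coeff h 0 = 0" using cg True by (simp add: h_def)
        ultimately show ?thesis by (metis leading_coeff_0_iff)
      next
        case False
        have "degree h \<le> degree g" using dms by (simp add: h_def degree_diff_le)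
        moreover have "coeff h (degree g) = 0" using cg by (simp add: h_def)
        ultimately show ?thesis by (metis leading_coeff_0_iff le_neq_implies_less)
      qed
      have "\<exists>q r. coeffs_in K q \<and> coeffs_in K r \<and> h = m * q + r \<and> (r = 0 \<or> degree r < degree m)"
      proof (cases "h = 0")
        case True
        then show ?thesis using assms(1) by (intro exI[of _ 0]) auto
      next
        case False
        then show ?thesis using less.hyps[OF _ h] dh by auto
      qed
      then obtain q r where qr: "coeffs_in K q" "coeffs_in K r" "h = m * q + r" "r = 0 \<or> degree r < degree m"
        by blast
      then have "g = m * (q + s) + r"
        by (simp add: h_def algebra_simps)
      then show ?thesis
        using qr s assms(1) by (intro exI[of _ "q + s"] exI[of _ r]) (auto intro: coeffs_in_add)
    qed
  qed
  then show ?thesis using that by blast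
qed

section \<open>Extending homomorphisms to an algebraic closure\<close>

text \<open>Only the ring operations are required: all elements are algebraic over the base field,
  so inverses follow (\<open>intermediate_inverse\<close>).\<close>

definition intermediate :: "'a::field alg_closure set \<Rightarrow> bool" where
  "intermediate K \<longleftrightarrow> is_subring K \<and> range to_ac \<subseteq> K"

lemma intermediateD: "intermediate K \<Longrightarrow> is_subring K" "intermediate K \<Longrightarrow> to_ac x \<in> K"
  by (auto simp: intermediate_def)

lemma intermediate_range: "intermediate (range to_ac)"
proof -
  have "- to_ac x \<in> range to_ac" "to_ac x + to_ac y \<in> range to_ac" "to_ac x * to_ac y \<in> range to_ac"
    for x y :: 'a
    by (metis rangeI to_ac_minus, metis rangeI to_ac_add, metis rangeI to_ac_mult)
  moreover have "1 \<in> range (to_ac :: 'a \<Rightarrow> _)" by (metis rangeI to_ac_1)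
  ultimately show ?thesis by (auto simp: intermediate_def is_subring_def)
qed

text \<open>An annihilating polynomial of least degree has nonzero constant coefficient, as
  otherwise X could be cancelled. Solving for that coefficient writes the inverse as a polynomial in
  \<open>x\<close> over the base field.\<close>

lemma intermediate_inverse:
  fixes x :: "'a::field alg_closure"
  assumes "intermediate K" "x \<in> K"
  shows "inverse x \<in> K"
proof (cases "x = 0")
  case False
  have "\<exists>p :: 'a poly. p \<noteq> 0 \<and> poly (map_poly to_ac p) x = 0"
    using alg_closure_algebraic[of x] by metis
  then obtain p :: "'a poly" where "p \<noteq> 0 \<and> poly (map_poly to_ac p) x = 0"
    and min: "\<And>q. q \<noteq> 0 \<and> poly (map_poly to_ac q) x = 0 \<Longrightarrow> degree p \<le> degree q"
    using exists_least_iff[of "\<lambda>n. \<exists>p. degree p = n \<and> p \<noteq> 0 \<and> poly (map_poly to_ac p) x = 0"]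
    by (metis (mono_tags, lifting) not_less)
  then have p: "p \<noteq> 0" "poly (map_poly to_ac p) x = 0" by auto
  obtain a q where pq: "p = pCons a q" by (metis pCons_cases)
  have *: "to_ac a + x * poly (map_poly to_ac q) x = 0"
    using p(2) by (simp add: pq map_poly_pCons)
  have "a \<noteq> 0"
  proof
    assume "a = 0"
    then have "q \<noteq> 0" "poly (map_poly to_ac q) x = 0" using p(1) * False by (auto simp: pq)
    then have "degree p \<le> degree q" using min by blast
    then show False using \<open>q \<noteq> 0\<close> by (simp add: pq)
  qed
  then have "inverse x = - to_ac (inverse a) * poly (map_poly to_ac q) x"
    using * False by (simp add: field_simps eq_neg_iff_add_eq_0 add.commute)
  moreover have "\<dots> \<in> K"
    using assms intermediateD[OF assms(1)]
    by (intro is_subringD poly_in coeffs_in_map_poly) (auto simp: intermediate_def simp flip: to_ac_inverse)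
  ultimately show ?thesis by simp
qed (use assms in \<open>auto simp: intermediate_def is_subringD\<close>)

section \<open>Simple extensions and minimal polynomials\<close>

definition simple_adjoin :: "'a::comm_ring_1 set \<Rightarrow> 'a \<Rightarrow> 'a set" where
  "simple_adjoin K a = {poly g a |g. coeffs_in K g}"

lemma simple_adjoin_mem:
  assumes "is_subring K"
  shows "K \<subseteq> simple_adjoin K a" "a \<in> simple_adjoin K a"
proof -
  have "x = poly [:x:] a" "a = poly [:0, 1:] a" for x by auto
  then show "K \<subseteq> simple_adjoin K a" "a \<in> simple_adjoin K a"
    unfolding simple_adjoin_def using assms
    by (auto simp: is_subringD) (metis coeffs_in_0 coeffs_in_pCons poly_0 mult_zero_right add.right_neutral poly_pCons,
      metis coeffs_in_0 coeffs_in_pCons is_subringD(1,2) poly_pCons poly_0 mult_zero_right add.right_neutral add_0 mult.right_neutral)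
qed

lemma is_subring_simple_adjoin:
  assumes "is_subring K"
  shows "is_subring (simple_adjoin K a)"
  unfolding is_subring_def
proof (intro conjI ballI)
  show "1 \<in> simple_adjoin K a" using simple_adjoin_mem(1)[OF assms] is_subringD(1)[OF assms] by auto
  fix x assume "x \<in> simple_adjoin K a"
  then obtain g where g: "coeffs_in K g" "x = poly g a" by (auto simp: simple_adjoin_def)
  have "coeffs_in K (- g)" using g by (auto simp: coeffs_in_def assms is_subringD)
  moreover have "- x = poly (- g) a" using g by simp
  ultimately show "- x \<in> simple_adjoin K a" unfolding simple_adjoin_def by blast
  fix y assume "y \<in> simple_adjoin K a"
  then obtain h where h: "coeffs_in K h" "y = poly h a" by (auto simp: simple_adjoin_def)
  have "x + y = poly (g + h) a" "x * y = poly (g * h) a" using g h by auto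
  then show "x + y \<in> simple_adjoin K a" "x * y \<in> simple_adjoin K a"
    unfolding simple_adjoin_def using g(1) h(1) coeffs_in_add[OF assms] coeffs_in_mult[OF assms] by blast+
qed

lemma intermediate_simple_adjoin: "intermediate K \<Longrightarrow> intermediate (simple_adjoin K a)"
  using simple_adjoin_mem(1) is_subring_simple_adjoin by (fastforce simp: intermediate_def)

lemma minimal_polynomial:
  fixes a :: "'a::field alg_closure"
  assumes K: "intermediate K"
  obtains m where "coeffs_in K m" "lead_coeff m = 1" "poly m a = 0" "degree m > 0"
    "\<And>g. coeffs_in K g \<Longrightarrow> poly g a = 0 \<Longrightarrow> \<exists>q. coeffs_in K q \<and> g = m * q"
proof -
  let ?P = "\<lambda>p. coeffs_in K p \<and> p \<noteq> 0 \<and> poly p a = 0"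
  obtain p0 :: "'a poly" where p0: "p0 \<noteq> 0" "poly (map_poly to_ac p0) a = 0"
    using alg_closure_algebraic .
  have "?P (map_poly to_ac p0)"
    using p0 K by (auto simp: intermediate_def map_poly_eq_0_iff intro!: coeffs_in_map_poly)
  then obtain p where p: "?P p" and min: "\<And>q. ?P q \<Longrightarrow> degree p \<le> degree q"
    using exists_least_iff[of "\<lambda>n. \<exists>p. degree p = n \<and> ?P p"] by (metis (mono_tags, lifting) not_less)
  define m where "m = smult (inverse (lead_coeff p)) p"
  have m: "coeffs_in K m" "lead_coeff m = 1" "poly m a = 0" "degree m = degree p"
    using p K intermediate_inverse[OF K]
    by (auto simp: m_def coeffs_in_def intermediateD is_subringD)
  have "degree m > 0"
  proof (rule ccontr)
    assume "\<not> degree m > 0"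
    then have "m = [:1:]" using m(2) by (metis degree_eq_zeroE lead_coeff_pCons(2) neq0_conv pCons_0_0)
    then show False using m(3) by simp
  qed
  moreover have "\<exists>q. coeffs_in K q \<and> g = m * q" if g: "coeffs_in K g" "poly g a = 0" for g
  proof -
    obtain q r where qr: "coeffs_in K q" "coeffs_in K r" "g = m * q + r" "r = 0 \<or> degree r < degree m"
      using monic_division[OF intermediateD(1)[OF K] m(1,2) g(1)] .
    have "poly r a = 0" using qr(3) g(2) m(3) by simp
    then have "r = 0" using min[of r] qr m(4) by force
    then show ?thesis using qr by auto
  qed
  ultimately show ?thesis using that m by blast
qed

text \<open>The hypothesis \<open>root\<close> says that every relation satisfied by
  \<open>a\<close> is satisfied by \<open>y\<close> after applying \<open>\<phi>\<close>. This is
  exactly what makes the value at \<open>poly g a\<close> independent of \<open>g\<close>, with no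
  minimal polynomial in sight.\<close>

lemma hom_on_simple_adjoin:
  fixes \<phi> :: "'a::comm_ring_1 \<Rightarrow> 'b::comm_ring_1"
  assumes K: "is_subring K" and \<phi>: "hom_on K \<phi>"
    and root: "\<And>g. coeffs_in K g \<Longrightarrow> poly g a = 0 \<Longrightarrow> poly (map_poly \<phi> g) y = 0"
  obtains \<psi> where "hom_on (simple_adjoin K a) \<psi>" "\<And>x. x \<in> K \<Longrightarrow> \<psi> x = \<phi> x" "\<psi> a = y"
proof -
  define \<psi> where "\<psi> x = (let g = (SOME g. coeffs_in K g \<and> x = poly g a) in poly (map_poly \<phi> g) y)" for x
  note h = hom_onD[OF \<phi> K] and mp = map_poly_hom_on[OF \<phi> K]
  have \<psi>: "\<psi> (poly g a) = poly (map_poly \<phi> g) y" if g: "coeffs_in K g" for g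
  proof -
    define g' where "g' = (SOME g'. coeffs_in K g' \<and> poly g a = poly g' a)"
    have g': "coeffs_in K g'" "poly g a = poly g' a"
      using someI[of "\<lambda>g'. coeffs_in K g' \<and> poly g a = poly g' a" g] g by (auto simp: g'_def)
    have "poly (map_poly \<phi> (g' - g)) y = 0"
      using g g' by (intro root coeffs_in_diff K) auto
    then show ?thesis using mp(2)[OF g'(1) g] by (simp add: \<psi>_def g'_def Let_def)
  qed
  have const: "\<psi> x = \<phi> x" if "x \<in> K" for x
    using \<psi>[of "[:x:]"] that K h by (simp add: map_poly_pCons)
  have "hom_on (simple_adjoin K a) \<psi>"
    unfolding hom_on_def
  proof (intro conjI ballI)
    show "\<psi> 1 = 1" using const[of 1] h K by (simp add: is_subringD)
    fix u v assume "u \<in> simple_adjoin K a" "v \<in> simple_adjoin K a"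
    then obtain f g where fg: "coeffs_in K f" "u = poly f a" "coeffs_in K g" "v = poly g a"
      by (auto simp: simple_adjoin_def)
    have "u + v = poly (f + g) a" "u * v = poly (f * g) a" using fg by auto
    then show "\<psi> (u + v) = \<psi> u + \<psi> v" "\<psi> (u * v) = \<psi> u * \<psi> v"
      using fg \<psi>[OF fg(1)] \<psi>[OF fg(3)] \<psi>[OF coeffs_in_add[OF K fg(1,3)]] \<psi>[OF coeffs_in_mult[OF K fg(1,3)]]
        mp[OF fg(1,3)] by simp_all
  qed
  moreover have "\<psi> a = y" using \<psi>[of "[:0, 1:]"] K h by (simp add: map_poly_pCons is_subringD)
  ultimately show ?thesis using that const by blast
qed

lemma extend_to_simple_adjoin:
  fixes \<phi> :: "'a::field alg_closure \<Rightarrow> 'b::alg_closed_field"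
  assumes K: "intermediate K" and \<phi>: "hom_on K \<phi>"
  obtains \<psi> where "hom_on (simple_adjoin K a) \<psi>" "\<And>x. x \<in> K \<Longrightarrow> \<psi> x = \<phi> x"
proof -
  obtain m where m: "coeffs_in K m" "lead_coeff m = 1" "poly m a = 0" "degree m > 0"
    "\<And>g. coeffs_in K g \<Longrightarrow> poly g a = 0 \<Longrightarrow> \<exists>q. coeffs_in K q \<and> g = m * q"
    using minimal_polynomial[OF K] by metis
  note h = hom_onD[OF \<phi> intermediateD(1)[OF K]]
  have "degree (map_poly \<phi> m) = degree m"
    by (rule map_poly_degree_eq) (use m h in auto)
  then obtain y where y: "poly (map_poly \<phi> m) y = 0"
    using alg_closed_imp_poly_has_root m(4) by metis
  show ?thesis
  proof (rule hom_on_simple_adjoin[OF intermediateD(1)[OF K] \<phi>, of a y])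
    fix g assume "coeffs_in K g" "poly g a = 0"
    then obtain q where "coeffs_in K q" "g = m * q" using m(5) by blast
    then show "poly (map_poly \<phi> g) y = 0"
      using y map_poly_hom_on(3)[OF \<phi> intermediateD(1)[OF K] m(1)] by simp
  qed (use that in blast)
qed

text \<open>Zorn's lemma on partial extensions. They are represented by their graphs, so that
  extension becomes inclusion and the upper bound of a chain is its union.\<close>

theorem extend_to_alg_closure:
  fixes \<phi> :: "'a::field alg_closure \<Rightarrow> 'b::alg_closed_field"
  assumes K: "intermediate K" and \<phi>: "hom_on K \<phi>"
  obtains \<psi> where "hom_on UNIV \<psi>" "\<And>x. x \<in> K \<Longrightarrow> \<psi> x = \<phi> x"
proof -
  define good where "good S \<longleftrightarrow> (\<exists>L \<psi>. intermediate L \<and> hom_on L \<psi> \<and> K \<subseteq> L \<and> (\<forall>x\<in>K. \<psi> x = \<phi> x)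
      \<and> S = (\<lambda>x. (x, \<psi> x)) ` L)" for S :: "('a alg_closure \<times> 'b) set"
  have "\<exists>M\<in>Collect good. (\<forall>Y\<in>Collect good. M \<subseteq> Y \<longrightarrow> Y = M)"
  proof (rule subset_Zorn_nonempty)
    show "Collect good \<noteq> {}" using K \<phi> by (auto simp: good_def)
  next
    fix C assume C: "C \<noteq> {}" "subset.chain (Collect good) C"
    have cmp: "A \<subseteq> Y \<or> Y \<subseteq> A" if "A \<in> C" "Y \<in> C" for A Y
      using C(2) that by (auto simp: subset_chain_def)
    have inC: "good A" if "A \<in> C" for A using C(2) that by (auto simp: subset_chain_def)
    define L where "L = fst ` \<Union>C"
    define \<psi> where "\<psi> x = (THE y. (x, y) \<in> \<Union>C)" for x
    have uniq: "y = y'" if xy: "(x, y) \<in> \<Union>C" "(x, y') \<in> \<Union>C" for x y y'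
    proof -
      obtain A Y where "A \<in> C" "Y \<in> C" "(x, y) \<in> A" "(x, y') \<in> Y" using xy by (meson UnionE)
      then obtain Z where "Z \<in> C" "(x, y) \<in> Z" "(x, y') \<in> Z" using cmp by blast
      then show ?thesis using inC by (auto simp: good_def)
    qed
    have \<psi>: "\<psi> x = y" if "(x, y) \<in> \<Union>C" for x y
      unfolding \<psi>_def using that uniq by blast
    \<comment> \<open>Two elements of the union already lie in the domain of one member of the
      chain, where sums and products can be checked.\<close>
    have two: "\<exists>Z L' \<chi>. Z \<in> C \<and> intermediate L' \<and> hom_on L' \<chi> \<and> K \<subseteq> L' \<and> (\<forall>x\<in>K. \<chi> x = \<phi> x)
        \<and> Z = (\<lambda>x. (x, \<chi> x)) ` L' \<and> u \<in> L' \<and> v \<in> L'" if uv: "u \<in> L" "v \<in> L" for u v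
    proof -
      obtain A Y where "A \<in> C" "Y \<in> C" "u \<in> fst ` A" "v \<in> fst ` Y"
        using uv unfolding L_def by blast
      then obtain Z where Z: "Z \<in> C" "u \<in> fst ` Z" "v \<in> fst ` Z" using cmp by blast
      then obtain L' \<chi> where "intermediate L'" "hom_on L' \<chi>" "K \<subseteq> L'" "\<forall>x\<in>K. \<chi> x = \<phi> x"
        "Z = (\<lambda>x. (x, \<chi> x)) ` L'"
        using inC unfolding good_def by blast
      moreover have "u \<in> L'" "v \<in> L'" using Z \<open>Z = _\<close> by auto
      ultimately show ?thesis using Z(1) by blast
    qed
    have agree: "\<psi> u = \<chi> u" "u \<in> L" if "Z \<in> C" "Z = (\<lambda>x. (x, \<chi> x)) ` L'" "u \<in> L'" for Z \<chi> L' u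
    proof -
      have "(u, \<chi> u) \<in> \<Union>C" using that by blast
      then show "\<psi> u = \<chi> u" "u \<in> L" using \<psi> unfolding L_def by (blast, metis fst_conv imageI)
    qed
    obtain A where "A \<in> C" using C(1) by blast
    then obtain L0 \<psi>0 where L0: "intermediate L0" "hom_on L0 \<psi>0" "K \<subseteq> L0" "\<forall>x\<in>K. \<psi>0 x = \<phi> x"
        "A = (\<lambda>x. (x, \<psi>0 x)) ` L0"
      using inC unfolding good_def by blast
    have sub: "L0 \<subseteq> L" using agree(2)[OF \<open>A \<in> C\<close> L0(5)] by auto
    have "intermediate L"
      unfolding intermediate_def is_subring_def
    proof (intro conjI ballI)
      show "1 \<in> L" "range to_ac \<subseteq> L" using L0 sub by (auto simp: intermediate_def is_subringD)
      fix u assume u: "u \<in> L"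
      from two[OF u u] show "- u \<in> L"
        using agree(2) by (metis intermediateD(1) is_subringD(5))
      fix v assume v: "v \<in> L"
      from two[OF u v] show "u + v \<in> L" "u * v \<in> L"
        using agree(2) by (metis intermediateD(1) is_subringD(3), metis intermediateD(1) is_subringD(4))
    qed
    moreover have "hom_on L \<psi>"
      unfolding hom_on_def
    proof (intro conjI ballI)
      show "\<psi> 1 = 1" using agree(1)[OF \<open>A \<in> C\<close> L0(5), of 1] L0
        by (simp add: intermediateD is_subringD hom_onD)
      fix u v assume "u \<in> L" "v \<in> L"
      from two[OF this] obtain Z L' \<chi> where Z: "Z \<in> C" "intermediate L'" "hom_on L' \<chi>"
        "Z = (\<lambda>x. (x, \<chi> x)) ` L'" "u \<in> L'" "v \<in> L'" by blast
      note ag = agree(1)[OF Z(1,4)]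
      have sr: "is_subring L'" using Z intermediateD by blast
      show "\<psi> (u + v) = \<psi> u + \<psi> v" "\<psi> (u * v) = \<psi> u * \<psi> v"
        using Z hom_onD(3,4)[OF Z(3) sr] is_subringD(3,4)[OF sr] by (simp_all add: ag)
    qed
    moreover have "K \<subseteq> L" "\<forall>x\<in>K. \<psi> x = \<phi> x"
      using L0(3,4) sub agree(1)[OF \<open>A \<in> C\<close> L0(5)] by auto
    moreover have "\<Union>C = (\<lambda>x. (x, \<psi> x)) ` L"
      unfolding L_def using \<psi> by force
    ultimately show "\<Union>C \<in> Collect good" unfolding good_def by blast
  qed
  then obtain M where M: "good M" "\<And>A. good A \<Longrightarrow> M \<subseteq> A \<Longrightarrow> A = M" by blast
  then obtain L \<psi> where L: "intermediate L" "hom_on L \<psi>" "K \<subseteq> L" "\<forall>x\<in>K. \<psi> x = \<phi> x"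
      "M = (\<lambda>x. (x, \<psi> x)) ` L"
    unfolding good_def by blast
  have "a \<in> L" for a
  proof -
    obtain \<chi> where \<chi>: "hom_on (simple_adjoin L a) \<chi>" "\<And>x. x \<in> L \<Longrightarrow> \<chi> x = \<psi> x"
      using extend_to_simple_adjoin[OF L(1,2)] by blast
    have "good ((\<lambda>x. (x, \<chi> x)) ` simple_adjoin L a)"
      unfolding good_def using L \<chi> intermediate_simple_adjoin[OF L(1)] simple_adjoin_mem(1)[of L a]
      by (intro exI[of _ "simple_adjoin L a"] exI[of _ \<chi>]) (auto simp: intermediate_def)
    moreover have "M \<subseteq> (\<lambda>x. (x, \<chi> x)) ` simple_adjoin L a"
      using L(1,5) \<chi>(2) simple_adjoin_mem(1)[of L a] by (auto simp: intermediate_def)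
    \<comment> \<open>Maximality gives equality of the graphs; comparing first components gives
      equality of the domains, hence \<open>a\<close> was there already.\<close>
    ultimately have "(\<lambda>x. (x, \<chi> x)) ` simple_adjoin L a = M" using M(2) by blast
    from arg_cong[OF this, of "\<lambda>Z. fst ` Z"] have "simple_adjoin L a = L"
      unfolding L(5) by (simp add: image_image)
    then show ?thesis using simple_adjoin_mem(2)[of L a] L(1) by (auto simp: intermediate_def)
  qed
  then have "L = UNIV" by blast
  then show ?thesis using that L by blast
qed

section \<open>Endomorphisms over the base field and their fixed elements\<close>

text \<open>Surjectivity is not demanded. Injectivity is automatic, and on a finite stable set of
  roots it already yields a permutation.\<close>

definition endo :: "('a::field alg_closure \<Rightarrow> 'a alg_closure) \<Rightarrow> bool" where
  "endo \<tau> \<longleftrightarrow> hom_on UNIV \<tau> \<and> (\<forall>c. \<tau> (to_ac c) = to_ac c)"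

lemma endo_id: "endo id"
  by (simp add: endo_def hom_on_def)

lemma endo_comp: "endo \<sigma> \<Longrightarrow> endo \<tau> \<Longrightarrow> endo (\<sigma> \<circ> \<tau>)"
  by (simp add: endo_def hom_on_def)

lemma endoD:
  assumes "endo \<tau>"
  shows "hom_on UNIV \<tau>" "\<tau> (to_ac c) = to_ac c" "\<tau> 1 = 1" "\<tau> 0 = 0" "\<tau> (x + y) = \<tau> x + \<tau> y"
    "\<tau> (x * y) = \<tau> x * \<tau> y" "\<tau> (- x) = - \<tau> x" "\<tau> (x - y) = \<tau> x - \<tau> y" "\<tau> x = \<tau> y \<longleftrightarrow> x = y"
    "\<tau> (inverse x) = inverse (\<tau> x)"
proof -
  show *: "hom_on UNIV \<tau>" and "\<tau> (to_ac c) = to_ac c" using assms by (auto simp: endo_def)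
  from hom_onD[OF *] show "\<tau> 1 = 1" "\<tau> 0 = 0" "\<tau> (x + y) = \<tau> x + \<tau> y"
    "\<tau> (x * y) = \<tau> x * \<tau> y" "\<tau> (- x) = - \<tau> x" "\<tau> (x - y) = \<tau> x - \<tau> y" by auto
  from hom_on_UNIV_eq_iff[OF *] show "\<tau> x = \<tau> y \<longleftrightarrow> x = y" .
  from hom_on_UNIV_inverse[OF *] show "\<tau> (inverse x) = inverse (\<tau> x)" .
qed

lemma endo_sum: "endo \<tau> \<Longrightarrow> \<tau> (sum f A) = (\<Sum>i\<in>A. \<tau> (f i))"
  using hom_on_sum[of UNIV \<tau>] endoD(1) by auto

lemma endo_prod: "endo \<tau> \<Longrightarrow> \<tau> (prod f A) = (\<Prod>i\<in>A. \<tau> (f i))"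
  using hom_on_prod[of UNIV \<tau>] endoD(1) by auto

lemma map_poly_endo_base: "endo \<tau> \<Longrightarrow> map_poly \<tau> (map_poly to_ac f) = map_poly to_ac f"
  by (rule poly_eqI) (simp add: coeff_map_poly endoD)

lemma poly_endo: "endo \<tau> \<Longrightarrow> poly (map_poly \<tau> p) (\<tau> x) = \<tau> (poly p x)"
  using poly_map_poly_hom_on[of UNIV \<tau> p x] endoD(1) by auto

lemma poly_endo_base: "endo \<tau> \<Longrightarrow> poly (map_poly to_ac f) (\<tau> x) = \<tau> (poly (map_poly to_ac f) x)"
  using poly_endo[of \<tau> "map_poly to_ac f" x] by (simp add: map_poly_endo_base)

lemma intermediate_fixed: "intermediate {x. \<forall>\<tau>\<in>T. endo \<tau> \<longrightarrow> \<tau> x = x}"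
  by (auto simp: intermediate_def is_subring_def endoD)

section \<open>Polynomials with simple roots\<close>

lemma card_roots_rsquarefree:
  fixes p :: "'a::alg_closed_field poly"
  assumes "rsquarefree p"
  shows "card {x. poly p x = 0} = degree p" "finite {x. poly p x = 0}"
proof -
  have p: "p \<noteq> 0" using assms by (simp add: rsquarefree_def)
  then show "finite {x. poly p x = 0}" by (rule poly_roots_finite)
  obtain A where A: "size A = degree p" "p = smult (lead_coeff p) (\<Prod>x\<in>#A. [:-x, 1:])"
    using alg_closed_imp_factorization[OF p] by blast
  have "proots p = proots (\<Prod>x\<in>#A. [:-x, 1:])"
    using p by (subst A(2)) (simp add: proots_smult)
  also have "\<dots> = A"
  proof (induction A)
    case (add x A)
    have "(\<Prod>x\<in>#A. [:-x, 1:]) \<noteq> 0" by (auto simp: prod_mset_zero_iff)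
    then show ?case using add by (simp add: proots_mult del: mult_pCons_left)
  qed simp
  finally have pr: "proots p = A" .
  have "count A x = order x p" "x \<in># A \<longleftrightarrow> order x p \<noteq> 0" for x
    using p by (simp_all add: order_root flip: pr)
  then have "count A x = (if x \<in># A then 1 else 0)" for x
    using assms[unfolded rsquarefree_def, THEN conjunct2, rule_format, of x] by fastforce
  then have "A = mset_set (set_mset A)"
    by (intro multiset_eqI) (simp add: count_mset_set')
  then have "size A = card (set_mset A)" by (metis size_mset_set)
  moreover have "set_mset A = {x. poly p x = 0}" using p by (simp flip: pr)
  ultimately show "card {x. poly p x = 0} = degree p" using A(1) by simp
qed

text \<open>Unlike \<open>rsquarefree_roots\<close>, this does not need characteristic \<open>0\<close>.\<close>
lemma rsquarefree_iff_pderiv: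
  fixes p :: "'a::field poly"
  shows "rsquarefree p \<longleftrightarrow> (\<forall>a. poly p a = 0 \<longrightarrow> poly (pderiv p) a \<noteq> 0)"
proof (cases "p = 0")
  case p: False
  have "order a p \<le> 1 \<longleftrightarrow> poly (pderiv p) a \<noteq> 0" if a: "poly p a = 0" for a
  proof -
    obtain q where q: "p = [:-a, 1:] * q" using a by (metis dvdE poly_eq_0_iff_dvd)
    have q0: "q \<noteq> 0" using p q by auto
    have "order a p = order a [:-a, 1:] + order a q" using p unfolding q by (rule order_mult)
    also have "order a [:-a, 1:] = 1" using order_power_n_n[of a 1] by simp
    finally have "order a p \<le> 1 \<longleftrightarrow> poly q a \<noteq> 0" using q0 by (simp add: order_root)
    moreover have "poly (pderiv p) a = poly q a"
      unfolding q by (simp add: pderiv_mult pderiv_pCons del: mult_pCons_left)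
    ultimately show ?thesis by simp
  qed
  moreover have "order a p = 0 \<longleftrightarrow> poly p a \<noteq> 0" for a using p by (simp add: order_root)
  ultimately show ?thesis unfolding rsquarefree_def using p by (metis le_numeral_extra(4) less_one nat_less_le zero_le_one)
qed (auto simp: rsquarefree_def)

lemma rsquarefree_prod_linear:
  assumes "finite I" "inj_on a I"
  shows "rsquarefree (\<Prod>i\<in>I. [:- a i, 1:] :: 'a::field poly)"
  unfolding rsquarefree_iff_pderiv
proof safe
  fix x assume x: "poly (\<Prod>i\<in>I. [:- a i, 1:]) x = 0" "poly (pderiv (\<Prod>i\<in>I. [:- a i, 1:])) x = 0"
  then obtain i where i: "i \<in> I" "x = a i" using assms(1) by (auto simp: poly_prod)
  define q where "q = (\<Prod>j\<in>I - {i}. [:- a j, 1:])"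
  have "(\<Prod>j\<in>I. [:- a j, 1:]) = [:- a i, 1:] * q" 
    unfolding q_def using assms(1) i(1) by (rule prod.remove)
  then have "poly q (a i) = 0"
    using x(2) i(2) by (simp add: pderiv_mult pderiv_pCons del: mult_pCons_left)
  then obtain j where "j \<in> I - {i}" "a j = a i" using assms(1) by (fastforce simp: q_def poly_prod)
  then show False using assms(2) i(1) by (auto dest: inj_onD)
qed

lemma rsquarefree_dvd:
  fixes p q :: "'a::field poly"
  assumes "rsquarefree p" "q dvd p"
  shows "rsquarefree q"
proof -
  obtain r where r: "p = q * r" using assms(2) by blast
  have p: "p \<noteq> 0" using assms by (simp add: rsquarefree_def)
  have o: "order a p = order a q + order a r" for a using p r by (simp add: order_mult)
  have "order a q = 0 \<or> order a q = 1" for a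
    using assms(1)[unfolded rsquarefree_def, THEN conjunct2, rule_format, of a] o[of a] by linarith
  then show ?thesis using p r unfolding rsquarefree_def by auto
qed

section \<open>Conjugates and descent\<close>

lemma conjugate_endo:
  assumes K: "intermediate K" and m: "coeffs_in K m" 
    "\<And>g. coeffs_in K g \<Longrightarrow> poly g a = 0 \<Longrightarrow> \<exists>q. coeffs_in K q \<and> g = m * q" and y: "poly m y = 0"
  obtains \<tau> where "endo \<tau>" "\<And>x. x \<in> K \<Longrightarrow> \<tau> x = x" "\<tau> a = y"
proof -
  note sr = intermediateD(1)[OF K]
  obtain \<psi> where \<psi>: "hom_on (simple_adjoin K a) \<psi>" "\<And>x. x \<in> K \<Longrightarrow> \<psi> x = x" "\<psi> a = y"
  proof (rule hom_on_simple_adjoin[OF sr, of "\<lambda>x. x" a y])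
    fix g assume "coeffs_in K g" "poly g a = 0"
    then show "poly (map_poly (\<lambda>x. x) g) y = 0" using m(2) y by fastforce
  qed (use that in \<open>auto simp: hom_on_def\<close>)
  obtain \<tau> where \<tau>: "hom_on UNIV \<tau>" "\<And>x. x \<in> simple_adjoin K a \<Longrightarrow> \<tau> x = \<psi> x"
    using extend_to_alg_closure[OF intermediate_simple_adjoin[OF K] \<psi>(1)] by blast
  have K': "\<tau> x = x" if "x \<in> K" for x
    using that \<tau>(2) \<psi>(2) simple_adjoin_mem(1)[OF sr] by (metis subsetD)
  moreover have "endo \<tau>" using \<tau>(1) K' K by (auto simp: endo_def intermediate_def)
  moreover have "\<tau> a = y" using \<tau>(2) \<psi>(3) simple_adjoin_mem(2)[OF sr] by metis
  ultimately show ?thesis using that by blast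
qed

text \<open>Write \<open>x = poly r a\<close> with \<open>r\<close> of smaller degree than the
  minimal polynomial \<open>m\<close> of \<open>a\<close>. Conjugation moves \<open>a\<close> to any
  root of \<open>m\<close> but fixes \<open>x\<close>, so \<open>r - [:x:]\<close> vanishes at all
  roots of \<open>m\<close>. By separability there are \<open>degree m\<close> of them, so
  \<open>r\<close> is the constant \<open>x\<close>.\<close>

lemma fixed_simple_adjoin:
  assumes K: "intermediate K" and f: "coeffs_in K f" "rsquarefree f" "poly f a = 0"
    and x: "x \<in> simple_adjoin K a"
    and fixed: "\<And>\<tau>. endo \<tau> \<Longrightarrow> (\<And>y. y \<in> K \<Longrightarrow> \<tau> y = y) \<Longrightarrow> \<tau> x = x"
  shows "x \<in> K"
proof -
  obtain m where m: "coeffs_in K m" "lead_coeff m = 1" "poly m a = 0" "degree m > 0"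
    "\<And>g. coeffs_in K g \<Longrightarrow> poly g a = 0 \<Longrightarrow> \<exists>q. coeffs_in K q \<and> g = m * q"
    using minimal_polynomial[OF K] by metis
  obtain g where g: "coeffs_in K g" "x = poly g a" using x by (auto simp: simple_adjoin_def)
  obtain q r where qr: "coeffs_in K q" "coeffs_in K r" "g = m * q + r" "r = 0 \<or> degree r < degree m"
    using monic_division[OF intermediateD(1)[OF K] m(1,2) g(1)] .
  have xr: "x = poly r a" using g qr m by simp
  have "m dvd f" using m(5)[OF f(1,3)] by auto
  then have card: "card {y. poly m y = 0} = degree m"
    using rsquarefree_dvd[OF f(2)] card_roots_rsquarefree(1) by blast
  have "poly r y = x" if y: "poly m y = 0" for y
  proof -
    obtain \<tau> where \<tau>: "endo \<tau>" "\<And>x. x \<in> K \<Longrightarrow> \<tau> x = x" "\<tau> a = y"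
      using conjugate_endo[OF K m(1,5) y] by blast
    have "map_poly \<tau> r = r"
      by (rule poly_eqI) (use \<tau> qr in \<open>simp add: coeff_map_poly endoD coeffs_in_def\<close>)
    then have "poly r y = \<tau> x" using poly_endo[OF \<tau>(1), of r a] xr \<tau>(3) by simp
    then show ?thesis using fixed[OF \<tau>(1,2)] by simp
  qed
  then have sub: "{y. poly m y = 0} \<subseteq> {y. poly (r - [:x:]) y = 0}" by auto
  have "r - [:x:] = 0"
  proof (rule ccontr)
    assume nz: "r - [:x:] \<noteq> 0"
    have "degree m \<le> card {y. poly (r - [:x:]) y = 0}"
      using card_mono[OF poly_roots_finite[OF nz] sub] card by simp
    also have "\<dots> \<le> degree (r - [:x:])" using card_poly_roots_bound[OF nz] .
    also have "\<dots> < degree m" using qr(4) m(4) by (intro degree_diff_less) auto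
    finally show False by simp
  qed
  then have "coeff r 0 = x" by simp
  then show ?thesis using qr(2) by (auto simp: coeffs_in_def)
qed

definition adjoin :: "'a::comm_ring_1 set \<Rightarrow> 'a set \<Rightarrow> 'a set" where
  "adjoin K A = \<Inter>{S. is_subring S \<and> K \<subseteq> S \<and> A \<subseteq> S}"

lemma adjoin_mem: "K \<subseteq> adjoin K A" "A \<subseteq> adjoin K A"
  by (auto simp: adjoin_def)

lemma is_subring_adjoin: "is_subring (adjoin K A)"
  unfolding adjoin_def by (rule is_subring_Inter) auto

lemma adjoin_minimal: "is_subring S \<Longrightarrow> K \<subseteq> S \<Longrightarrow> A \<subseteq> S \<Longrightarrow> adjoin K A \<subseteq> S"
  by (auto simp: adjoin_def)

lemma intermediate_adjoin: "intermediate K \<Longrightarrow> intermediate (adjoin K A)"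
  using adjoin_mem(1)[of K A] is_subring_adjoin by (auto simp: intermediate_def)

lemma adjoin_insert:
  "is_subring K \<Longrightarrow> adjoin K (insert a A) \<subseteq> adjoin (simple_adjoin K a) A"
  using simple_adjoin_mem[of K a] adjoin_mem[where K = "simple_adjoin K a" and A = A]
  by (intro adjoin_minimal is_subring_adjoin) auto

text \<open>The roots are adjoined one at a time, with \<open>K\<close> growing during the
  induction: an endomorphism fixing the larger field also fixes \<open>K\<close>, so the hypothesis
  on \<open>x\<close> survives.\<close>

theorem fixed_adjoin:
  assumes "finite A" "intermediate K" 
    "\<And>a. a \<in> A \<Longrightarrow> coeffs_in K f \<and> rsquarefree f \<and> poly f a = 0"
    "x \<in> adjoin K A" "\<And>\<tau>. endo \<tau> \<Longrightarrow> (\<And>y. y \<in> K \<Longrightarrow> \<tau> y = y) \<Longrightarrow> \<tau> x = x"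
  shows "x \<in> K"
  using assms
proof (induction A arbitrary: K rule: finite_induct)
  case empty
  then show ?case using adjoin_minimal[of K K "{}"] by (auto simp: intermediate_def)
next
  case (insert a A)
  note K = insert.prems(1)
  have sub: "K \<subseteq> simple_adjoin K a" using simple_adjoin_mem(1)[OF intermediateD(1)[OF K]] .
  have "x \<in> simple_adjoin K a"
  proof (rule insert.IH)
    show "intermediate (simple_adjoin K a)" using K by (rule intermediate_simple_adjoin)
    show "x \<in> adjoin (simple_adjoin K a) A"
      using insert.prems(3) adjoin_insert[OF intermediateD(1)[OF K]] by blast
    show "coeffs_in (simple_adjoin K a) f \<and> rsquarefree f \<and> poly f b = 0" if "b \<in> A" for b
      using insert.prems(2)[of b] that coeffs_in_mono[OF _ sub] by auto
    show "\<tau> x = x" if "endo \<tau>" "\<And>y. y \<in> simple_adjoin K a \<Longrightarrow> \<tau> y = y" for \<tau>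
      using insert.prems(4) that sub by blast
  qed
  then show ?case
    using fixed_simple_adjoin[OF K, of f a x] insert.prems(2)[of a] insert.prems(4) by blast
qed

section \<open>Power series and places\<close>

definition fps_over :: "'a::comm_ring_1 set \<Rightarrow> 'a fps set" where
  "fps_over \<kappa> = {f. \<forall>n. fps_nth f n \<in> \<kappa>}"

lemma is_subring_fps_over: "is_subring \<kappa> \<Longrightarrow> is_subring (fps_over \<kappa>)"
  unfolding is_subring_def[of "fps_over \<kappa>"]
  by (auto simp: fps_over_def fps_mult_nth is_subringD intro!: is_subring_sum)

lemma fps_const_in_fps_over: "is_subring \<kappa> \<Longrightarrow> c \<in> \<kappa> \<Longrightarrow> fps_const c \<in> fps_over \<kappa>"
  by (auto simp: fps_over_def is_subringD)

lemma hom_on_fps_nth_0: "hom_on K (\<lambda>f :: 'a::comm_ring_1 fps. fps_nth f 0)"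
  by (simp add: hom_on_def)

lemma fps_X_power_dvd_iff:
  "fps_X ^ m dvd (f :: 'a::comm_ring_1 fps) \<longleftrightarrow> (\<forall>i<m. fps_nth f i = 0)"
proof
  assume "\<forall>i<m. fps_nth f i = 0"
  then have "f = fps_X ^ m * fps_shift m f"
    by (intro fps_ext) (simp add: fps_X_power_mult_nth)
  then show "fps_X ^ m dvd f" by (metis dvd_triv_left)
qed (auto simp: fps_X_power_mult_nth elim!: dvdE)

lemma poly_taylor2:
  fixes p :: "'a::idom poly"
  shows "\<exists>e. poly p (b + d) = poly p b + d * poly (pderiv p) b + d\<^sup>2 * e"
proof (induction p)
  case (pCons a p)
  then obtain e where e: "poly p (b + d) = poly p b + d * poly (pderiv p) b + d\<^sup>2 * e" by blast
  have "poly (pCons a p) (b + d) = poly (pCons a p) b + d * poly (pderiv (pCons a p)) b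
      + d\<^sup>2 * (b * e + poly (pderiv p) b + d * e)"
    by (simp add: e pderiv_pCons algebra_simps power2_eq_square)
  then show ?case by blast
qed simp

lemma dvd_poly_diff: "(a - b) dvd (poly p a - poly p b)" for p :: "'a::comm_ring_1 poly"
proof (induction p)
  case (pCons c p)
  have "poly (pCons c p) a - poly (pCons c p) b = (a - b) * poly p a + b * (poly p a - poly p b)"
    by (simp add: algebra_simps)
  then show ?case using pCons by (simp add: dvd_add)
qed simp

text \<open>Newton iteration with the fixed slope \<open>c\<close>, the inverse derivative at the
  residue \<open>a\<close>. It gains only one order per step, which is enough, and all iterates have
  coefficients in \<open>\<kappa>\<close>. Keeping track of \<open>\<kappa>\<close> is what later
  separates roots over \<open>k\<close> from roots over its closure.\<close>

lemma hensel:
  fixes F :: "'a::field fps poly"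
  assumes \<kappa>: "is_subring \<kappa>" "\<And>x. x \<in> \<kappa> \<Longrightarrow> inverse x \<in> \<kappa>" and F: "coeffs_in (fps_over \<kappa>) F" and a: "a \<in> \<kappa>"
    and root: "poly (map_poly (\<lambda>f. fps_nth f 0) F) a = 0"
    and simple: "poly (pderiv (map_poly (\<lambda>f. fps_nth f 0) F)) a \<noteq> 0"
  obtains \<beta> where "\<beta> \<in> fps_over \<kappa>" "poly F \<beta> = 0" "fps_nth \<beta> 0 = a"
proof -
  note sr = is_subring_fps_over[OF \<kappa>(1)]
  let ?f = "map_poly (\<lambda>f. fps_nth f 0) F"
  have nth0: "fps_nth (poly G b) 0 = poly (map_poly (\<lambda>f. fps_nth f 0) G) (fps_nth b 0)"
    for G :: "'a fps poly" and b
    using poly_map_poly_hom_on[OF hom_on_fps_nth_0[of UNIV], of G b] by simp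
  have pd: "map_poly (\<lambda>f. fps_nth f 0) (pderiv F) = pderiv ?f"
    by (rule poly_eqI) (simp add: coeff_map_poly coeff_pderiv fps_of_nat[symmetric] del: of_nat_Suc)
  define c where "c = inverse (poly (pderiv ?f) a)"
  have f: "coeffs_in \<kappa> ?f" using F by (auto simp: coeffs_in_def coeff_map_poly fps_over_def)
  have nat_in: "of_nat n \<in> \<kappa>" for n by (induction n) (auto simp: is_subringD[OF \<kappa>(1)])
  have "coeffs_in \<kappa> (pderiv ?f)"
    using f nat_in by (auto simp: coeffs_in_def coeff_pderiv simp del: of_nat_Suc intro!: is_subringD(4)[OF \<kappa>(1)])
  then have c: "c \<in> \<kappa>" unfolding c_def by (intro \<kappa>(2) poly_in \<kappa>(1) a)
  define b where "b = rec_nat (fps_const a) (\<lambda>_ b. b - fps_const c * poly F b)"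
  have b0: "b 0 = fps_const a" and bS: "b (Suc m) = b m - fps_const c * poly F (b m)" for m
    by (simp_all add: b_def)
  have b_in: "b m \<in> fps_over \<kappa>" for m
    by (induction m) (auto simp: b0 bS a c intro!: is_subringD(4,6)[OF sr] poly_in[OF sr F] fps_const_in_fps_over[OF \<kappa>(1)])
  have inv: "fps_nth (b m) 0 = a \<and> fps_X ^ Suc m dvd poly F (b m)" for m
  proof (induction m)
    case 0
    have "fps_nth (poly F (fps_const a)) 0 = 0" using root nth0[of F "fps_const a"] by simp
    then show ?case unfolding b0 fps_X_power_dvd_iff by simp
  next
    case (Suc m)
    define d where "d = - (fps_const c * poly F (b m))"
    obtain e where e: "poly F (b m + d) = poly F (b m) + d * poly (pderiv F) (b m) + d\<^sup>2 * e"
      using poly_taylor2 by blast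
    have bd: "b (Suc m) = b m + d" by (simp add: bS d_def)
    \<comment> \<open>In \<open>F(b + d) = F(b) (1 - c F'(b)) + d\<^sup>2 e\<close> the bracket has
      constant term 0 and \<open>d\<close> has the order of \<open>F(b)\<close>, so both summands
      gain at least one order.\<close>
    have "fps_nth (1 - fps_const c * poly (pderiv F) (b m)) 0 = 0"
      using Suc simple by (simp add: nth0 pd c_def)
    then have "fps_X ^ 1 dvd 1 - fps_const c * poly (pderiv F) (b m)"
      unfolding fps_X_power_dvd_iff by simp
    then have 1: "fps_X ^ Suc m * fps_X ^ 1 dvd poly F (b m) * (1 - fps_const c * poly (pderiv F) (b m))"
      using Suc by (intro mult_dvd_mono) auto
    have "fps_X ^ Suc m dvd fps_const c * poly F (b m)" using Suc dvd_mult by blast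
    then have dd: "fps_X ^ Suc m dvd d" unfolding d_def by (metis dvd_minus_iff)
    then have "fps_X ^ Suc m * fps_X ^ Suc m dvd d\<^sup>2" unfolding power2_eq_square using dd by (intro mult_dvd_mono)
    moreover have "(fps_X :: 'a fps) ^ Suc (Suc m) dvd fps_X ^ Suc m * fps_X ^ Suc m"
      unfolding power_add[symmetric] by (rule le_imp_power_dvd) simp
    ultimately have 2: "fps_X ^ Suc (Suc m) dvd d\<^sup>2 * e" using dvd_trans dvd_mult2 by blast
    have "poly F (b (Suc m)) = poly F (b m) * (1 - fps_const c * poly (pderiv F) (b m)) + d\<^sup>2 * e"
      by (simp add: bd e) (simp add: d_def algebra_simps)
    then have "fps_X ^ Suc (Suc m) dvd poly F (b (Suc m))"
      using 1 2 by (simp add: mult.commute dvd_add)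
    moreover have "fps_nth d 0 = 0" using dd unfolding fps_X_power_dvd_iff by auto
    ultimately show ?case using Suc by (simp add: bd)
  qed
  have step: "fps_nth (b (Suc m)) n = fps_nth (b m) n" if "n \<le> m" for m n
  proof -
    have "fps_X ^ Suc m dvd fps_const c * poly F (b m)" using inv[of m] by (auto simp del: power_Suc)
    then show ?thesis using that unfolding fps_X_power_dvd_iff bS by simp
  qed
  have stable: "fps_nth (b m) n = fps_nth (b n) n" if "n \<le> m" for m n
    using that by (induction m rule: dec_induct) (auto simp: step)
  \<comment> \<open>The coefficient at \<open>n\<close> no longer changes from the iterate
    \<open>b n\<close> on, so the diagonal is the limit.\<close>
  define \<beta> where "\<beta> = Abs_fps (\<lambda>n. fps_nth (b n) n)"
  have "fps_X ^ Suc m dvd poly F \<beta>" for m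
  proof -
    have "fps_X ^ Suc m dvd \<beta> - b m"
      unfolding fps_X_power_dvd_iff \<beta>_def using stable[of _ m] by simp
    from dvd_trans[OF this dvd_poly_diff] have "fps_X ^ Suc m dvd poly F \<beta> - poly F (b m)" .
    from dvd_add[OF this conjunct2[OF inv[of m]]] show ?thesis by (simp del: power_Suc)
  qed
  then have "poly F \<beta> = 0"
    unfolding fps_X_power_dvd_iff by (intro fps_ext) auto
  moreover have "\<beta> \<in> fps_over \<kappa>" using b_in by (auto simp: \<beta>_def fps_over_def)
  moreover have "fps_nth \<beta> 0 = a" using b0 by (simp add: \<beta>_def)
  ultimately show ?thesis using that by blast
qed

text \<open>A power series that is a quotient of series over \<open>\<kappa>\<close> is itself over
  \<open>\<kappa>\<close>: comparing coefficients at \<open>n + subdegree b\<close> expresses the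
  coefficient of \<open>c\<close> at \<open>n\<close> through earlier ones.\<close>

lemma fps_over_quotient:
  fixes a b c :: "'a::field fps"
  assumes \<kappa>: "is_subring \<kappa>" "\<And>x. x \<in> \<kappa> \<Longrightarrow> inverse x \<in> \<kappa>"
    and ab: "a \<in> fps_over \<kappa>" "b \<in> fps_over \<kappa>" "b \<noteq> 0" and abc: "c * b = a"
  shows "c \<in> fps_over \<kappa>"
proof -
  define m where "m = subdegree b"
  have bm: "fps_nth b m \<noteq> 0" using ab(3) by (simp add: m_def)
  have "fps_nth c n \<in> \<kappa>" for n
  proof (induction n rule: less_induct)
    case (less n)
    have "fps_nth a (n + m) = (\<Sum>i=0..n+m. fps_nth c i * fps_nth b (n + m - i))"
      by (simp add: abc[symmetric] fps_mult_nth)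
    also have "\<dots> = (\<Sum>i\<in>{0..n}. fps_nth c i * fps_nth b (n + m - i))"
    proof (rule sum.mono_neutral_right)
      have "n + m - i < subdegree b" if "i \<in> {0..n + m} - {0..n}" for i
        using that by (auto simp: m_def)
      then show "\<forall>i\<in>{0..n + m} - {0..n}. fps_nth c i * fps_nth b (n + m - i) = 0"
        using nth_less_subdegree_zero by (metis mult_zero_right)
    qed auto
    also have "\<dots> = (\<Sum>i\<in>{0..<n}. fps_nth c i * fps_nth b (n + m - i)) + fps_nth c n * fps_nth b m"
      by (subst atLeastLessThanSuc_atLeastAtMost[symmetric], subst sum.op_ivl_Suc) simp
    finally have "fps_nth c n = (fps_nth a (n + m) - (\<Sum>i\<in>{0..<n}. fps_nth c i * fps_nth b (n + m - i)))
        * inverse (fps_nth b m)"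
      using bm by (simp add: field_simps)
    also have "\<dots> \<in> \<kappa>"
      using less ab \<kappa> by (auto simp: fps_over_def intro!: is_subringD(4,6)[OF \<kappa>(1)] is_subring_sum[OF \<kappa>(1)])
    finally show ?case .
  qed
  then show ?thesis by (simp add: fps_over_def)
qed

section \<open>Fraction fields and places\<close>

lemma hom_on_fract:
  fixes g :: "'a::idom \<Rightarrow> 'b::field"
  assumes g: "hom_on UNIV g" and inj: "\<And>x. g x = 0 \<Longrightarrow> x = 0"
  obtains h where "hom_on UNIV h" "\<And>x. h (to_fract x) = g x"
proof -
  note G = hom_onD[OF g is_subring_UNIV]
  define h where "h x = (let (a, b) = (SOME (a, b). b \<noteq> 0 \<and> x = Fract a b) in g a / g b)" for x
  have h: "h (Fract a b) = g a / g b" if "b \<noteq> 0" for a b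
  proof -
    obtain a' b' where ab: "(SOME (a', b'). b' \<noteq> 0 \<and> Fract a b = Fract a' b') = (a', b')" by force
    have "b' \<noteq> 0 \<and> Fract a b = Fract a' b'"
      using someI[of "\<lambda>(a', b'). b' \<noteq> 0 \<and> Fract a b = Fract a' b'" "(a, b)"] that ab by auto
    then have "b' \<noteq> 0" "a * b' = a' * b" using that by (auto simp: eq_fract)
    from arg_cong[OF this(2), of g] have "g a * g b' = g a' * g b" by (simp add: G)
    moreover have "g b \<noteq> 0" "g b' \<noteq> 0" using inj that \<open>b' \<noteq> 0\<close> by auto
    ultimately
    show ?thesis by (simp add: h_def ab frac_eq_eq)
  qed
  have "hom_on UNIV h"
    unfolding hom_on_def
  proof (intro conjI ballI)
    show "h 1 = 1" by (simp add: One_fract_def h G)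
    fix x y :: "'a fract"
    obtain a b where "x = Fract a b" "b \<noteq> 0" by (cases x)
    moreover obtain c d where "y = Fract c d" "d \<noteq> 0" by (cases y)
    moreover from calculation have "g b \<noteq> 0" "g d \<noteq> 0" using inj by auto
    ultimately show "h (x + y) = h x + h y" "h (x * y) = h x * h y"
      by (simp_all add: h G field_simps)
  qed
  moreover have "h (to_fract x) = g x" for x by (simp add: to_fract_def h G)
  ultimately show ?thesis using that by blast
qed

lemma intermediate_range_inverse: "x \<in> range to_ac \<Longrightarrow> inverse x \<in> range to_ac"
  by (auto simp flip: to_ac_inverse)

abbreviation poly_to_ac :: "'k::field poly \<Rightarrow> 'k poly fract alg_closure" where
  "poly_to_ac p \<equiv> to_ac (to_fract p)"

lemma hom_on_poly_to_ac: "hom_on UNIV poly_to_ac"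
  by (simp add: hom_on_def)

text \<open>
  The place sends \<open>T\<close> to \<open>t\<close>. It is the constant coefficient map along an embedding of the algebraic
  closure of \<open>k(T)\<close> into an algebraic closure of the Laurent series field in \<open>T - t\<close> over \<open>k\<close>-bar;
  \<open>W\<close> consists of the elements which become Laurent series with coefficients in \<open>k\<close>.
\<close>

theorem place_exists:
  fixes F :: "'k::field poly poly" and \<alpha> :: "'i \<Rightarrow> 'k poly fract alg_closure"
  assumes I: "finite I" and F: "lead_coeff F = 1" "map_poly poly_to_ac F = (\<Prod>i\<in>I. [:- \<alpha> i, 1:])"
    and sep: "rsquarefree (map_poly to_ac (specialize F t))"
  obtains V W and \<pi> :: "'k poly fract alg_closure \<Rightarrow> 'k alg_closure"
  where "is_subring V" "hom_on V \<pi>" "intermediate W"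
    "\<And>p. poly_to_ac p \<in> V" "\<And>p. \<pi> (poly_to_ac p) = to_ac (poly p t)"
    "\<And>i. i \<in> I \<Longrightarrow> \<alpha> i \<in> V"
    "map_poly to_ac (specialize F t) = (\<Prod>i\<in>I. [:- \<pi> (\<alpha> i), 1:])"
    "inj_on (\<lambda>i. \<pi> (\<alpha> i)) I"
    "\<And>i. i \<in> I \<Longrightarrow> \<pi> (\<alpha> i) \<in> range to_ac \<Longrightarrow> \<alpha> i \<in> W"
    "\<And>x. x \<in> V \<Longrightarrow> x \<in> W \<Longrightarrow> \<pi> x \<in> range to_ac"
proof -
  let ?\<kappa> = "range to_ac :: 'k alg_closure set"
  note \<kappa> = intermediateD(1)[OF intermediate_range] intermediate_range_inverse
  note srK = is_subring_fps_over[OF \<kappa>(1)]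
  define e :: "'k alg_closure fps \<Rightarrow> 'k alg_closure fls alg_closure" where "e f = to_ac (fps_to_fls f)" for f
  have e: "hom_on UNIV e" by (simp add: hom_on_def e_def fls_times_fps_to_fls)
  have e_inj: "e f = e g \<longleftrightarrow> f = g" for f g by (simp add: e_def)
  note E = hom_onD[OF e is_subring_UNIV]
  \<comment> \<open>Taylor expansion at \<open>t\<close>: after composing with
    \<open>[:t, 1:]\<close> the series variable stands for \<open>T - t\<close>.\<close>
  define \<psi> :: "'k poly \<Rightarrow> 'k alg_closure fps" where
    "\<psi> p = fps_of_poly (map_poly to_ac (pcompose p [:t, 1:]))" for p
  have mp: "map_poly to_ac (p + q) = map_poly to_ac p + map_poly to_ac q"
    "map_poly to_ac (p * q) = map_poly to_ac p * map_poly to_ac q" for p q :: "'k poly"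
    using map_poly_hom_on[OF hom_on_to_ac is_subring_UNIV] by auto
  have \<psi>: "hom_on UNIV \<psi>"
    by (simp add: hom_on_def \<psi>_def mp pcompose_add pcompose_mult fps_of_poly_add fps_of_poly_mult pcompose_1)
  have \<psi>0: "p = 0" if "\<psi> p = 0" for p
  proof -
    have "map_poly to_ac (pcompose p [:t, 1:]) = 0"
      using that fps_of_poly_eq_iff[of _ 0] by (simp add: \<psi>_def)
    then have "pcompose p [:t, 1:] = 0" by (simp add: map_poly_eq_0_iff)
    then show ?thesis by (simp add: pcompose_eq_0_iff)
  qed
  have \<psi>_in: "\<psi> p \<in> fps_over ?\<kappa>" for p by (simp add: \<psi>_def fps_over_def coeff_map_poly)
  have \<psi>_nth0: "fps_nth (\<psi> p) 0 = to_ac (poly p t)" for p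
    by (simp add: \<psi>_def coeff_map_poly)
  have e\<psi>: "hom_on UNIV (e \<circ> \<psi>)" by (rule hom_on_comp[OF \<psi> e]) simp
  have "p = 0" if "(e \<circ> \<psi>) p = 0" for p using that e_inj[of _ 0] E(2) \<psi>0 by simp
  with e\<psi> obtain h where h: "hom_on UNIV h" "\<And>p. h (to_fract p) = e (\<psi> p)"
    using hom_on_fract[of "e \<circ> \<psi>"] by auto
  have "hom_on (range to_ac) (h \<circ> of_ac)"
    using h(1) by (auto simp: hom_on_def simp flip: to_ac_add to_ac_mult)
  then obtain \<iota> where \<iota>: "hom_on UNIV \<iota>" "\<And>x. x \<in> range to_ac \<Longrightarrow> \<iota> x = (h \<circ> of_ac) x"
    using extend_to_alg_closure[OF intermediate_range] by blast
  have \<iota>p: "\<iota> (poly_to_ac p) = e (\<psi> p)" for p using \<iota>(2)[of "poly_to_ac p"] h(2) by simp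
  note J = hom_onD[OF \<iota>(1) is_subring_UNIV]
  \<comment> \<open>\<open>V\<close> collects the elements that become honest power series, so that
    the constant coefficient makes sense on it.\<close>
  define V where "V = {x. \<iota> x \<in> range e}"
  define \<pi> where "\<pi> x = fps_nth (inv_into UNIV e (\<iota> x)) 0" for x
  have inve: "inv_into UNIV e (e f) = f" for f by (rule inv_f_f) (auto simp: inj_def e_inj)
  have VI: "x \<in> V" "\<pi> x = fps_nth f 0" if "\<iota> x = e f" for x f
    using that by (auto simp: V_def \<pi>_def inve)
  \<comment> \<open>Laurent series over \<open>k\<close> appear as quotients of power series over
    \<open>k\<close>, cross-multiplied to avoid division.\<close>
  define W where "W = {x. \<exists>a\<in>fps_over ?\<kappa>. \<exists>b\<in>fps_over ?\<kappa>. b \<noteq> 0 \<and> \<iota> x * e b = e a}"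
  have subV: "is_subring V"
    unfolding is_subring_def
  proof (intro conjI ballI)
    show "1 \<in> V" using VI(1)[of 1 1] J E by simp
    fix x assume "x \<in> V"
    then obtain f where f: "\<iota> x = e f" by (auto simp: V_def)
    show "- x \<in> V" using VI(1)[of "- x" "- f"] J E f by simp
    fix y assume "y \<in> V"
    then obtain g where g: "\<iota> y = e g" by (auto simp: V_def)
    show "x + y \<in> V" "x * y \<in> V"
      using VI(1)[of "x + y" "f + g"] VI(1)[of "x * y" "f * g"] J E f g by auto
  qed
  have homV: "hom_on V \<pi>"
    unfolding hom_on_def
  proof (intro conjI ballI)
    show "\<pi> 1 = 1" using VI(2)[of 1 1] J E by simp
    fix x y assume "x \<in> V" "y \<in> V"
    then obtain f g where fg: "\<iota> x = e f" "\<iota> y = e g" by (auto simp: V_def)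
    show "\<pi> (x + y) = \<pi> x + \<pi> y" "\<pi> (x * y) = \<pi> x * \<pi> y"
      using VI(2)[of "x + y" "f + g"] VI(2)[of "x * y" "f * g"] VI(2)[OF fg(1)] VI(2)[OF fg(2)] J E fg by auto
  qed
  have W: "intermediate W"
    unfolding intermediate_def is_subring_def
  proof (intro conjI ballI subsetI)
    have WI: "x \<in> W" if "\<iota> x * e b = e a" "a \<in> fps_over ?\<kappa>" "b \<in> fps_over ?\<kappa>" "b \<noteq> 0" for x a b
      using that by (auto simp: W_def)
    show "1 \<in> W" using WI[of 1 1 1] J E is_subringD(1)[OF srK] by simp
    fix x assume "x \<in> W"
    then obtain a b where ab: "a \<in> fps_over ?\<kappa>" "b \<in> fps_over ?\<kappa>" "b \<noteq> 0" "\<iota> x * e b = e a"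
      by (auto simp: W_def)
    show "- x \<in> W" using WI[of "- x" b "- a", OF _ is_subringD(5)[OF srK ab(1)] ab(2,3)] J E ab(4) by simp
    fix y assume "y \<in> W"
    then obtain c d where cd: "c \<in> fps_over ?\<kappa>" "d \<in> fps_over ?\<kappa>" "d \<noteq> 0" "\<iota> y * e d = e c"
      by (auto simp: W_def)
    have nz: "e b \<noteq> 0" "e d \<noteq> 0" using ab cd e_inj[of _ 0] E(2) by auto
    have "\<iota> x = e a / e b" "\<iota> y = e c / e d" using ab(4) cd(4) nz by (simp_all add: field_simps)
    then have "\<iota> (x + y) * e (b * d) = e (a * d + c * b)" "\<iota> (x * y) * e (b * d) = e (a * c)"
      using nz J E by (simp_all add: field_simps)
    moreover have "b * d \<in> fps_over ?\<kappa>" "a * c \<in> fps_over ?\<kappa>" "a * d + c * b \<in> fps_over ?\<kappa>" "b * d \<noteq> 0"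
      using ab cd is_subringD(3,4)[OF srK] by auto
    ultimately show "x + y \<in> W" "x * y \<in> W" using WI by blast+
  next
    fix x :: "'k poly fract alg_closure" assume "x \<in> range to_ac"
    then obtain p q where q: "q \<noteq> 0" "x = to_ac (Fract p q)" by (metis Fract_cases rangeE)
    then have "x * poly_to_ac q = poly_to_ac p"
      by (simp add: to_fract_def eq_fract flip: to_ac_mult)
    then have "\<iota> x * e (\<psi> q) = e (\<psi> p)" using \<iota>p J by (metis UNIV_I)
    then show "x \<in> W" using \<psi>_in \<psi>0 q(1) unfolding W_def by blast
  qed
  define R where "R = {y. poly (map_poly to_ac (specialize F t)) y = 0}"
  define f where "f = map_poly to_ac (specialize F t)"
  define Fs where "Fs = map_poly \<psi> F"
  have Fs0: "map_poly (\<lambda>f. fps_nth f 0) Fs = f"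
    by (rule poly_eqI) (use \<psi>0 in \<open>simp add: Fs_def f_def coeff_map_poly specialize_def \<psi>_nth0 hom_onD[OF \<psi>]\<close>)
  have degF: "degree F = card I"
  proof -
    have "degree F = degree (map_poly poly_to_ac F)" by (rule map_poly_degree_eq[symmetric]) (use F in simp)
    also have "\<dots> = card I" unfolding F(2) by (subst degree_prod_eq_sum_degree) auto
    finally show ?thesis .
  qed
  have degf: "degree f = card I"
  proof -
    have "degree (specialize F t) = degree F" unfolding specialize_def
      by (rule map_poly_degree_eq) (use F in simp)
    moreover have "degree f = degree (specialize F t)" unfolding f_def
      by (rule map_poly_degree_eq) (metis leading_coeff_0_iff to_ac_eq_0_iff map_poly_0 \<open>degree (specialize F t) = degree F\<close> sep rsquarefree_def)
    ultimately show ?thesis using degF by simp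
  qed
  have R: "card R = card I" "finite R"
    using card_roots_rsquarefree[OF sep] degf by (auto simp: R_def f_def)
  have "\<exists>\<beta>. poly Fs \<beta> = 0 \<and> fps_nth \<beta> 0 = y \<and> (y \<in> ?\<kappa> \<longrightarrow> \<beta> \<in> fps_over ?\<kappa>)" if "y \<in> R" for y
  proof -
    have y: "poly f y = 0" "poly (pderiv f) y \<noteq> 0"
      using that sep[unfolded rsquarefree_iff_pderiv] unfolding R_def f_def by blast+
    \<comment> \<open>The coefficient field \<open>K\<close> is left open: over the whole closure
      every root of the fibre lifts, and a root in \<open>k\<close> has a lift over
      \<open>k\<close>.\<close>
    have "\<exists>\<beta>\<in>fps_over K. poly Fs \<beta> = 0 \<and> fps_nth \<beta> 0 = y"
      if K: "is_subring K" "\<And>x. x \<in> K \<Longrightarrow> inverse x \<in> K" "?\<kappa> \<subseteq> K" "y \<in> K" for K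
    proof -
      have "coeffs_in (fps_over K) Fs"
        using \<psi>_in K(3) hom_onD(2)[OF \<psi>] by (auto simp: coeffs_in_def Fs_def coeff_map_poly fps_over_def)
      from hensel[OF K(1,2) this K(4), unfolded Fs0, OF _ y] show ?thesis by blast
    qed
    from this[of UNIV] this[of ?\<kappa>] show ?thesis using \<kappa> by (cases "y \<in> ?\<kappa>") auto
  qed
  then obtain \<beta> where \<beta>: "\<And>y. y \<in> R \<Longrightarrow> poly Fs (\<beta> y) = 0" "\<And>y. y \<in> R \<Longrightarrow> fps_nth (\<beta> y) 0 = y"
    "\<And>y. y \<in> R \<Longrightarrow> y \<in> ?\<kappa> \<Longrightarrow> \<beta> y \<in> fps_over ?\<kappa>"
    by metis
  have "map_poly \<iota> (map_poly poly_to_ac F) = map_poly e Fs"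
    by (rule poly_eqI) (simp add: coeff_map_poly Fs_def \<iota>p J E hom_onD[OF \<psi>])
  then have split: "map_poly e Fs = (\<Prod>i\<in>I. [:- \<iota> (\<alpha> i), 1:])"
    using map_poly_prod_linear[OF \<iota>(1) is_subring_UNIV, of I \<alpha>] F(2) by simp
  \<comment> \<open>The lifts are distinct roots of the image of \<open>F\<close>, and there are
    \<open>card I\<close> of them. Hence they exhaust the \<open>\<iota> (\<alpha> i)\<close>, and
    every root of \<open>F\<close> becomes a power series.\<close>
  have "(\<lambda>y. e (\<beta> y)) ` R \<subseteq> (\<lambda>i. \<iota> (\<alpha> i)) ` I"
  proof clarify
    fix y assume "y \<in> R"
    then have "poly (map_poly e Fs) (e (\<beta> y)) = 0"
      using poly_map_poly_hom_on[OF e is_subring_UNIV, of Fs "\<beta> y"] \<beta>(1) E by simp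
    then show "e (\<beta> y) \<in> (\<lambda>i. \<iota> (\<alpha> i)) ` I"
      using I by (auto simp: split poly_prod)
  qed
  moreover have "inj_on (\<lambda>y. e (\<beta> y)) R"
    by (rule inj_onI) (metis \<beta>(2) e_inj)
  then have "card ((\<lambda>y. e (\<beta> y)) ` R) = card I" using R by (simp add: card_image)
  ultimately have img: "(\<lambda>y. e (\<beta> y)) ` R = (\<lambda>i. \<iota> (\<alpha> i)) ` I"
    using I by (metis card_image_le card_subset_eq finite_imageI card_mono le_antisym)
  have \<alpha>: "\<exists>y\<in>R. \<iota> (\<alpha> i) = e (\<beta> y)" if "i \<in> I" for i
    using img that by (metis (no_types, lifting) imageE imageI)
  have \<alpha>V: "\<alpha> i \<in> V" if "i \<in> I" for i using \<alpha>[OF that] VI by blast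
  have pV: "poly_to_ac p \<in> V" "\<pi> (poly_to_ac p) = to_ac (poly p t)" for p
    using VI[OF \<iota>p] \<psi>_nth0 by auto
  have "map_poly \<pi> (map_poly poly_to_ac F) = f"
    by (rule poly_eqI) (simp add: f_def coeff_map_poly specialize_def pV(2) hom_onD[OF homV subV])
  then have fsplit: "f = (\<Prod>i\<in>I. [:- \<pi> (\<alpha> i), 1:])"
    using map_poly_prod_linear[OF homV subV, of I \<alpha>] F(2) \<alpha>V by simp
  have "R = (\<lambda>i. \<pi> (\<alpha> i)) ` I"
    using I unfolding R_def f_def[symmetric] by (auto simp: fsplit poly_prod)
  then have inj: "inj_on (\<lambda>i. \<pi> (\<alpha> i)) I"
    using R(1) I by (metis eq_card_imp_inj_on)
  have \<alpha>W: "\<alpha> i \<in> W" if i: "i \<in> I" "\<pi> (\<alpha> i) \<in> ?\<kappa>" for i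
  proof -
    obtain y where y: "y \<in> R" "\<iota> (\<alpha> i) = e (\<beta> y)" using \<alpha> i(1) by blast
    then have "\<pi> (\<alpha> i) = y" using VI(2)[OF y(2)] \<beta>(2) by simp
    then have "\<beta> y \<in> fps_over ?\<kappa>" using \<beta>(3) y(1) i(2) by blast
    then show ?thesis
      unfolding W_def using y(2) E(1) is_subringD(1)[OF srK]
      by (intro CollectI bexI[of _ "\<beta> y"] bexI[of _ 1]) auto
  qed
  have VW: "\<pi> x \<in> ?\<kappa>" if x: "x \<in> V" "x \<in> W" for x
  proof -
    obtain c where c: "\<iota> x = e c" using x(1) by (auto simp: V_def)
    obtain a b where ab: "a \<in> fps_over ?\<kappa>" "b \<in> fps_over ?\<kappa>" "b \<noteq> 0" "\<iota> x * e b = e a"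
      using x(2) by (auto simp: W_def)
    have "e (c * b) = e a" using ab(4) c E(4)[of c b] by simp
    then have "c * b = a" by (simp add: e_inj)
    then have "c \<in> fps_over ?\<kappa>" using fps_over_quotient[OF \<kappa> ab(1-3)] by blast
    then show ?thesis using VI(2)[OF c] by (simp add: fps_over_def)
  qed
  show ?thesis
    by (rule that[OF subV homV W pV \<alpha>V fsplit[unfolded f_def] inj \<alpha>W VW])
qed

section \<open>The Galois group as a group of permutations of the roots\<close>

text \<open>The Galois group of the splitting field, represented on the indices of the roots;
  \<open>permutes\<close> makes each element the identity off \<open>I\<close>.\<close>

definition galois_perms :: "'i set \<Rightarrow> ('i \<Rightarrow> 'a::field alg_closure) \<Rightarrow> ('i \<Rightarrow> 'i) set" where
  "galois_perms I \<alpha> = {\<sigma>. \<sigma> permutes I \<and> (\<exists>\<tau>. endo \<tau> \<and> (\<forall>i\<in>I. \<tau> (\<alpha> i) = \<alpha> (\<sigma> i)))}"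

lemma endo_permutes_roots:
  fixes \<alpha> :: "'i \<Rightarrow> 'a::field alg_closure"
  assumes I: "finite I" "inj_on \<alpha> I" and f: "map_poly to_ac f = (\<Prod>i\<in>I. [:- \<alpha> i, 1:])" and \<tau>: "endo \<tau>"
  obtains \<sigma> where "\<sigma> permutes I" "\<And>i. i \<in> I \<Longrightarrow> \<tau> (\<alpha> i) = \<alpha> (\<sigma> i)"
proof -
  have "\<exists>j\<in>I. \<tau> (\<alpha> i) = \<alpha> j" if "i \<in> I" for i
  proof -
    have "poly (map_poly to_ac f) (\<alpha> i) = 0" using that I(1) unfolding f by (auto simp: poly_prod)
    then have "poly (map_poly to_ac f) (\<tau> (\<alpha> i)) = 0" using poly_endo_base[OF \<tau>] endoD[OF \<tau>] by metis
    then show ?thesis unfolding f using I(1) by (auto simp: poly_prod)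
  qed
  then obtain s where s: "\<And>i. i \<in> I \<Longrightarrow> s i \<in> I \<and> \<tau> (\<alpha> i) = \<alpha> (s i)" by metis
  have "inj_on s I"
  proof (rule inj_onI)
    fix i j assume "i \<in> I" "j \<in> I" "s i = s j"
    then have "\<alpha> i = \<alpha> j" using s endoD(9)[OF \<tau>] by metis
    then show "i = j" using \<open>i \<in> I\<close> \<open>j \<in> I\<close> I(2) by (simp add: inj_on_eq_iff)
  qed
  then have "bij_betw s I I"
    using s I(1) by (metis endo_inj_surj bij_betw_def image_subset_iff)
  then have "(\<lambda>i. if i \<in> I then s i else i) permutes I"
    by (intro bij_imp_permutes) (auto cong: bij_betw_cong)
  then show ?thesis using that s by (metis (mono_tags, lifting))
qed

lemma galois_perms_comp: "\<sigma> \<in> galois_perms I \<alpha> \<Longrightarrow> \<rho> \<in> galois_perms I \<alpha> \<Longrightarrow> \<sigma> \<circ> \<rho> \<in> galois_perms I \<alpha>"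
proof -
  assume "\<sigma> \<in> galois_perms I \<alpha>" "\<rho> \<in> galois_perms I \<alpha>"
  then obtain s r where *: "\<sigma> permutes I" "endo s" "\<forall>i\<in>I. s (\<alpha> i) = \<alpha> (\<sigma> i)"
    "\<rho> permutes I" "endo r" "\<forall>i\<in>I. r (\<alpha> i) = \<alpha> (\<rho> i)" by (auto simp: galois_perms_def)
  then have "\<forall>i\<in>I. (s \<circ> r) (\<alpha> i) = \<alpha> ((\<sigma> \<circ> \<rho>) i)" by (simp add: permutes_in_image)
  then show ?thesis
    using endo_comp[OF *(2,5)] permutes_compose[OF *(4,1)] unfolding galois_perms_def by blast
qed

lemma galois_perms_id: "id \<in> galois_perms I \<alpha>"
  using endo_id by (auto simp: galois_perms_def permutes_id intro!: exI[of _ id])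

text \<open>Endomorphisms are not known to be invertible, but a permutation of a finite set has
  finite order, so its inverse is one of its powers.\<close>

lemma galois_perms_inv:
  assumes "finite I" "\<sigma> \<in> galois_perms I \<alpha>"
  shows "inv_into UNIV \<sigma> \<in> galois_perms I \<alpha>"
proof -
  have p: "\<sigma> permutes I" using assms(2) by (simp add: galois_perms_def)
  then have "permutation \<sigma>" using assms(1) by (auto simp: permutation_permutes)
  then obtain n where n: "\<sigma> ^^ n = id" "n > 0" using permutation_is_nilpotent by blast
  then have "\<sigma> ^^ (n - 1) \<circ> \<sigma> = id"
    by (metis Suc_diff_1 funpow_Suc_right)
  then have "inv_into UNIV \<sigma> = \<sigma> ^^ (n - 1)"
    using permutes_bij[OF p] by (metis bij_is_surj comp_assoc comp_id id_comp surj_iff)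
  moreover have "\<sigma> ^^ k \<in> galois_perms I \<alpha>" for k
    by (induction k) (simp_all only: funpow.simps galois_perms_id galois_perms_comp assms(2))
  ultimately show ?thesis by simp
qed

text \<open>The stability of \<open>Q\<close> puts the coefficients of the product of the
  \<open>X - \<alpha> i\<close> over \<open>Q\<close> into the field generated by the roots indexed
  by \<open>J\<close>, hence into \<open>W\<close>. They also lie in \<open>V\<close>, so their
  residues lie in \<open>k\<close>: a stable set of roots reduces to a polynomial over
  \<open>k\<close>.\<close>

lemma place_stable_product:
  fixes \<alpha> :: "'i \<Rightarrow> 'a::field alg_closure" and \<pi> :: "'a alg_closure \<Rightarrow> 'k::field alg_closure"
  assumes I: "finite I" "inj_on \<alpha> I" and f: "map_poly to_ac f = (\<Prod>i\<in>I. [:- \<alpha> i, 1:])"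
    and V: "is_subring V" "hom_on V \<pi>" and W: "intermediate W"
    and \<alpha>V: "\<And>i. i \<in> I \<Longrightarrow> \<alpha> i \<in> V"
    and J: "J \<subseteq> I" "\<And>i. i \<in> J \<Longrightarrow> \<alpha> i \<in> W"
    and VW: "\<And>x. x \<in> V \<Longrightarrow> x \<in> W \<Longrightarrow> \<pi> x \<in> range to_ac"
    and Q: "Q \<subseteq> I" "\<And>\<sigma>. \<sigma> \<in> galois_perms I \<alpha> \<Longrightarrow> (\<And>j. j \<in> J \<Longrightarrow> \<sigma> j = j) \<Longrightarrow> \<sigma> ` Q \<subseteq> Q"
  obtains g where "map_poly to_ac g = (\<Prod>i\<in>Q. [:- \<pi> (\<alpha> i), 1:])"
proof -
  let ?B = "range to_ac :: 'a alg_closure set"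
  define P where "P = (\<Prod>i\<in>Q. [:- \<alpha> i, 1:])"
  define K where "K = adjoin ?B (\<alpha> ` J)"
  have K: "intermediate K" unfolding K_def by (intro intermediate_adjoin intermediate_range)
  have KW: "K \<subseteq> W" unfolding K_def using W J by (intro adjoin_minimal) (auto simp: intermediate_def)
  have PV: "coeffs_in V P" unfolding P_def by (rule coeffs_in_prod_linear[OF V(1)]) (use Q \<alpha>V in auto)
  have "coeffs_in K P"
    unfolding coeffs_in_def
  proof
    fix n
    show "coeff P n \<in> K"
    proof (rule fixed_adjoin[OF finite_imageI[OF I(1)] K])
      show "coeffs_in K (map_poly to_ac f) \<and> rsquarefree (map_poly to_ac f) \<and> poly (map_poly to_ac f) a = 0"
        if "a \<in> \<alpha> ` I" for a
      proof (intro conjI)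
        show "coeffs_in K (map_poly to_ac f)" using K by (auto simp: intermediate_def intro!: coeffs_in_map_poly)
        show "rsquarefree (map_poly to_ac f)" unfolding f using I by (rule rsquarefree_prod_linear)
        show "poly (map_poly to_ac f) a = 0" unfolding f using that I(1) by (auto simp: poly_prod)
      qed
      have "coeffs_in (adjoin K (\<alpha> ` I)) P" unfolding P_def
        by (rule coeffs_in_prod_linear[OF is_subring_adjoin]) (use Q(1) adjoin_mem(2)[of "\<alpha> ` I" K] in fast)
      then show "coeff P n \<in> adjoin K (\<alpha> ` I)" by (simp add: coeffs_in_def)
      \<comment> \<open>An endomorphism over \<open>K\<close> fixes the roots in \<open>J\<close>,
        so its permutation preserves \<open>Q\<close> and only reorders the factors of
        \<open>P\<close>.\<close>
      fix \<tau> assume \<tau>: "endo \<tau>" "\<And>y. y \<in> K \<Longrightarrow> \<tau> y = y"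
      obtain \<sigma> where \<sigma>: "\<sigma> permutes I" "\<And>i. i \<in> I \<Longrightarrow> \<tau> (\<alpha> i) = \<alpha> (\<sigma> i)"
        using endo_permutes_roots[OF I f \<tau>(1)] by blast
      have "\<sigma> \<in> galois_perms I \<alpha>" using \<sigma> \<tau>(1) by (auto simp: galois_perms_def)
      moreover have "\<sigma> j = j" if "j \<in> J" for j
      proof -
        have "\<alpha> j \<in> K" using that adjoin_mem(2)[of "\<alpha> ` J" ?B] by (auto simp: K_def)
        then have "\<alpha> (\<sigma> j) = \<alpha> j" using \<tau>(2)[of "\<alpha> j"] \<sigma>(2)[of j] that J(1) by auto
        then show ?thesis using I(2) that J(1) \<sigma>(1) by (metis inj_on_eq_iff permutes_in_image subsetD)
      qed
      ultimately have "\<sigma> ` Q \<subseteq> Q" using Q(2) by blast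
      then have bij: "bij_betw \<sigma> Q Q"
        using \<sigma>(1) I(1) Q(1) by (metis bij_betw_def endo_inj_surj finite_subset permutes_inj_on)
      have "map_poly \<tau> P = (\<Prod>i\<in>Q. [:- \<tau> (\<alpha> i), 1:])"
        unfolding P_def by (rule map_poly_prod_linear[OF endoD(1)[OF \<tau>(1)]]) auto
      also have "\<dots> = (\<Prod>i\<in>Q. [:- \<alpha> (\<sigma> i), 1:])" using \<sigma>(2) Q(1) by (intro prod.cong) auto
      also have "\<dots> = P" unfolding P_def using prod.reindex_bij_betw[OF bij, of "\<lambda>i. [:- \<alpha> i, 1:]"] .
      finally have "coeff (map_poly \<tau> P) n = coeff P n" by simp
      then show "\<tau> (coeff P n) = coeff P n" using endoD(4)[OF \<tau>(1)] by (simp add: coeff_map_poly)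
    qed
  qed
  then have "coeffs_in (range to_ac) (map_poly \<pi> P)"
    using PV KW VW hom_onD(2)[OF V(2,1)] by (auto simp: coeffs_in_def coeff_map_poly subset_iff)
  then obtain g where "map_poly \<pi> P = map_poly to_ac g"
    by (rule coeffs_in_range_E) auto
  moreover have "map_poly \<pi> P = (\<Prod>i\<in>Q. [:- \<pi> (\<alpha> i), 1:])"
    unfolding P_def by (rule map_poly_prod_linear[OF V(2,1)]) (use Q \<alpha>V in auto)
  ultimately show ?thesis using that by metis
qed

lemma degree_prod_linear: "finite I \<Longrightarrow> degree (\<Prod>i\<in>I. [:- a i, 1:] :: 'a::idom poly) = card I"
  by (subst degree_prod_eq_sum_degree) auto

lemma map_poly_to_ac_eq_iff [simp]: "map_poly to_ac p = map_poly to_ac q \<longleftrightarrow> p = q"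
  by (auto simp: poly_eq_iff coeff_map_poly)

lemma map_poly_to_ac_mult: "map_poly to_ac (p * q) = map_poly to_ac p * map_poly to_ac q"
  using map_poly_hom_on(3)[OF hom_on_to_ac is_subring_UNIV, of p q] by simp

lemma degree_map_poly_to_ac [simp]: "degree (map_poly to_ac p) = degree p"
  by (rule degree_map_poly) auto

lemma irreducible_no_root:
  fixes h :: "'k::field poly"
  assumes "Factorial_Ring.irreducible h" "degree h \<ge> 2"
  shows "poly h a \<noteq> 0"
proof
  assume "poly h a = 0"
  then obtain q where q: "h = [:-a, 1:] * q" by (metis dvdE poly_eq_0_iff_dvd)
  then have "q dvd 1" using Factorial_Ring.irreducibleD[OF assms(1) q] by (auto simp: is_unit_poly_iff)
  then have "degree q = 0" by (auto simp: is_unit_poly_iff)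
  moreover have "degree h = degree [:-a, 1:] + degree q"
    using q assms(1) unfolding Factorial_Ring.irreducible_def by (metis degree_mult_eq mult_zero_left mult_zero_right)
  ultimately show False using assms(2) by simp
qed

text \<open>\<open>J\<close> indexes the roots whose residues lie in \<open>k\<close>. An orbit of
  its pointwise stabilizer on the remaining indices reduces to a factor of \<open>h\<close> over
  \<open>k\<close>; as \<open>h\<close> is irreducible, there is only one orbit.\<close>

lemma stabilizer_transitive:
  fixes F :: "'k::field poly poly" and \<alpha> :: "'i \<Rightarrow> 'k poly fract alg_closure"
  assumes I: "finite I" "inj_on \<alpha> I"
    and F: "lead_coeff F = 1" "map_poly poly_to_ac F = (\<Prod>i\<in>I. [:- \<alpha> i, 1:])"
    and t: "specialize F t = (\<Prod>a\<in>A. [:- a, 1:]) * h" "rsquarefree (map_poly to_ac (specialize F t))"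
    and A: "finite A" and h: "Factorial_Ring.irreducible h" "degree h \<ge> 2" "lead_coeff h = 1"
  obtains J where "J \<subseteq> I" "card (I - J) = degree h"
    "\<And>i j. i \<in> I - J \<Longrightarrow> j \<in> I - J \<Longrightarrow> \<exists>\<sigma>\<in>galois_perms I \<alpha>. (\<forall>l\<in>J. \<sigma> l = l) \<and> \<sigma> i = j"
proof -
  obtain V and \<pi> :: "'k poly fract alg_closure \<Rightarrow> 'k alg_closure" and W
    where V: "is_subring V" "hom_on V \<pi>" and W: "intermediate W"
    and "\<And>p. poly_to_ac p \<in> V" "\<And>p. \<pi> (poly_to_ac p) = to_ac (poly p t)"
    and \<alpha>V: "\<And>i. i \<in> I \<Longrightarrow> \<alpha> i \<in> V"
    and split: "map_poly to_ac (specialize F t) = (\<Prod>i\<in>I. [:- \<pi> (\<alpha> i), 1:])"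
    and inj: "inj_on (\<lambda>i. \<pi> (\<alpha> i)) I"
    and \<alpha>W: "\<And>i. i \<in> I \<Longrightarrow> \<pi> (\<alpha> i) \<in> range to_ac \<Longrightarrow> \<alpha> i \<in> W"
    and VW: "\<And>x. x \<in> V \<Longrightarrow> x \<in> W \<Longrightarrow> \<pi> x \<in> range to_ac"
    by (rule place_exists[OF I(1) F t(2)]) (rule that)
  define J where "J = {i\<in>I. \<pi> (\<alpha> i) \<in> range to_ac}"
  have JI: "J \<subseteq> I" "finite J" using I(1) by (auto simp: J_def)
  have sp: "(\<Prod>i\<in>I. [:- \<pi> (\<alpha> i), 1:]) = (\<Prod>a\<in>A. [:- to_ac a, 1:]) * map_poly to_ac h"
    unfolding split[symmetric] t(1) map_poly_to_ac_mult
    using map_poly_prod_linear[OF hom_on_to_ac is_subring_UNIV, of A "\<lambda>a. a"] by simp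
  have hr: "poly (map_poly to_ac h) (to_ac a) \<noteq> 0" for a
    using irreducible_no_root[OF h(1,2), of a] poly_map_poly_hom_on[OF hom_on_to_ac is_subring_UNIV, of h a]
    by simp
  \<comment> \<open>\<open>h\<close> has no root in \<open>k\<close>, so the residues in
    \<open>k\<close> are precisely the elements of \<open>A\<close>; cancelling them leaves
    \<open>h\<close> as the product over \<open>I - J\<close>.\<close>
  have "bij_betw (\<lambda>i. \<pi> (\<alpha> i)) J (to_ac ` A)"
    unfolding bij_betw_def
  proof
    show "inj_on (\<lambda>i. \<pi> (\<alpha> i)) J" using inj JI(1) by (rule inj_on_subset)
    have "\<pi> (\<alpha> i) \<in> to_ac ` A" if i: "i \<in> J" for i
    proof -
      have "poly (\<Prod>i\<in>I. [:- \<pi> (\<alpha> i), 1:]) (\<pi> (\<alpha> i)) = 0" using i JI I(1) by (auto simp: poly_prod)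
      then show ?thesis using i hr A unfolding sp by (auto simp: J_def poly_prod)
    qed
    moreover have "to_ac a \<in> (\<lambda>i. \<pi> (\<alpha> i)) ` J" if "a \<in> A" for a
    proof -
      have "poly (\<Prod>i\<in>I. [:- \<pi> (\<alpha> i), 1:]) (to_ac a) = 0" unfolding sp using that A by (auto simp: poly_prod)
      then obtain i where "i \<in> I" "\<pi> (\<alpha> i) = to_ac a" using I(1) by (auto simp: poly_prod)
      then show ?thesis by (force simp: J_def)
    qed
    ultimately show "(\<lambda>i. \<pi> (\<alpha> i)) ` J = to_ac ` A" by blast
  qed
  from prod.reindex_bij_betw[OF this, of "\<lambda>x. [:- x, 1:]"]
  have "(\<Prod>i\<in>J. [:- \<pi> (\<alpha> i), 1:]) = (\<Prod>a\<in>A. [:- to_ac a, 1:])"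
    by (simp add: prod.reindex inj_on_def)
  moreover have "(\<Prod>i\<in>I. [:- \<pi> (\<alpha> i), 1:]) = (\<Prod>i\<in>J. [:- \<pi> (\<alpha> i), 1:]) * (\<Prod>i\<in>I - J. [:- \<pi> (\<alpha> i), 1:])"
    using prod.subset_diff[OF JI(1) I(1)] by (simp add: mult.commute)
  moreover have "(\<Prod>a\<in>A. [:- to_ac a, 1:]) \<noteq> 0" using A by auto
  ultimately have hs: "map_poly to_ac h = (\<Prod>i\<in>I - J. [:- \<pi> (\<alpha> i), 1:])"
    using sp by simp
  have cIJ: "card (I - J) = degree h"
    using degree_prod_linear[of "I - J" "\<lambda>i. \<pi> (\<alpha> i)"] I(1) unfolding hs[symmetric] by simp
  have "\<exists>\<sigma>\<in>galois_perms I \<alpha>. (\<forall>l\<in>J. \<sigma> l = l) \<and> \<sigma> i = j" if ij: "i \<in> I - J" "j \<in> I - J" for i j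
  proof -
    define S where "S = {\<sigma> \<in> galois_perms I \<alpha>. \<forall>l\<in>J. \<sigma> l = l}"
    define U where "U = (\<lambda>\<sigma>. \<sigma> i) ` S"
    have Sp: "\<sigma> permutes I" if "\<sigma> \<in> S" for \<sigma> using that by (auto simp: S_def galois_perms_def)
    have SIJ: "\<sigma> x \<in> I - J" if "\<sigma> \<in> S" "x \<in> I - J" for \<sigma> x
    proof -
      have "\<sigma> x \<in> I" using Sp[OF that(1)] that(2) by (simp add: permutes_in_image)
      moreover have "\<sigma> x \<notin> J"
      proof
        assume "\<sigma> x \<in> J"
        then have "\<sigma> (\<sigma> x) = \<sigma> x" using that(1) by (auto simp: S_def)
        then have "\<sigma> x = x" using Sp[OF that(1)] by (metis permutes_inj injD)
        then show False using \<open>\<sigma> x \<in> J\<close> that(2) by simp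
      qed
      ultimately show ?thesis by simp
    qed
    have S_comp: "\<sigma> \<circ> \<rho> \<in> S" if "\<sigma> \<in> S" "\<rho> \<in> S" for \<sigma> \<rho>
      using that galois_perms_comp by (auto simp: S_def)
    have S_inv: "inv_into UNIV \<sigma> \<in> S" if "\<sigma> \<in> S" for \<sigma>
      using that galois_perms_inv[OF I(1)] Sp[OF that] by (auto simp: S_def permutes_inverses permutes_inv_eq)
    have UI: "U \<subseteq> I - J" using SIJ ij(1) by (auto simp: U_def)
    have "id \<in> S" using galois_perms_id by (simp add: S_def)
    from imageI[OF this, of "\<lambda>\<sigma>. \<sigma> i"] have iU: "i \<in> U" unfolding U_def by simp
    have U1: "\<sigma> ` U \<subseteq> U" if "\<sigma> \<in> S" for \<sigma>
    proof clarify
      fix x assume "x \<in> U"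
      then obtain \<rho> where "\<rho> \<in> S" "x = \<rho> i" by (auto simp: U_def)
      then have "\<sigma> x = (\<sigma> \<circ> \<rho>) i" by simp
      then show "\<sigma> x \<in> U" using S_comp[OF that \<open>\<rho> \<in> S\<close>] unfolding U_def by blast
    qed
    have U2: "\<sigma> ` (I - J - U) \<subseteq> I - J - U" if "\<sigma> \<in> S" for \<sigma>
    proof clarify
      fix x assume x: "x \<in> I" "x \<notin> J" "x \<notin> U"
      have "\<sigma> x \<notin> U"
      proof
        assume "\<sigma> x \<in> U"
        then have "inv_into UNIV \<sigma> (\<sigma> x) \<in> U" using U1[OF S_inv[OF that]] by blast
        then show False using x(3) Sp[OF that] by (simp add: permutes_inverses)
      qed
      then show "\<sigma> x \<in> I - J - U" using SIJ[OF that, of x] x by auto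
    qed
    have stab: "\<exists>g. map_poly to_ac g = (\<Prod>i\<in>Q. [:- \<pi> (\<alpha> i), 1:])"
      if Q: "Q \<subseteq> I" "\<And>\<sigma>. \<sigma> \<in> S \<Longrightarrow> \<sigma> ` Q \<subseteq> Q" for Q
    proof -
      have mF: "map_poly to_ac (map_poly to_fract F) = (\<Prod>i\<in>I. [:- \<alpha> i, 1:])"
        using F(2) by (simp add: map_poly_map_poly o_def)
      show ?thesis
      proof (rule place_stable_product[OF I mF V W \<alpha>V JI(1) _ VW Q(1)])
        show "\<sigma> ` Q \<subseteq> Q" if "\<sigma> \<in> galois_perms I \<alpha>" "\<And>j. j \<in> J \<Longrightarrow> \<sigma> j = j" for \<sigma>
          using Q(2)[of \<sigma>] that by (auto simp: S_def)
        show "\<alpha> i \<in> W" if "i \<in> J" for i using that \<alpha>W by (auto simp: J_def)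
      qed auto
    qed
    \<comment> \<open>The orbit \<open>U\<close> and its complement in \<open>I - J\<close> are both
      stable and yield complementary factors of \<open>h\<close>. As \<open>U\<close> contains
      \<open>i\<close>, the complement must be empty.\<close>
    have "U \<subseteq> I" using UI by blast
    from stab[OF this U1] obtain g where g: "map_poly to_ac g = (\<Prod>i\<in>U. [:- \<pi> (\<alpha> i), 1:])" by blast
    from stab[OF _ U2] obtain g' where g': "map_poly to_ac g' = (\<Prod>i\<in>I - J - U. [:- \<pi> (\<alpha> i), 1:])" by blast
    have "map_poly to_ac h = map_poly to_ac (g * g')"
      unfolding map_poly_to_ac_mult g g' hs using prod.subset_diff[OF UI, of "\<lambda>i. [:- \<pi> (\<alpha> i), 1:]"] I(1)
      by (simp add: mult.commute)
    then have "h = g * g'" by simp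
    from Factorial_Ring.irreducibleD[OF h(1) this] have "degree g = 0 \<or> degree g' = 0" by (auto simp: is_unit_poly_iff)
    moreover have "degree g = card U" "degree g' = card (I - J - U)"
      using degree_prod_linear[of U "\<lambda>i. \<pi> (\<alpha> i)"] degree_prod_linear[of "I - J - U" "\<lambda>i. \<pi> (\<alpha> i)"] UI I(1)
        finite_subset[OF \<open>U \<subseteq> I\<close>]
      unfolding g[symmetric] g'[symmetric] by simp_all
    moreover have "card U \<noteq> 0" using iU finite_subset[OF \<open>U \<subseteq> I\<close> I(1)] by auto
    ultimately have "I - J - U = {}" using I(1) by simp
    then have "j \<in> U" using ij(2) by blast
    then show ?thesis by (auto simp: U_def S_def)
  qed
  then show ?thesis using that JI(1) cIJ by blast
qed

lemma map_poly_specialize: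
  "specialize (map_poly (\<lambda>c. [:c:]) f) t = f"
  by (rule poly_eqI) (simp add: specialize_def coeff_map_poly)

lemma specialize_hom:
  "specialize (P + Q) t = specialize P t + specialize Q t"
  "specialize (P * Q) t = specialize P t * specialize Q t"
  "specialize (P - Q) t = specialize P t - specialize Q t"
  "specialize (smult c P) t = smult (poly c t) (specialize P t)"
proof -
  have "hom_on UNIV (\<lambda>c :: 'a poly. poly c t)" by (simp add: hom_on_def)
  from map_poly_hom_on[OF this is_subring_UNIV, of P Q]
  show "specialize (P + Q) t = specialize P t + specialize Q t"
    "specialize (P * Q) t = specialize P t * specialize Q t"
    "specialize (P - Q) t = specialize P t - specialize Q t"
    by (simp_all add: specialize_def)
  show "specialize (smult c P) t = smult (poly c t) (specialize P t)"
    by (rule poly_eqI) (simp add: specialize_def coeff_map_poly)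
qed

lemma transpose_conj:
  assumes "\<rho> permutes I"
  shows "\<rho> \<circ> Transposition.transpose x y \<circ> inv_into UNIV \<rho> = Transposition.transpose (\<rho> x) (\<rho> y)"
proof -
  have b: "bij \<rho>" using assms by (rule permutes_bij)
  have "Transposition.transpose (\<rho> x) (\<rho> y) \<circ> \<rho> = \<rho> \<circ> Transposition.transpose x y"
    using transpose_comp_eq[OF b, of "\<rho> x" "\<rho> y"] permutes_inverses[OF assms] by simp
  then show ?thesis using b by (metis bij_is_surj comp_assoc comp_id surj_iff)
qed

text \<open>The three fibres make the group transitive, make a point stabilizer transitive, and provide a
  transposition.\<close>

lemma galois_perms_symmetric:
  fixes F :: "'k::field poly poly" and \<alpha> :: "'i \<Rightarrow> 'k poly fract alg_closure"
  assumes I: "finite I" "inj_on \<alpha> I" "card I \<ge> 3"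
    and F: "lead_coeff F = 1" "map_poly poly_to_ac F = (\<Prod>i\<in>I. [:- \<alpha> i, 1:])"
    and irr: "\<And>h. h \<in> {h0, h1, h2} \<Longrightarrow> Factorial_Ring.irreducible h \<and> lead_coeff h = 1"
    and deg: "degree h0 = card I" "degree h1 = card I - 1" "degree h2 = 2"
    and t0: "specialize F t0 = h0" "rsquarefree (map_poly to_ac (specialize F t0))"
    and t1: "specialize F t1 = [:- a, 1:] * h1" "rsquarefree (map_poly to_ac (specialize F t1))"
    and t2: "specialize F t2 = (\<Prod>a\<in>A. [:- a, 1:]) * h2" "rsquarefree (map_poly to_ac (specialize F t2))"
    and A: "finite A"
    and \<sigma>: "\<sigma> permutes I"
  shows "\<sigma> \<in> galois_perms I \<alpha>"
proof -
  let ?G = "galois_perms I \<alpha>"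
  have Gp: "\<rho> permutes I" if "\<rho> \<in> ?G" for \<rho> using that by (simp add: galois_perms_def)
  have irr': "Factorial_Ring.irreducible h0" "lead_coeff h0 = 1" "Factorial_Ring.irreducible h1" "lead_coeff h1 = 1"
    "Factorial_Ring.irreducible h2" "lead_coeff h2 = 1"
    using irr[of h0] irr[of h1] irr[of h2] by blast+
  have d: "degree h0 \<ge> 2" "degree h1 \<ge> 2" "degree h2 \<ge> 2" using deg I(3) by linarith+
  have t0': "specialize F t0 = (\<Prod>a\<in>{}. [:- a, 1:]) * h0" using t0 by simp
  have t1': "specialize F t1 = (\<Prod>a\<in>{a}. [:- a, 1:]) * h1" using t1 by simp
  obtain J0 where J0: "J0 \<subseteq> I" "card (I - J0) = card I"
    "\<And>i j. i \<in> I - J0 \<Longrightarrow> j \<in> I - J0 \<Longrightarrow> \<exists>\<sigma>\<in>?G. (\<forall>l\<in>J0. \<sigma> l = l) \<and> \<sigma> i = j"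
    by (rule stabilizer_transitive[OF I(1,2) F t0' t0(2) _ irr'(1) d(1) irr'(2)]) (use deg in auto)
  obtain J1 where J1: "J1 \<subseteq> I" "card (I - J1) = card I - 1"
    "\<And>i j. i \<in> I - J1 \<Longrightarrow> j \<in> I - J1 \<Longrightarrow> \<exists>\<sigma>\<in>?G. (\<forall>l\<in>J1. \<sigma> l = l) \<and> \<sigma> i = j"
    by (rule stabilizer_transitive[OF I(1,2) F t1' t1(2) _ irr'(3) d(2) irr'(4)]) (use deg in auto)
  obtain J2 where J2: "J2 \<subseteq> I" "card (I - J2) = 2"
    "\<And>i j. i \<in> I - J2 \<Longrightarrow> j \<in> I - J2 \<Longrightarrow> \<exists>\<sigma>\<in>?G. (\<forall>l\<in>J2. \<sigma> l = l) \<and> \<sigma> i = j"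
    by (rule stabilizer_transitive[OF I(1,2) F t2 A irr'(5) d(3) irr'(6)]) (use deg in auto)
  \<comment> \<open>The degrees of the irreducible factors determine the fixed sets: empty over
    \<open>t0\<close>, a single point \<open>p\<close> over \<open>t1\<close>.\<close>
  have "card I = card I - card J0" "card I - 1 = card I - card J1" "card J0 \<le> card I" "card J1 \<le> card I"
    using card_Diff_subset[OF finite_subset[OF J0(1) I(1)] J0(1)]
      card_Diff_subset[OF finite_subset[OF J1(1) I(1)] J1(1)] J0(2) J1(2)
      card_mono[OF I(1) J0(1)] card_mono[OF I(1) J1(1)] by simp_all
  then have "card J0 = 0" "card J1 = 1" using I(3) by linarith+
  then have "J0 = {}" using finite_subset[OF J0(1) I(1)] by simp
  obtain p where p: "J1 = {p}" using \<open>card J1 = 1\<close> card_1_singletonE by blast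
  then have pI: "p \<in> I" using J1(1) by simp
  obtain x y where xy: "I - J2 = {x, y}" "x \<noteq> y" using J2(2) by (meson card_2_iff)
  then have xyI: "x \<in> I" "y \<in> I" by auto
  have "\<exists>\<rho>\<in>?G. \<rho> u = v" if "u \<in> I" "v \<in> I" for u v using J0(3)[of u v] that \<open>J0 = {}\<close> by auto
  note trans = this
  \<comment> \<open>Double transitivity: move \<open>x\<close> and \<open>u\<close> to
    \<open>p\<close>, then match the images of \<open>y\<close> and \<open>v\<close> by an element
    fixing \<open>p\<close>.\<close>
  have trans2: "\<exists>\<rho>\<in>?G. \<rho> x = u \<and> \<rho> y = v" if uv: "u \<in> I" "v \<in> I" "u \<noteq> v" for u v
  proof -
    obtain r1 r2 where r: "r1 \<in> ?G" "r1 x = p" "r2 \<in> ?G" "r2 u = p" using trans xyI uv pI by meson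
    note r1 = Gp[OF r(1)] and r2 = Gp[OF r(3)]
    have "r1 y \<in> I - J1" using r1 r(2) xyI xy(2) p by (auto simp: permutes_in_image) (metis permutes_inj injD)
    moreover have "r2 v \<in> I - J1" using r2 r(4) uv p by (auto simp: permutes_in_image) (metis permutes_inj injD)
    ultimately obtain s where s: "s \<in> ?G" "s p = p" "s (r1 y) = r2 v" using J1(3) p by blast
    have "inv_into UNIV r2 \<circ> (s \<circ> r1) \<in> ?G"
      by (intro galois_perms_comp galois_perms_inv[OF I(1)] r(1,3) s(1))
    moreover have "(inv_into UNIV r2 \<circ> (s \<circ> r1)) x = u" "(inv_into UNIV r2 \<circ> (s \<circ> r1)) y = v"
      using s r permutes_inverses(2)[OF r2] by auto (metis \<open>r2 u = p\<close>)
    ultimately show ?thesis by blast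
  qed
  \<comment> \<open>Outside \<open>J2\<close> only \<open>x\<close> and \<open>y\<close> are left,
    so an element fixing \<open>J2\<close> and sending \<open>x\<close> to \<open>y\<close> has no
    choice at \<open>y\<close>. By double transitivity its conjugates are all transpositions, and
    these generate.\<close>
  have txy: "Transposition.transpose x y \<in> ?G"
  proof -
    obtain \<rho> where \<rho>: "\<rho> \<in> ?G" "\<forall>l\<in>J2. \<rho> l = l" "\<rho> x = y" using J2(3)[of x y] xy by auto
    have "\<rho> y \<notin> J2"
    proof
      assume "\<rho> y \<in> J2"
      then have "\<rho> (\<rho> y) = \<rho> y" using \<rho>(2) by blast
      then have "\<rho> y = y" using Gp[OF \<rho>(1)] by (metis permutes_inj injD)
      then show False using \<open>\<rho> y \<in> J2\<close> xy by auto
    qed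
    moreover have "\<rho> y \<in> I" using Gp[OF \<rho>(1)] xyI by (simp add: permutes_in_image)
    moreover have "\<rho> y \<noteq> y" using Gp[OF \<rho>(1)] xy(2) \<rho>(3) by (metis permutes_inj injD)
    ultimately have "\<rho> y = x" using xy by auto
    then have "\<rho> z = Transposition.transpose x y z" for z
      using \<rho>(2,3) xy Gp[OF \<rho>(1)] by (cases "z = x"; cases "z = y"; cases "z \<in> I")
        (auto simp: permutes_not_in)
    then have "\<rho> = Transposition.transpose x y" by blast
    then show ?thesis using \<rho>(1) by simp
  qed
  have tr: "Transposition.transpose u v \<in> ?G" if uv: "u \<in> I" "v \<in> I" "u \<noteq> v" for u v
  proof -
    obtain \<rho> where \<rho>: "\<rho> \<in> ?G" "\<rho> x = u" "\<rho> y = v" using trans2 uv by meson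
    have "\<rho> \<circ> Transposition.transpose x y \<circ> inv_into UNIV \<rho> \<in> ?G"
      using \<rho>(1) txy galois_perms_inv[OF I(1)] by (intro galois_perms_comp)
    then show ?thesis using transpose_conj[OF Gp[OF \<rho>(1)], of x y] \<rho> by simp
  qed
  show ?thesis using \<sigma> I(1)
  proof (induction rule: permutes_induct)
    case id
    show ?case by (rule galois_perms_id)
  next
    case (swap a b q)
    then show ?case using tr galois_perms_comp by blast
  qed
qed

section \<open>Irreducible polynomials over a Hilbertian field\<close>

text \<open>The trinomial \<open>X\<^sup>m + T X + T\<close>. Without the linear term in
  \<open>X\<close> it would be inseparable whenever the characteristic divides
  \<open>m\<close>.\<close>

definition eisenstein :: "nat \<Rightarrow> 'k::field poly poly" where
  "eisenstein m = monom 1 m + [:[:0, 1:], [:0, 1:]:]"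

lemma degree_eisenstein: "m \<ge> 2 \<Longrightarrow> degree (eisenstein m :: 'k::field poly poly) = m"
  unfolding eisenstein_def by (subst degree_add_eq_left) (auto simp: degree_monom_eq)

lemma lead_coeff_eisenstein: "m \<ge> 2 \<Longrightarrow> lead_coeff (eisenstein m :: 'k::field poly poly) = 1"
  by (simp add: degree_eisenstein) (simp add: eisenstein_def coeff_pCons numeral_2_eq_2 split: nat.splits)

text \<open>Eisenstein's argument at the prime T. As the polynomial is monic, both factors have unit
  leading coefficients, so no statement about contents is needed, and setting \<open>T = 0\<close>
  preserves their degrees. Both divide \<open>X\<^sup>m\<close> there, so both constant coefficients
  are divisible by T, contradicting that their product is T.\<close>

lemma irreducible_eisenstein:
  assumes m: "m \<ge> 2"
  shows "Factorial_Ring.irreducible (eisenstein m :: 'k::field poly poly)"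
proof -
  let ?P = "eisenstein m :: 'k poly poly"
  note deg = degree_eisenstein[OF m, where ?'k = 'k] and lc = lead_coeff_eisenstein[OF m, where ?'k = 'k]
  show ?thesis
  proof (rule Factorial_Ring.irreducibleI)
    show "?P \<noteq> 0" using deg m by auto
    show "\<not> is_unit ?P" using deg m by (auto simp: is_unit_poly_iff)
    fix A B assume AB: "?P = A * B"
    have lcAB: "lead_coeff A * lead_coeff B = 1" using lc AB lead_coeff_mult by metis
    have nz: "A \<noteq> 0" "B \<noteq> 0" using lcAB by auto
    have const: "is_unit C" if "degree C = 0" "is_unit (lead_coeff C)" for C :: "'k poly poly"
      using that by (metis degree_eq_zeroE is_unit_pCons_iff lead_coeff_pCons(2) pCons_0_0 is_unit_const_poly_iff)
    show "is_unit A \<or> is_unit B"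
    proof (rule ccontr)
      assume c: "\<not> (is_unit A \<or> is_unit B)"
      have "is_unit (lead_coeff A)" "is_unit (lead_coeff B)"
        using lcAB by (metis dvd_triv_left, metis dvd_triv_right)
      then have d: "degree A > 0" "degree B > 0" and lu: "is_unit (lead_coeff A)" "is_unit (lead_coeff B)"
        using const[of A] const[of B] c by fast+
      have sP: "specialize ?P 0 = monom 1 m"
        by (rule poly_eqI) (auto simp: eisenstein_def specialize_def coeff_map_poly coeff_pCons split: nat.splits)
      have zero: "poly (coeff C 0) 0 = 0" if C: "degree C > 0" "is_unit (lead_coeff C)" "specialize C 0 dvd monom 1 m"
        for C :: "'k poly poly"
      proof -
        have "poly (lead_coeff C) 0 \<noteq> 0" using C(2) by (auto simp: is_unit_poly_iff)
        then have "degree (specialize C 0) = degree C" unfolding specialize_def by (rule map_poly_degree_eq)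
        then obtain z where z: "poly (map_poly to_ac (specialize C 0)) z = 0"
          using alg_closed_imp_poly_has_root[of "map_poly to_ac (specialize C 0)"] C(1) by auto
        obtain Q where "monom 1 m = specialize C 0 * Q" using C(3) by blast
        then have "map_poly to_ac (monom 1 m) = map_poly to_ac (specialize C 0) * map_poly to_ac Q"
          by (simp add: map_poly_to_ac_mult)
        then have "poly (map_poly to_ac (monom 1 m)) z = 0" using z by simp
        then have "z = 0" using m by (simp add: map_poly_monom poly_monom)
        then have "coeff (specialize C 0) 0 = 0" using z by (simp add: poly_0_coeff_0 coeff_map_poly)
        then show ?thesis by (simp add: specialize_def coeff_map_poly)
      qed
      have "monom 1 m = specialize A 0 * specialize B 0" using sP AB specialize_hom(2) by metis
      then have "poly (coeff A 0) 0 = 0" "poly (coeff B 0) 0 = 0" using zero d lu by auto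
      then obtain a b where ab: "coeff A 0 = pCons 0 a" "coeff B 0 = pCons 0 b"
        by (metis pCons_cases poly_0_coeff_0 coeff_pCons_0)
      have "coeff ?P 0 = coeff A 0 * coeff B 0" by (simp add: AB coeff_mult_0)
      then have "[:0, 1:] = pCons 0 a * pCons 0 b" using m ab by (simp add: eisenstein_def)
      then have "coeff [:0, 1:] 1 = coeff (pCons 0 a * pCons 0 b) 1" by simp
      then show False by simp
    qed
  qed
qed

text \<open>Substituting \<open>s = - m x\<^sup>m\<^sup>-\<^sup>1\<close> from the second equation
  into the first leaves \<open>(1 - m) x = m\<close>. So apart from \<open>s = 0\<close> only one
  parameter can produce a double root, and it comes from the constants. A transcendental T avoids
  it, and so do all but two values in \<open>k\<close>.\<close>

lemma trinomial_double_root: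
  fixes x s :: "'b::field" and \<phi> :: "'k::field \<Rightarrow> 'b"
  assumes "x ^ m + s * x + s = 0" "of_nat m * x ^ (m - 1) + s = 0" "s \<noteq> 0" "m \<ge> 2" and \<phi>: "hom_on UNIV \<phi>"
  shows "s = \<phi> (- of_nat m * (of_nat m / (1 - of_nat m)) ^ (m - 1))"
proof -
  note H = hom_onD[OF \<phi> is_subring_UNIV]
  have n: "\<phi> (of_nat n) = of_nat n" for n by (induction n) (simp_all add: H)
  obtain n where m: "m = Suc n" using assms(4) by (cases m) auto
  have s: "s = - (of_nat m * x ^ n)" using assms(2) m by (simp add: eq_neg_iff_add_eq_0 add.commute)
  have "x \<noteq> 0" using assms(1,3,4) by (auto simp: power_0_left)
  have "x ^ n * ((1 - of_nat m) * x - of_nat m) = x ^ m + s * x + s"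
    unfolding s m by (simp add: algebra_simps)
  then have e: "(1 - of_nat m) * x = of_nat m" using assms(1) \<open>x \<noteq> 0\<close> by simp
  have "(1 - of_nat m :: 'b) \<noteq> 0" using e by auto
  then have "x = of_nat m / (1 - of_nat m)" using e by (simp add: field_simps)
  also have "\<dots> = \<phi> (of_nat m / (1 - of_nat m))"
    by (simp only: divide_inverse H(1,4,6) UNIV_I hom_on_UNIV_inverse[OF \<phi>] n)
  finally have x: "x = \<phi> (of_nat m / (1 - of_nat m))" .
  show ?thesis
    by (simp only: s x m diff_Suc_1 hom_on_power[OF \<phi> is_subring_UNIV] H(4,5) UNIV_I n mult_minus_left)
qed

text \<open>Stated for an arbitrary \<open>h\<close> so that it covers both the generic fibre, with
  \<open>poly_to_ac\<close>, and the fibre at \<open>t\<close>, with evaluation followed by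
  \<open>to_ac\<close>.\<close>

lemma rsquarefree_eisenstein:
  fixes h :: "'k::field poly \<Rightarrow> 'b::field"
  assumes h: "hom_on UNIV h" and m: "m \<ge> 2"
    and T: "h [:0, 1:] \<noteq> 0" "h [:0, 1:] \<noteq> h [:- of_nat m * (of_nat m / (1 - of_nat m)) ^ (m - 1):]"
  shows "rsquarefree (map_poly h (eisenstein m))"
  unfolding rsquarefree_iff_pderiv
proof safe
  fix x assume x: "poly (map_poly h (eisenstein m)) x = 0" "poly (pderiv (map_poly h (eisenstein m))) x = 0"
  note H = hom_onD[OF h is_subring_UNIV]
  have "map_poly h (eisenstein m) = monom 1 m + [:h [:0, 1:], h [:0, 1:]:]"
    unfolding eisenstein_def
    by (subst map_poly_hom_on(1)[OF h is_subring_UNIV]) (simp_all add: map_poly_monom map_poly_pCons H)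
  then have "x ^ m + h [:0, 1:] * x + h [:0, 1:] = 0" "of_nat m * x ^ (m - 1) + h [:0, 1:] = 0"
    using x by (simp_all add: poly_monom pderiv_add pderiv_monom pderiv_pCons algebra_simps)
  moreover have "hom_on UNIV (\<lambda>a. h [:a:])"
    using H(3)[of "[:_:]" "[:_:]"] H(4)[of "[:_:]" "[:_:]"] H(1) by (simp add: hom_on_def one_pCons)
  ultimately show False using trinomial_double_root[OF _ _ T(1) m, of x "\<lambda>a. h [:a:]"] T(2) by simp
qed

lemma hilbertian_irreducible:
  assumes k: "hilbertian TYPE('k::field)" and m: "m \<ge> 2"
  obtains h :: "'k::field poly" where "Factorial_Ring.irreducible h" "lead_coeff h = 1" "degree h = m"
    "rsquarefree (map_poly to_ac h)" "infinite (UNIV :: 'k::field set)"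
proof -
  let ?P = "eisenstein m :: 'k poly poly"
  define c where "c = (- of_nat m * (of_nat m / (1 - of_nat m)) ^ (m - 1) :: 'k)"
  have "rsquarefree (map_poly poly_to_ac ?P)"
    by (rule rsquarefree_eisenstein[OF hom_on_poly_to_ac m]) auto
  then have "separable_poly (map_poly to_fract ?P)"
    by (simp add: separable_poly_def map_poly_map_poly o_def)
  then have inf: "infinite {t. Factorial_Ring.irreducible (specialize ?P t)}"
    using k irreducible_eisenstein[OF m] degree_eisenstein[OF m, where ?'k = 'k] m
    unfolding hilbertian_def by fastforce
  \<comment> \<open>A double root can occur only at the parameters \<open>0\<close> and
    \<open>c\<close>; discarding them makes the irreducible specialization separable even over an
    imperfect field.\<close>
  then have "infinite ({t. Factorial_Ring.irreducible (specialize ?P t)} - {0, c})" by simp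
  then obtain t where t: "Factorial_Ring.irreducible (specialize ?P t)" "t \<noteq> 0" "t \<noteq> c"
    by (metis (no_types, lifting) Diff_iff infinite_imp_nonempty insertCI mem_Collect_eq ex_in_conv)
  have ev: "hom_on UNIV (\<lambda>c. to_ac (poly c t))" by (simp add: hom_on_def)
  have "map_poly to_ac (specialize ?P t) = map_poly (\<lambda>c. to_ac (poly c t)) ?P"
    by (simp add: specialize_def map_poly_map_poly o_def)
  moreover have "rsquarefree (map_poly (\<lambda>c. to_ac (poly c t)) ?P)"
    by (rule rsquarefree_eisenstein[OF ev m])
       (use t in \<open>simp_all add: c_def del: to_ac_minus to_ac_mult to_ac_power to_ac_divide to_ac_of_nat\<close>)
  moreover have "degree (specialize ?P t) = m"
    unfolding specialize_def using lead_coeff_eisenstein[OF m, where ?'k = 'k] degree_eisenstein[OF m, where ?'k = 'k]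
    by (subst map_poly_degree_eq) auto
  moreover have "lead_coeff (specialize ?P t) = 1"
    using lead_coeff_eisenstein[OF m, where ?'k = 'k]
    by (simp only: \<open>degree (specialize ?P t) = m\<close> degree_eisenstein[OF m])
       (simp add: specialize_def coeff_map_poly)
  moreover have "infinite (UNIV :: 'k set)" using inf finite_subset[OF subset_UNIV] by blast
  ultimately show ?thesis using that t(1) by metis
qed

section \<open>A polynomial over $k(T)$ with symmetric Galois group\<close>

lemma rsquarefree_mult:
  fixes p q :: "'a::field poly"
  assumes "rsquarefree p" "rsquarefree q" "\<And>x. poly p x = 0 \<Longrightarrow> poly q x \<noteq> 0"
  shows "rsquarefree (p * q)"
  using assms unfolding rsquarefree_iff_pderiv by (auto simp: pderiv_mult)

lemma split_linear_factors:
  fixes p :: "'a::alg_closed_field poly"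
  assumes "lead_coeff p = 1"
  obtains \<alpha> :: "nat \<Rightarrow> 'a" where "p = (\<Prod>i<degree p. [:- \<alpha> i, 1:])"
proof -
  have "p \<noteq> 0" using assms by auto
  then obtain A where A: "size A = degree p" "p = smult (lead_coeff p) (\<Prod>x\<in>#A. [:-x, 1:])"
    using alg_closed_imp_factorization by blast
  obtain xs where xs: "mset xs = A" using ex_mset by blast
  have "p = (\<Prod>x\<in>#A. [:-x, 1:])" using A(2) assms by simp
  also have "\<dots> = (\<Prod>i<length xs. [:- (xs ! i), 1:])"
    unfolding xs[symmetric] by (simp add: prod_mset_prod_list prod.list_conv_set_nth atLeast0LessThan flip: mset_map)
  also have "length xs = degree p" using A(1) xs by auto
  finally show ?thesis using that by blast
qed

text \<open>Lagrange interpolation at the nodes 0, 1 and \<open>c\<close>, written as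
  \<open>f0\<close> plus corrections. The differences of monic polynomials of equal degree have
  smaller degree, so the result stays monic of that degree.\<close>

lemma interpolate_three:
  fixes f0 f1 f2 :: "'k::field poly"
  assumes c: "c \<noteq> 0" "c \<noteq> 1" and "lead_coeff f0 = 1" "lead_coeff f1 = 1" "lead_coeff f2 = 1"
    "degree f1 = degree f0" "degree f2 = degree f0"
  obtains F where "lead_coeff F = 1" "degree F = degree f0"
    "specialize F 0 = f0" "specialize F 1 = f1" "specialize F c = f2"
proof -
  let ?L = "map_poly (\<lambda>c :: 'k. [:c:])"
  define C where "C = [:0, 1:] * [:- c, 1:] * [:1 / (1 - c):]"
  define D where "D = [:0, 1:] * [:- 1, 1:] * [:1 / (c * (c - 1)):]"
  define F where "F = ?L f0 + (smult C (?L (f1 - f0)) + smult D (?L (f2 - f0)))"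
  have cf: "coeff F n = [:coeff f0 n:] + C * [:coeff f1 n - coeff f0 n:] + D * [:coeff f2 n - coeff f0 n:]" for n
    by (simp add: F_def coeff_map_poly)
  have "coeff F n = 0" if "n > degree f0" for n
    using that assms(6,7) by (simp add: cf coeff_eq_0)
  moreover have top: "coeff F (degree f0) = 1" using assms(3-7) by (simp add: cf one_pCons)
  ultimately have deg: "degree F = degree f0"
    by (metis degree_le le_antisym le_degree zero_neq_one)
  have "specialize F t = f0 + (smult (poly C t) (f1 - f0) + smult (poly D t) (f2 - f0))" for t
    by (simp add: F_def specialize_hom map_poly_specialize)
  moreover have "poly C 0 = 0" "poly D 0 = 0" "poly C 1 = 1" "poly D 1 = 0" "poly C c = 0" "poly D c = 1"
  proof -
    have C: "poly C t = t * (t - c) * (1 / (1 - c))" and D: "poly D t = t * (t - 1) * (1 / (c * (c - 1)))" for t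
      unfolding C_def D_def by (simp_all only: poly_mult) simp_all
    have "1 - c \<noteq> 0" "c * (c - 1) \<noteq> 0" using c by auto
    then show "poly C 0 = 0" "poly D 0 = 0" "poly C 1 = 1" "poly D 1 = 0" "poly C c = 0" "poly D c = 1"
      unfolding C D by simp_all
  qed
  ultimately show ?thesis using that[of F] deg top by simp
qed

theorem symmetric_over_function_field:
  fixes n :: nat
  assumes k: "hilbertian TYPE('k::field)" and n: "n \<ge> 3"
  obtains F :: "'k::field poly poly" and \<alpha> where "lead_coeff F = 1"
    "map_poly poly_to_ac F = (\<Prod>i<n. [:- \<alpha> i, 1:])" "inj_on \<alpha> {..<n}"
    "\<And>\<sigma>. \<sigma> permutes {..<n} \<Longrightarrow> \<sigma> \<in> galois_perms {..<n} \<alpha>" "infinite (UNIV :: 'k::field set)"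
proof -
  obtain h0 :: "'k poly" where h0: "Factorial_Ring.irreducible h0" "lead_coeff h0 = 1" "degree h0 = n"
    "rsquarefree (map_poly to_ac h0)" and inf: "infinite (UNIV :: 'k set)"
    by (rule hilbertian_irreducible[OF k, of n]) (use n in auto)
  obtain h1 :: "'k poly" where h1: "Factorial_Ring.irreducible h1" "lead_coeff h1 = 1" "degree h1 = n - 1"
    "rsquarefree (map_poly to_ac h1)"
    by (rule hilbertian_irreducible[OF k, of "n - 1"]) (use n in auto)
  obtain h2 :: "'k poly" where h2: "Factorial_Ring.irreducible h2" "lead_coeff h2 = 1" "degree h2 = 2"
    "rsquarefree (map_poly to_ac h2)"
    by (rule hilbertian_irreducible[OF k, of 2]) auto
  obtain A :: "'k set" where A: "finite A" "card A = n - 2"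
    using infinite_arbitrarily_large[OF inf] by blast
  have "infinite (UNIV - {0, 1 :: 'k})" using inf by simp
  then obtain c :: 'k where c: "c \<noteq> 0" "c \<noteq> 1"
    by (metis Diff_iff ex_in_conv infinite_imp_nonempty insertCI)
  \<comment> \<open>The linear factors have roots in \<open>k\<close>, where the irreducible
    \<open>h\<close> of degree at least 2 does not vanish, so the two factors share no root.\<close>
  have sq: "rsquarefree (map_poly to_ac ((\<Prod>a\<in>B. [:- a, 1:]) * h))"
    if B: "finite B" and h: "Factorial_Ring.irreducible h" "degree h \<ge> 2" "rsquarefree (map_poly to_ac h)"
    for B and h :: "'k poly"
  proof -
    have e: "map_poly to_ac (\<Prod>a\<in>B. [:- a, 1:]) = (\<Prod>a\<in>B. [:- to_ac a, 1:])"
      using map_poly_prod_linear[OF hom_on_to_ac is_subring_UNIV, of B "\<lambda>a. a"] by simp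
    show ?thesis unfolding map_poly_to_ac_mult e
    proof (rule rsquarefree_mult[OF rsquarefree_prod_linear])
      fix x assume "poly (\<Prod>a\<in>B. [:- to_ac a, 1:]) x = 0"
      then obtain a where "x = to_ac a" using B by (auto simp: poly_prod)
      then show "poly (map_poly to_ac h) x \<noteq> 0"
        using irreducible_no_root[OF h(1,2), of a] poly_map_poly_hom_on[OF hom_on_to_ac is_subring_UNIV, of h a]
        by simp
    qed (use B h in \<open>auto simp: inj_on_def\<close>)
  qed
  define f1 where "f1 = [:- 0, 1:] * h1"
  define f2 where "f2 = (\<Prod>a\<in>A. [:- a, 1:]) * h2"
  have nz: "h1 \<noteq> 0" "h2 \<noteq> 0" using h1(2) h2(2) by auto
  have d1: "degree f1 = n" unfolding f1_def using n h1(3) nz by (subst degree_mult_eq) auto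
  have d2: "degree f2 = n" unfolding f2_def using n h2(3) nz A
    by (subst degree_mult_eq) (auto simp: degree_prod_linear)
  have l1: "lead_coeff f1 = 1" unfolding f1_def lead_coeff_mult using h1(2) by simp
  have l2: "lead_coeff f2 = 1" unfolding f2_def lead_coeff_mult lead_coeff_prod using h2(2) by simp
  obtain F where F: "lead_coeff F = 1" "degree F = n"
    "specialize F 0 = h0" "specialize F 1 = f1" "specialize F c = f2"
    by (rule interpolate_three[OF c h0(2) l1 l2]) (use h0 d1 d2 in auto)
  have "degree (map_poly poly_to_ac F) = degree F" by (rule map_poly_degree_eq) (use F in simp)
  moreover have "lead_coeff (map_poly poly_to_ac F) = 1"
    using F(1) calculation by (simp add: coeff_map_poly)
  ultimately obtain \<alpha> where \<alpha>: "map_poly poly_to_ac F = (\<Prod>i<n. [:- \<alpha> i, 1:])"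
    using split_linear_factors[of "map_poly poly_to_ac F"] F(2) by metis
  have sq0: "rsquarefree (map_poly to_ac (specialize F 0))" using F(3) h0(4) by simp
  have sq1: "rsquarefree (map_poly to_ac (specialize F 1))"
    using sq[of "{0}" h1] h1 n unfolding F(4) f1_def by simp
  have sq2: "rsquarefree (map_poly to_ac (specialize F c))"
    using sq[of A h2] h2 A unfolding F(5) f2_def by simp
  \<comment> \<open>Distinctness of the generic roots is inherited from the fibre at 0, whose roots
    are their residues.\<close>
  have inj: "inj_on \<alpha> {..<n}"
  proof (rule place_exists[OF _ F(1) \<alpha> sq0])
    fix \<pi> :: "'k poly fract alg_closure \<Rightarrow> 'k alg_closure"
    assume "inj_on (\<lambda>i. \<pi> (\<alpha> i)) {..<n}"
    then show "inj_on \<alpha> {..<n}" by (auto simp: inj_on_def)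
  qed auto
  have "\<sigma> \<in> galois_perms {..<n} \<alpha>" if "\<sigma> permutes {..<n}" for \<sigma>
    by (rule galois_perms_symmetric[OF _ inj _ F(1) \<alpha> _ _ _ _ F(3) sq0 F(4)[unfolded f1_def] sq1
          F(5)[unfolded f2_def] sq2 A(1) that])
       (use n h0 h1 h2 in auto)
  then show ?thesis using that F(1) \<alpha> inj inf by blast
qed

section \<open>Specialization\<close>

lemma fixed_in_base:
  fixes \<alpha> :: "'i \<Rightarrow> 'a::field alg_closure"
  assumes I: "finite I" "inj_on \<alpha> I" and f: "map_poly to_ac f = (\<Prod>i\<in>I. [:- \<alpha> i, 1:])"
    and x: "x \<in> adjoin (range to_ac) (\<alpha> ` I)" and fixed: "\<And>\<tau>. endo \<tau> \<Longrightarrow> \<tau> x = x"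
  shows "x \<in> range to_ac"
proof (rule fixed_adjoin[OF finite_imageI[OF I(1)] intermediate_range _ x])
  fix a assume a: "a \<in> \<alpha> ` I"
  have "coeffs_in (range to_ac) (map_poly to_ac f)" by (rule coeffs_in_map_poly) auto
  moreover have "rsquarefree (map_poly to_ac f)" unfolding f using I by (rule rsquarefree_prod_linear)
  moreover have "poly (map_poly to_ac f) a = 0" unfolding f using a I(1) by (auto simp: poly_prod)
  ultimately show "coeffs_in (range to_ac) (map_poly to_ac f) \<and> rsquarefree (map_poly to_ac f)
      \<and> poly (map_poly to_ac f) a = 0" by blast
qed (rule fixed)

section \<open>Denominators, separable fibres and primitive elements\<close>

lemma clear_denominators:
  fixes q :: "'a::idom fract poly"
  obtains d P where "d \<noteq> 0" "smult (to_fract d) q = map_poly to_fract P"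
proof -
  have "\<exists>d P. d \<noteq> 0 \<and> smult (to_fract d) q = map_poly to_fract P"
  proof (induction q)
    case 0
    then show ?case by (intro exI[of _ 1] exI[of _ 0]) auto
  next
    case (pCons a q)
    then obtain d P where dP: "d \<noteq> 0" "smult (to_fract d) q = map_poly to_fract P" by blast
    obtain u v where uv: "a = Fract u v" "v \<noteq> 0" by (cases a)
    have "to_fract v * a = to_fract u" using uv by (simp add: to_fract_def eq_fract)
    then have "smult (to_fract (d * v)) (pCons a q) = map_poly to_fract (pCons (d * u) (smult v P))"
      using dP(2) by (simp add: map_poly_pCons fract_poly_smult smult_smult[symmetric] mult.commute[of "to_fract d"] mult.assoc
          del: smult_smult)
    then show ?case using dP uv by (metis mult_eq_0_iff)
  qed
  then show ?thesis using that by blast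
qed

lemma specialize_pderiv: "specialize (pderiv F) t = pderiv (specialize F t)"
  by (rule poly_eqI) (simp add: specialize_def coeff_map_poly coeff_pderiv of_nat_poly del: of_nat_Suc)

lemma map_poly_pderiv:
  fixes h :: "'a::idom \<Rightarrow> 'b::idom"
  assumes "hom_on UNIV h"
  shows "map_poly h (pderiv F) = pderiv (map_poly h F)"
proof -
  note H = hom_onD[OF assms is_subring_UNIV]
  have "h (of_nat n) = of_nat n" for n by (induction n) (simp_all add: H)
  then show ?thesis
    by (intro poly_eqI) (simp add: coeff_map_poly coeff_pderiv H del: of_nat_Suc)
qed

text \<open>A Bezout identity \<open>G F' = d + F q\<close> over \<open>k[T]\<close>, obtained by writing \<open>1 / F' (\<alpha>)\<close> as a polynomial
  in a root \<open>\<alpha>\<close> of \<open>F\<close>.\<close>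

lemma separable_specializations:
  fixes F :: "'k::field poly poly" and \<alpha> :: "'i \<Rightarrow> 'k poly fract alg_closure"
  assumes I: "finite I" "inj_on \<alpha> I" "i0 \<in> I"
    and F: "lead_coeff F = 1" "map_poly poly_to_ac F = (\<Prod>i\<in>I. [:- \<alpha> i, 1:])"
    and trans: "\<And>i. i \<in> I \<Longrightarrow> \<exists>\<tau>. endo \<tau> \<and> \<tau> (\<alpha> i0) = \<alpha> i"
  obtains d where "d \<noteq> 0" "\<And>t. poly d t \<noteq> 0 \<Longrightarrow> rsquarefree (map_poly to_ac (specialize F t))"
proof -
  let ?F = "map_poly poly_to_ac F"
  have mp: "map_poly poly_to_ac F = map_poly to_ac (map_poly to_fract F)" for F :: "'k poly poly"
    by (simp add: map_poly_map_poly o_def)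
  have pd: "pderiv ?F = map_poly poly_to_ac (pderiv F)"
    by (rule map_poly_pderiv[OF hom_on_poly_to_ac, symmetric])
  let ?K = "simple_adjoin (range to_ac) (\<alpha> i0)"
  have "rsquarefree ?F" unfolding F using I by (intro rsquarefree_prod_linear)
  moreover have "poly ?F (\<alpha> i0) = 0" unfolding F using I by (auto simp: poly_prod)
  ultimately have nz: "poly (pderiv ?F) (\<alpha> i0) \<noteq> 0" unfolding rsquarefree_iff_pderiv by blast
  have K: "intermediate ?K" by (rule intermediate_simple_adjoin[OF intermediate_range])
  have "coeffs_in (range to_ac) (map_poly poly_to_ac (pderiv F))"
    unfolding mp by (rule coeffs_in_map_poly) auto
  then have "poly (pderiv ?F) (\<alpha> i0) \<in> ?K"
    unfolding pd simple_adjoin_def by blast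
  then have "inverse (poly (pderiv ?F) (\<alpha> i0)) \<in> ?K" by (rule intermediate_inverse[OF K])
  then obtain g where g: "coeffs_in (range to_ac) g" "inverse (poly (pderiv ?F) (\<alpha> i0)) = poly g (\<alpha> i0)"
    by (auto simp: simple_adjoin_def)
  obtain g0 where g0: "g = map_poly to_ac g0" using g(1) by (rule coeffs_in_range_E) auto
  obtain d G where dG: "d \<noteq> 0" "smult (to_fract d) g0 = map_poly to_fract G" by (rule clear_denominators)
  have "map_poly to_ac (smult (to_fract d) g0) = smult (poly_to_ac d) g"
    unfolding g0 by (rule poly_eqI) (simp add: coeff_map_poly)
  then have G: "map_poly poly_to_ac G = smult (poly_to_ac d) g" using dG(2) mp by metis
  \<comment> \<open>\<open>G\<close> is \<open>d\<close> times a polynomial taking the value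
    \<open>1 / F'\<close> at \<open>\<alpha> i0\<close>, so the left side vanishes there and, by
    transitivity, at every root. Division by the monic \<open>F\<close> stays over
    \<open>k[T]\<close>; the remainder then has more roots than its degree permits and
    vanishes.\<close>
  obtain q r where qr: "G * pderiv F - [:d:] = F * q + r" "r = 0 \<or> degree r < degree F"
    using monic_division[OF is_subring_UNIV coeffs_in_UNIV F(1) coeffs_in_UNIV] by metis
  note mph = map_poly_hom_on[OF hom_on_poly_to_ac is_subring_UNIV coeffs_in_UNIV coeffs_in_UNIV]
  have "poly (map_poly poly_to_ac r) (\<alpha> i) = 0" if i: "i \<in> I" for i
  proof -
    obtain \<tau> where \<tau>: "endo \<tau>" "\<tau> (\<alpha> i0) = \<alpha> i" using trans[OF i] by blast
    have "poly (pderiv ?F) (\<alpha> i0) * poly g (\<alpha> i0) = 1" using g(2) nz by (metis right_inverse)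
    then have "\<tau> (poly (pderiv ?F) (\<alpha> i0)) * \<tau> (poly g (\<alpha> i0)) = 1"
      using endoD(3,6)[OF \<tau>(1)] by metis
    moreover have "\<tau> (poly (pderiv ?F) (\<alpha> i0)) = poly (pderiv ?F) (\<alpha> i)"
      using poly_endo_base[OF \<tau>(1), of "map_poly to_fract (pderiv F)" "\<alpha> i0"] \<tau>(2)
      unfolding pd mp[of "pderiv F"] by simp
    moreover have "\<tau> (poly g (\<alpha> i0)) = poly g (\<alpha> i)"
      using poly_endo_base[OF \<tau>(1), of g0 "\<alpha> i0"] \<tau>(2) unfolding g0 by simp
    ultimately have "poly (pderiv ?F) (\<alpha> i) * poly g (\<alpha> i) = 1" by simp
    moreover have "poly ?F (\<alpha> i) = 0" unfolding F using i I by (auto simp: poly_prod)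
    moreover have "map_poly poly_to_ac (G * pderiv F - [:d:]) =
        smult (poly_to_ac d) g * pderiv ?F - [:poly_to_ac d:]"
      unfolding mph pd G by (simp add: map_poly_pCons)
    moreover have "map_poly poly_to_ac (G * pderiv F - [:d:]) = ?F * map_poly poly_to_ac q + map_poly poly_to_ac r"
      unfolding qr(1) mph ..
    ultimately show ?thesis by (metis (no_types, lifting) diff_self mult.commute mult.right_neutral mult_zero_left
        add_0 poly_add poly_diff poly_mult poly_smult poly_pCons poly_0 mult_zero_right add.right_neutral mult.assoc)
  qed
  then have sub: "\<alpha> ` I \<subseteq> {x. poly (map_poly poly_to_ac r) x = 0}" by auto
  have "r = 0"
  proof (rule ccontr)
    assume "r \<noteq> 0"
    then have nz: "map_poly poly_to_ac r \<noteq> 0" by (simp add: map_poly_eq_0_iff)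
    have "degree ?F = degree F" by (rule map_poly_degree_eq) (use F in simp)
    then have "degree F = card I" unfolding F(2) using degree_prod_linear[OF I(1), of \<alpha>] by simp
    also have "\<dots> = card (\<alpha> ` I)" using I(2) by (simp add: card_image)
    also have "\<dots> \<le> card {x. poly (map_poly poly_to_ac r) x = 0}"
      by (rule card_mono[OF poly_roots_finite[OF nz] sub])
    also have "\<dots> \<le> degree (map_poly poly_to_ac r)" by (rule card_poly_roots_bound[OF nz])
    also have "\<dots> \<le> degree r" by (rule map_poly_degree_leq)
    finally show False using qr(2) \<open>r \<noteq> 0\<close> by simp
  qed
  have "rsquarefree (map_poly to_ac (specialize F t))" if t: "poly d t \<noteq> 0" for t
    unfolding rsquarefree_iff_pderiv
  proof safe
    let ?s = "\<lambda>P. map_poly to_ac (specialize P t)"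
    fix x assume x: "poly (?s F) x = 0" "poly (pderiv (?s F)) x = 0"
    have "poly (?s (pderiv F)) x = 0"
      using x(2) unfolding specialize_pderiv map_poly_pderiv[OF hom_on_to_ac] .
    \<comment> \<open>The identity over \<open>k[T]\<close> can be specialized: at a common root of
      the fibre and its derivative it reads \<open>poly d t = 0\<close>.\<close>
    moreover have "?s (G * pderiv F - [:d:]) = ?s (F * q)" using qr(1) \<open>r = 0\<close> by simp
    moreover have "?s (G * pderiv F - [:d:]) = ?s G * ?s (pderiv F) - [:to_ac (poly d t):]"
      unfolding specialize_hom map_poly_hom_on[OF hom_on_to_ac is_subring_UNIV coeffs_in_UNIV coeffs_in_UNIV]
      by (simp add: specialize_def map_poly_pCons)
    moreover have "?s (F * q) = ?s F * ?s q" by (simp add: specialize_hom map_poly_to_ac_mult)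
    ultimately have "to_ac (poly d t) = 0" using x(1)
      by (metis (no_types, lifting) diff_0 mult_zero_right mult_zero_left neg_equal_0_iff_equal poly_diff poly_mult
          poly_pCons poly_0 add.right_neutral)
    then show False using t by simp
  qed
  then show ?thesis using that dG(1) by blast
qed

text \<open>A primitive element whose weights are powers of a single \<open>c\<close>. Because the
  exponents \<open>b i\<close> are distinct, each difference of two such sums is a nonzero
  polynomial in \<open>c\<close>; only finitely many \<open>c\<close> are roots of the product of
  all of them.\<close>

lemma distinct_power_sums:
  fixes \<alpha> :: "'i \<Rightarrow> 'b::field" and \<phi> :: "'k \<Rightarrow> 'b" and b :: "'i \<Rightarrow> nat"
  assumes I: "finite I" "inj_on b I" and \<alpha>: "inj_on \<alpha> I" and \<phi>: "infinite (range \<phi>)"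
  obtains c where "inj_on (\<lambda>\<sigma>. \<Sum>i\<in>I. \<phi> c ^ b i * \<alpha> (\<sigma> i)) {\<sigma>. \<sigma> permutes I}"
proof -
  let ?S = "{\<sigma>. \<sigma> permutes I}"
  define D where "D = (\<lambda>(\<sigma>, \<tau>). \<Sum>i\<in>I. monom (\<alpha> (\<sigma> i) - \<alpha> (\<tau> i)) (b i))"
  have D: "D (\<sigma>, \<tau>) \<noteq> 0" if st: "\<sigma> \<in> ?S" "\<tau> \<in> ?S" "\<sigma> \<noteq> \<tau>" for \<sigma> \<tau>
  proof -
    obtain i where i: "\<sigma> i \<noteq> \<tau> i" using st(3) by auto
    have "i \<in> I" using i st(1,2) permutes_not_in by (metis mem_Collect_eq)
    then have "\<sigma> i \<in> I" "\<tau> i \<in> I" using st(1,2) permutes_in_image by (metis mem_Collect_eq)+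
    then have "\<alpha> (\<sigma> i) \<noteq> \<alpha> (\<tau> i)" using i \<alpha> by (auto dest: inj_onD)
    moreover have "coeff (D (\<sigma>, \<tau>)) (b i) = (\<Sum>j\<in>I. if j = i then \<alpha> (\<sigma> j) - \<alpha> (\<tau> j) else 0)"
      unfolding D_def prod.case coeff_sum coeff_monom
      using \<open>i \<in> I\<close> I(2) by (intro sum.cong) (auto dest: inj_onD)
    then have "coeff (D (\<sigma>, \<tau>)) (b i) = \<alpha> (\<sigma> i) - \<alpha> (\<tau> i)"
      using \<open>i \<in> I\<close> I(1) by simp
    ultimately show ?thesis by auto
  qed
  define Q where "Q = (\<Prod>p\<in>{p \<in> ?S \<times> ?S. fst p \<noteq> snd p}. D p)"
  have fin: "finite {p \<in> ?S \<times> ?S. fst p \<noteq> snd p}" using I(1) by (simp add: finite_permutations)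
  have "Q \<noteq> 0" unfolding Q_def using fin D by auto
  then have "finite {x. poly Q x = 0}" by (rule poly_roots_finite)
  then have "range \<phi> - {x. poly Q x = 0} \<noteq> {}" using \<phi> by (metis Diff_infinite_finite infinite_imp_nonempty)
  then obtain c where c: "poly Q (\<phi> c) \<noteq> 0" by blast
  have "inj_on (\<lambda>\<sigma>. \<Sum>i\<in>I. \<phi> c ^ b i * \<alpha> (\<sigma> i)) ?S"
  proof (rule inj_onI, rule ccontr)
    fix \<sigma> \<tau> assume st: "\<sigma> \<in> ?S" "\<tau> \<in> ?S" "\<sigma> \<noteq> \<tau>"
      and eq: "(\<Sum>i\<in>I. \<phi> c ^ b i * \<alpha> (\<sigma> i)) = (\<Sum>i\<in>I. \<phi> c ^ b i * \<alpha> (\<tau> i))"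
    have "poly (D (\<sigma>, \<tau>)) (\<phi> c) = (\<Sum>i\<in>I. \<phi> c ^ b i * \<alpha> (\<sigma> i)) - (\<Sum>i\<in>I. \<phi> c ^ b i * \<alpha> (\<tau> i))"
      by (simp add: D_def poly_sum poly_monom sum_subtractf[symmetric] algebra_simps)
    then have "poly (D (\<sigma>, \<tau>)) (\<phi> c) = 0" using eq by simp
    then have "poly Q (\<phi> c) = 0"
      unfolding Q_def poly_prod using fin st by (intro prod_zero) (auto intro!: bexI[of _ "(\<sigma>, \<tau>)"])
    then show False using c by simp
  qed
  then show ?thesis using that by blast
qed

text \<open>A form of Gauss's lemma: the common denominator \<open>d\<close> is chosen of least
  degree. Since \<open>R\<close> is monic, \<open>d\<close> is the leading coefficient of
  \<open>P\<close>; a factor of \<open>P\<close> constant in X divides \<open>d\<close> and could be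
  cancelled from it, so by minimality it is a unit.\<close>

lemma irreducible_clear_denominators:
  fixes R :: "'k::field poly fract poly"
  assumes R: "lead_coeff R = 1" "degree R > 0"
    and irr: "\<And>A B. R = A * B \<Longrightarrow> degree A = 0 \<or> degree B = 0"
  obtains d P where "d \<noteq> 0" "smult (to_fract d) R = map_poly to_fract P" "Factorial_Ring.irreducible P"
    "degree P = degree R"
proof -
  let ?ok = "\<lambda>d P. d \<noteq> 0 \<and> smult (to_fract d) R = map_poly to_fract P"
  have ex: "\<exists>d P. ?ok d P" by (rule clear_denominators) blast
  define N where "N = (LEAST n. \<exists>d P. degree d = n \<and> ?ok d P)"
  have "\<exists>d P. degree d = N \<and> ?ok d P" unfolding N_def by (rule LeastI_ex) (use ex in blast)
  then obtain d P where dP: "degree d = N" "d \<noteq> 0" "smult (to_fract d) R = map_poly to_fract P" by blast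
  have min: "N \<le> degree e" if "?ok e Q" for e Q unfolding N_def by (rule Least_le) (use that in blast)
  have dm: "degree (map_poly to_fract Q) = degree Q" for Q :: "'k poly poly" by (rule degree_map_poly) auto
  have degP: "degree P = degree R" using dP dm[of P] by (metis degree_smult_eq to_fract_eq_0_iff)
  have P0: "P \<noteq> 0" using degP R(2) by auto
  have mult: "map_poly to_fract (A * B) = map_poly to_fract A * map_poly to_fract B" for A B :: "'k poly poly"
    by (rule map_poly_hom_on(3)[of UNIV]) (auto simp: hom_on_def)
  have const: "is_unit B" if AB: "P = A * B" "degree B = 0" for A B
  proof -
    obtain b where b: "B = [:b:]" using AB(2) by (metis degree_eq_zeroE)
    have b0: "b \<noteq> 0" using P0 AB(1) b by auto
    define a where "a = coeff A (degree R)"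
    have "to_fract d = coeff (smult (to_fract d) R) (degree R)" using R(1) by simp
    also have "\<dots> = to_fract (coeff P (degree R))" unfolding dP(3) by (simp add: coeff_map_poly)
    also have "coeff P (degree R) = b * a" unfolding AB(1) b a_def by simp
    finally have d: "d = b * a" by (simp only: to_fract_eq_iff)
    have a0: "a \<noteq> 0" using d dP(2) by auto
    have "smult (to_fract b) (smult (to_fract a) R) = smult (to_fract b) (map_poly to_fract A)"
      using dP(3) unfolding d AB(1) b mult by (simp add: map_poly_pCons)
    then have "smult (to_fract a) R = map_poly to_fract A" using b0
      by (metis (no_types, lifting) smult_eq_iff to_fract_eq_0_iff smult_smult left_inverse smult_1_left)
    then have "N \<le> degree a" using min a0 by blast
    then have "degree b = 0" using d dP(1) a0 b0 by (simp add: degree_mult_eq)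
    then show ?thesis using b b0 by (metis degree_eq_zeroE is_unit_const_poly_iff is_unit_triv pCons_0_0)
  qed
  have "Factorial_Ring.irreducible P"
  proof (rule Factorial_Ring.irreducibleI[OF P0])
    show "\<not> is_unit P" using degP R(2) by (auto simp: is_unit_poly_iff)
    fix A B assume AB: "P = A * B"
    have "smult (to_fract d) R = map_poly to_fract A * map_poly to_fract B" using dP(3) AB mult by simp
    then have "smult (inverse (to_fract d)) (smult (to_fract d) R)
        = smult (inverse (to_fract d)) (map_poly to_fract A) * map_poly to_fract B" by simp
    then have "R = smult (inverse (to_fract d)) (map_poly to_fract A) * map_poly to_fract B"
      using dP(2) by simp
    from irr[OF this] have "degree A = 0 \<or> degree B = 0" using dP(2) dm by simp
    then show "is_unit A \<or> is_unit B" using const[OF AB] const[of B A] AB by (auto simp: mult.commute)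
  qed
  then show ?thesis using that dP degP by blast
qed

text \<open>The resolvent with roots \<open>\<gamma> \<sigma>\<close>, one for each permutation, is
  irreducible over \<open>k(T)\<close>. If it stays irreducible at \<open>t\<close>, then all
  \<open>\<pi> (\<gamma> \<sigma>)\<close> are conjugate over \<open>k\<close>, and a conjugating
  endomorphism can only act on the roots of the fibre of \<open>F\<close> by
  \<open>\<sigma>\<close>.\<close>

theorem symmetric_over_hilbertian:
  fixes n :: nat
  assumes k: "hilbertian TYPE('k::field)" and n: "n \<ge> 3"
  obtains f :: "'k::field poly" and a :: "nat \<Rightarrow> 'k alg_closure" where
    "map_poly to_ac f = (\<Prod>i<n. [:- a i, 1:])" "inj_on a {..<n}"
    "\<And>\<sigma>. \<sigma> permutes {..<n} \<Longrightarrow> \<sigma> \<in> galois_perms {..<n} a"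
proof -
  let ?I = "{..<n}"
  let ?S = "{\<sigma>. \<sigma> permutes ?I}"
  obtain F :: "'k poly poly" and \<alpha> where F: "lead_coeff F = 1"
    "map_poly poly_to_ac F = (\<Prod>i<n. [:- \<alpha> i, 1:])" and inj: "inj_on \<alpha> ?I"
    and sym: "\<And>\<sigma>. \<sigma> permutes ?I \<Longrightarrow> \<sigma> \<in> galois_perms ?I \<alpha>" and inf: "infinite (UNIV :: 'k set)"
    by (rule symmetric_over_function_field[OF k n]) (rule that)
  have mF: "map_poly to_ac (map_poly to_fract F) = (\<Prod>i<n. [:- \<alpha> i, 1:])"
    using F(2) by (simp add: map_poly_map_poly o_def)
  have endo_sym: "\<exists>\<tau>. endo \<tau> \<and> (\<forall>i\<in>?I. \<tau> (\<alpha> i) = \<alpha> (\<sigma> i))" if "\<sigma> \<in> ?S" for \<sigma>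
    using sym[of \<sigma>] that by (auto simp: galois_perms_def)
  have S1: "id \<in> ?S" and S2: "\<And>\<sigma> \<rho>. \<sigma> \<in> ?S \<Longrightarrow> \<rho> \<in> ?S \<Longrightarrow> \<rho> \<circ> \<sigma> \<in> ?S" and finS: "finite ?S"
    by (auto simp: permutes_id permutes_compose finite_permutations)
  have S_lt: "\<sigma> i < n" if "\<sigma> \<in> ?S" "i < n" for \<sigma> i
    using that permutes_in_image[of \<sigma> ?I i] by simp
  have S3: "bij_betw (\<lambda>\<sigma>. \<rho> \<circ> \<sigma>) ?S ?S" if "\<rho> \<in> ?S" for \<rho>
  proof -
    have "inj_on (\<lambda>\<sigma>. \<rho> \<circ> \<sigma>) ?S"
      using that by (auto intro!: inj_onI simp: fun_eq_iff) (metis permutes_inj injD)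
    then show ?thesis using finS S2[OF _ that] by (metis (no_types, lifting) bij_betw_def endo_inj_surj image_subsetI)
  qed
  have "infinite (range (\<lambda>c :: 'k. poly_to_ac [:c:]))"
    using inf by (subst finite_image_iff) (auto simp: inj_def)
  from distinct_power_sums[OF finite_lessThan inj_on_id2 inj this] obtain c :: 'k where
    c: "inj_on (\<lambda>\<sigma>. \<Sum>i<n. poly_to_ac [:c:] ^ i * \<alpha> (\<sigma> i)) ?S" by blast
  define \<gamma> where "\<gamma> \<sigma> = (\<Sum>i<n. poly_to_ac [:c:] ^ i * \<alpha> (\<sigma> i))" for \<sigma>
  have \<gamma>_inj: "inj_on \<gamma> ?S" using c by (simp add: \<gamma>_def[abs_def])
  have \<gamma>_endo: "\<tau> (\<gamma> \<sigma>) = \<gamma> (\<rho> \<circ> \<sigma>)" if "endo \<tau>" "\<sigma> \<in> ?S" "\<forall>i\<in>?I. \<tau> (\<alpha> i) = \<alpha> (\<rho> i)" for \<tau> \<sigma> \<rho>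
  proof -
    have "\<tau> (poly_to_ac [:c:] ^ i) = poly_to_ac [:c:] ^ i" for i
      using endoD(2)[OF that(1), of "to_fract [:c:] ^ i"] by simp
    then have "\<tau> (\<gamma> \<sigma>) = (\<Sum>i<n. poly_to_ac [:c:] ^ i * \<tau> (\<alpha> (\<sigma> i)))"
      unfolding \<gamma>_def endo_sum[OF that(1)] endoD(6)[OF that(1)] by simp
    also have "\<dots> = \<gamma> (\<rho> \<circ> \<sigma>)"
      unfolding \<gamma>_def o_apply using that(3) S_lt[OF that(2)] by (intro sum.cong) auto
    finally show ?thesis .
  qed
  let ?E = "adjoin (range to_ac) (\<alpha> ` ?I)"
  have E: "is_subring ?E" by (rule is_subring_adjoin)
  have \<alpha>E: "\<alpha> i \<in> ?E" if "i < n" for i using adjoin_mem(2)[of "\<alpha> ` ?I" "range to_ac"] that by auto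
  have baseE: "to_ac x \<in> ?E" for x using adjoin_mem(1)[of "range to_ac" "\<alpha> ` ?I"] by auto
  have \<gamma>E: "\<gamma> \<sigma> \<in> ?E" if "\<sigma> \<in> ?S" for \<sigma>
    unfolding \<gamma>_def using S_lt[OF that]
    by (intro is_subring_sum[OF E] is_subringD(4)[OF E] is_subring_power[OF E] baseE \<alpha>E) simp
  have base: "x \<in> range to_ac" if "x \<in> ?E" "\<And>\<tau>. endo \<tau> \<Longrightarrow> \<tau> x = x" for x
    by (rule fixed_in_base[OF finite_lessThan inj mF that(1)]) (rule that(2))
  have endo_perm: "\<exists>\<rho>\<in>?S. \<forall>i\<in>?I. \<tau> (\<alpha> i) = \<alpha> (\<rho> i)" if "endo \<tau>" for \<tau>
    using endo_permutes_roots[OF finite_lessThan inj mF that] by (metis mem_Collect_eq)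
  define R where "R = (\<Prod>\<sigma>\<in>?S. [:- \<gamma> \<sigma>, 1:])"
  have degR: "degree R = card ?S" "lead_coeff R = 1"
    unfolding R_def lead_coeff_prod using finS by (simp_all add: degree_prod_linear)
  have cardS: "card ?S > 0" using finS S1 card_gt_0_iff by blast
  have "coeffs_in (range to_ac) R"
    unfolding coeffs_in_def
  proof (intro allI base)
    fix m
    show "coeff R m \<in> ?E"
      using coeffs_in_prod_linear[OF E, of ?S \<gamma>] \<gamma>E by (auto simp: R_def coeffs_in_def)
    fix \<tau> :: "'k poly fract alg_closure \<Rightarrow> 'k poly fract alg_closure" assume \<tau>: "endo \<tau>"
    obtain \<rho> where \<rho>: "\<rho> \<in> ?S" "\<forall>i\<in>?I. \<tau> (\<alpha> i) = \<alpha> (\<rho> i)" using endo_perm[OF \<tau>] by blast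
    have "map_poly \<tau> R = (\<Prod>\<sigma>\<in>?S. [:- \<tau> (\<gamma> \<sigma>), 1:])"
      unfolding R_def by (rule map_poly_prod_linear[OF endoD(1)[OF \<tau>]]) auto
    also have "\<dots> = (\<Prod>\<sigma>\<in>?S. [:- \<gamma> (\<rho> \<circ> \<sigma>), 1:])"
      using \<gamma>_endo[OF \<tau> _ \<rho>(2)] by (intro prod.cong) auto
    also have "\<dots> = R" unfolding R_def by (rule prod.reindex_bij_betw[OF S3[OF \<rho>(1)]])
    finally show "\<tau> (coeff R m) = coeff R m" using endoD(4)[OF \<tau>] by (metis coeff_map_poly)
  qed
  then obtain R0 where R0: "R = map_poly to_ac R0" by (rule coeffs_in_range_E) auto
  have "degree R0 > 0" "lead_coeff R0 = 1"
    using degR cardS unfolding R0 by (simp_all add: coeff_map_poly)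
  \<comment> \<open>A nonconstant factor has some \<open>\<gamma> \<sigma>0\<close> as a root, hence
    all \<open>\<gamma> \<sigma>\<close> by transitivity, and so the full degree.\<close>
  moreover have "degree A = 0 \<or> degree B = 0" if AB: "R0 = A * B" for A B
  proof (rule ccontr)
    assume nz: "\<not> (degree A = 0 \<or> degree B = 0)"
    have RAB: "R = map_poly to_ac A * map_poly to_ac B" unfolding R0 AB map_poly_to_ac_mult ..
    have A0: "A \<noteq> 0" "B \<noteq> 0" using nz by auto
    obtain z where z: "poly (map_poly to_ac A) z = 0"
      using alg_closed_imp_poly_has_root[of "map_poly to_ac A"] nz by auto
    then have "poly R z = 0" unfolding RAB by simp
    then obtain \<sigma>0 where \<sigma>0: "\<sigma>0 \<in> ?S" "z = \<gamma> \<sigma>0" unfolding R_def using finS by (auto simp: poly_prod)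
    have "poly (map_poly to_ac A) (\<gamma> \<sigma>) = 0" if \<sigma>: "\<sigma> \<in> ?S" for \<sigma>
    proof -
      obtain \<rho> where \<rho>: "\<rho> \<in> ?S" "\<rho> \<circ> \<sigma>0 = \<sigma>"
        using bij_betw_imp_surj_on[of "\<lambda>\<rho>. \<rho> \<circ> \<sigma>0"] \<sigma> \<sigma>0(1)
        by (metis (no_types, lifting) S2 comp_assoc comp_id mem_Collect_eq permutes_inv permutes_inv_o(2))
      obtain \<tau> where \<tau>: "endo \<tau>" "\<forall>i\<in>?I. \<tau> (\<alpha> i) = \<alpha> (\<rho> i)" using endo_sym[OF \<rho>(1)] by blast
      have "\<tau> z = \<gamma> \<sigma>" using \<gamma>_endo[OF \<tau>(1) \<sigma>0(1) \<tau>(2)] \<sigma>0(2) \<rho>(2) by simp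
      then show ?thesis using poly_endo_base[OF \<tau>(1), of A z] z endoD(4)[OF \<tau>(1)] by simp
    qed
    then have sub: "\<gamma> ` ?S \<subseteq> {x. poly (map_poly to_ac A) x = 0}" by auto
    have Anz: "map_poly to_ac A \<noteq> 0" using A0 by (simp add: map_poly_eq_0_iff)
    have "card ?S = card (\<gamma> ` ?S)" using \<gamma>_inj by (simp add: card_image)
    also have "\<dots> \<le> card {x. poly (map_poly to_ac A) x = 0}"
      by (rule card_mono[OF poly_roots_finite[OF Anz] sub])
    also have "\<dots> \<le> degree A" using card_poly_roots_bound[OF Anz] by simp
    also have "\<dots> < degree R0" using nz A0 unfolding AB by (subst degree_mult_eq) auto
    finally show False using degR unfolding R0 by simp
  qed
  ultimately obtain d P where P: "d \<noteq> 0" "smult (to_fract d) R0 = map_poly to_fract P"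
    "Factorial_Ring.irreducible P" "degree P = degree R0"
    using irreducible_clear_denominators[of R0] by metis
  have PR: "map_poly poly_to_ac P = smult (poly_to_ac d) R"
  proof -
    have "map_poly to_ac (smult (to_fract d) R0) = smult (poly_to_ac d) R"
      unfolding R0 by (rule poly_eqI) (simp add: coeff_map_poly)
    then show ?thesis using P(2) by (simp add: map_poly_map_poly o_def)
  qed
  have "rsquarefree R" unfolding R_def using finS \<gamma>_inj by (rule rsquarefree_prod_linear)
  then have "rsquarefree (map_poly poly_to_ac P)"
    using P(1) unfolding PR rsquarefree_iff_pderiv by (simp add: pderiv_smult)
  then have "separable_poly (map_poly to_fract P)"
    by (simp add: separable_poly_def map_poly_map_poly o_def)
  then have infT: "infinite {t. Factorial_Ring.irreducible (specialize P t)}"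
    using k P(3,4) degR cardS unfolding hilbertian_def R0 by fastforce
  have "\<exists>\<tau>. endo \<tau> \<and> \<tau> (\<alpha> 0) = \<alpha> i" if "i \<in> ?I" for i
    using endo_sym[of "Transposition.transpose 0 i"] that n permutes_swap_id[of 0 ?I i] by fastforce
  then obtain d' where d': "d' \<noteq> 0" "\<And>t. poly d' t \<noteq> 0 \<Longrightarrow> rsquarefree (map_poly to_ac (specialize F t))"
    using separable_specializations[OF finite_lessThan inj _ F, of 0] n by auto
  define T where "T = {p \<in> ?S \<times> ?S. fst p \<noteq> snd p}"
  have finT: "finite T" unfolding T_def using finS by auto
  \<comment> \<open>Up to sign the discriminant of the resolvent; being symmetric in the
    \<open>\<gamma> \<sigma>\<close> it lies in \<open>k(T)\<close>, and its numerator
    \<open>u\<close> controls when the roots stay distinct.\<close>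
  define \<Delta> where "\<Delta> = (\<Prod>p\<in>T. \<gamma> (fst p) - \<gamma> (snd p))"
  have \<Delta>0: "\<Delta> \<noteq> 0"
    unfolding \<Delta>_def using finT \<gamma>_inj by (auto simp: T_def dest: inj_onD)
  have "\<Delta> \<in> range to_ac"
  proof (rule base)
    show "\<Delta> \<in> ?E" unfolding \<Delta>_def T_def using \<gamma>E
      by (intro is_subring_prod[OF E] is_subringD(6)[OF E]) auto
    fix \<tau> :: "'k poly fract alg_closure \<Rightarrow> 'k poly fract alg_closure" assume \<tau>: "endo \<tau>"
    obtain \<rho> where \<rho>: "\<rho> \<in> ?S" "\<forall>i\<in>?I. \<tau> (\<alpha> i) = \<alpha> (\<rho> i)" using endo_perm[OF \<tau>] by blast
    have bij: "bij_betw (map_prod ((\<circ>) \<rho>) ((\<circ>) \<rho>)) T T"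
    proof -
      have "inj \<rho>" using \<rho>(1) by (simp add: permutes_inj)
      then have inj: "\<rho> \<circ> s = \<rho> \<circ> s' \<longleftrightarrow> s = s'" for s s' :: "nat \<Rightarrow> nat"
        by (auto simp: fun_eq_iff inj_eq)
      have "inj_on (map_prod ((\<circ>) \<rho>) ((\<circ>) \<rho>)) T" by (auto simp: inj_on_def inj)
      moreover have "map_prod ((\<circ>) \<rho>) ((\<circ>) \<rho>) ` T \<subseteq> T"
        using S2[OF _ \<rho>(1)] unfolding T_def by (auto simp: inj)
      ultimately show ?thesis using finT by (metis bij_betw_def endo_inj_surj)
    qed
    have "\<tau> \<Delta> = (\<Prod>p\<in>T. \<gamma> (\<rho> \<circ> fst p) - \<gamma> (\<rho> \<circ> snd p))"
      unfolding \<Delta>_def endo_prod[OF \<tau>] endoD(8)[OF \<tau>] T_def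
      using \<gamma>_endo[OF \<tau> _ \<rho>(2)] by (intro prod.cong) auto
    also have "\<dots> = \<Delta>" unfolding \<Delta>_def using prod.reindex_bij_betw[OF bij, of "\<lambda>p. \<gamma> (fst p) - \<gamma> (snd p)"] by simp
    finally show "\<tau> \<Delta> = \<Delta>" .
  qed
  then obtain u v where uv: "v \<noteq> 0" "\<Delta> = to_ac (Fract u v)" by (metis Fract_cases rangeE)
  then have \<Delta>v: "\<Delta> * poly_to_ac v = poly_to_ac u"
    by (simp add: to_fract_def eq_fract flip: to_ac_mult)
  then have u0: "u \<noteq> 0" using \<Delta>0 uv(1) by auto
  \<comment> \<open>Off the zeros of \<open>d'\<close> the fibre of \<open>F\<close> has simple
    roots, so a place is available; off the zeros of \<open>u\<close> the residue of
    \<open>\<Delta>\<close> is nonzero, so the \<open>\<pi> (\<gamma> \<sigma>)\<close> remain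
    distinct.\<close>
  have "finite {t. poly (d * d' * u) t = 0}" using P(1) d'(1) u0 by (intro poly_roots_finite) simp
  then have "infinite ({t. Factorial_Ring.irreducible (specialize P t)} - {t. poly (d * d' * u) t = 0})"
    using infT by (rule Diff_infinite_finite)
  then obtain t where "t \<in> {t. Factorial_Ring.irreducible (specialize P t)} - {t. poly (d * d' * u) t = 0}"
    by (metis ex_in_conv infinite_imp_nonempty)
  then have t: "Factorial_Ring.irreducible (specialize P t)" "poly d t \<noteq> 0" "poly d' t \<noteq> 0" "poly u t \<noteq> 0" by auto
  obtain V and \<pi> :: "'k poly fract alg_closure \<Rightarrow> 'k alg_closure" and W
    where V: "is_subring V" "hom_on V \<pi>" and "intermediate W"
    and pV: "\<And>p. poly_to_ac p \<in> V" "\<And>p. \<pi> (poly_to_ac p) = to_ac (poly p t)"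
    and \<alpha>V: "\<And>i. i \<in> ?I \<Longrightarrow> \<alpha> i \<in> V"
    and split: "map_poly to_ac (specialize F t) = (\<Prod>i<n. [:- \<pi> (\<alpha> i), 1:])"
    and inj\<pi>: "inj_on (\<lambda>i. \<pi> (\<alpha> i)) ?I"
    and "\<And>i. i \<in> ?I \<Longrightarrow> \<pi> (\<alpha> i) \<in> range to_ac \<Longrightarrow> \<alpha> i \<in> W"
    and "\<And>x. x \<in> V \<Longrightarrow> x \<in> W \<Longrightarrow> \<pi> x \<in> range to_ac"
    by (rule place_exists[OF finite_lessThan F d'(2)[OF t(3)]]) (rule that)
  define a where "a i = \<pi> (\<alpha> i)" for i
  note H = hom_onD[OF V(2,1)]
  have \<gamma>V: "\<gamma> \<sigma> \<in> V" if "\<sigma> \<in> ?S" for \<sigma>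
    unfolding \<gamma>_def using S_lt[OF that]
    by (intro is_subring_sum[OF V(1)] is_subringD(4)[OF V(1)] is_subring_power[OF V(1)] pV \<alpha>V) auto
  have \<gamma>\<pi>: "\<pi> (\<gamma> \<sigma>) = (\<Sum>i<n. to_ac c ^ i * a (\<sigma> i))" if "\<sigma> \<in> ?S" for \<sigma>
  proof -
    have *: "poly_to_ac [:c:] ^ i \<in> V" "\<alpha> (\<sigma> i) \<in> V" if "i < n" for i
      by (rule is_subring_power[OF V(1) pV(1)], rule \<alpha>V) (use S_lt[OF \<open>\<sigma> \<in> ?S\<close> that] in simp)
    have "\<pi> (\<gamma> \<sigma>) = (\<Sum>i<n. \<pi> (poly_to_ac [:c:] ^ i * \<alpha> (\<sigma> i)))"
      unfolding \<gamma>_def by (rule hom_on_sum[OF V(2,1)]) (use * is_subringD(4)[OF V(1)] in auto)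
    also have "\<dots> = (\<Sum>i<n. to_ac c ^ i * a (\<sigma> i))"
      by (rule sum.cong) (use * H(4) hom_on_power[OF V(2,1) pV(1)] pV(2)[of "[:c:]"] in \<open>auto simp: a_def\<close>)
    finally show ?thesis .
  qed
  have \<pi>\<gamma>_inj: "inj_on (\<lambda>\<sigma>. \<pi> (\<gamma> \<sigma>)) ?S"
  proof (rule inj_onI, rule ccontr)
    fix \<sigma> \<tau> assume st: "\<sigma> \<in> ?S" "\<tau> \<in> ?S" "\<pi> (\<gamma> \<sigma>) = \<pi> (\<gamma> \<tau>)" "\<sigma> \<noteq> \<tau>"
    have "\<Delta> \<in> V" "\<pi> \<Delta> = (\<Prod>p\<in>T. \<pi> (\<gamma> (fst p) - \<gamma> (snd p)))"
      unfolding \<Delta>_def using \<gamma>V is_subringD(6)[OF V(1)]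
      by (auto simp: T_def intro!: is_subring_prod[OF V(1)] hom_on_prod[OF V(2,1)])
    moreover have "\<pi> (\<gamma> \<sigma> - \<gamma> \<tau>) = 0" using st \<gamma>V H(6) by simp
    then have "(\<Prod>p\<in>T. \<pi> (\<gamma> (fst p) - \<gamma> (snd p))) = 0"
      using finT st by (intro prod_zero) (auto simp: T_def intro!: bexI[of _ "(\<sigma>, \<tau>)"])
    ultimately have "\<pi> (\<Delta> * poly_to_ac v) = 0" using H(4) pV(1) by simp
    then show False using t(4) unfolding \<Delta>v pV(2) by simp
  qed
  have Pt: "map_poly to_ac (specialize P t) = smult (to_ac (poly d t)) (\<Prod>\<sigma>\<in>?S. [:- \<pi> (\<gamma> \<sigma>), 1:])"
  proof -
    have "map_poly to_ac (specialize P t) = map_poly \<pi> (map_poly poly_to_ac P)"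
      by (rule poly_eqI) (simp add: coeff_map_poly specialize_def pV(2) H)
    also have "\<dots> = map_poly \<pi> ([:poly_to_ac d:] * R)" unfolding PR by simp
    also have "\<dots> = map_poly \<pi> [:poly_to_ac d:] * map_poly \<pi> R"
      unfolding R_def using \<gamma>V pV(1) V(1)
      by (intro map_poly_hom_on(3)[OF V(2,1)] coeffs_in_prod_linear) auto
    also have "map_poly \<pi> R = (\<Prod>\<sigma>\<in>?S. [:- \<pi> (\<gamma> \<sigma>), 1:])"
      unfolding R_def by (rule map_poly_prod_linear[OF V(2,1)]) (rule \<gamma>V)
    finally show ?thesis using H(2) pV(2)[of d] by (simp add: map_poly_pCons)
  qed
  have inja: "inj_on a ?I" using inj\<pi> by (simp add: a_def[abs_def])
  have splita: "map_poly to_ac (specialize F t) = (\<Prod>i<n. [:- a i, 1:])" using split by (simp add: a_def)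
  have "\<sigma> \<in> galois_perms ?I a" if \<sigma>: "\<sigma> permutes ?I" for \<sigma>
  proof -
    let ?z = "\<pi> (\<gamma> id)"
    have root: "poly (map_poly to_ac (specialize P t)) (\<pi> (\<gamma> \<rho>)) = 0" if "\<rho> \<in> ?S" for \<rho>
      unfolding Pt using finS that by (auto simp: poly_prod)
    \<comment> \<open>The minimal polynomial of \<open>?z\<close> divides the irreducible
      \<open>specialize P t\<close>, so they agree up to a constant and every
      \<open>\<pi> (\<gamma> \<sigma>)\<close> is a conjugate of \<open>?z\<close>.\<close>
    obtain m where m: "coeffs_in (range to_ac) m" "lead_coeff m = 1" "poly m ?z = 0" "degree m > 0"
      "\<And>g. coeffs_in (range to_ac) g \<Longrightarrow> poly g ?z = 0 \<Longrightarrow> \<exists>q. coeffs_in (range to_ac) q \<and> g = m * q"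
      using minimal_polynomial[OF intermediate_range] by metis
    have "coeffs_in (range to_ac) (map_poly to_ac (specialize P t))" by (rule coeffs_in_map_poly) auto
    from m(5)[OF this root[OF S1]] obtain q where q: "coeffs_in (range to_ac) q"
      "map_poly to_ac (specialize P t) = m * q" by blast
    obtain m0 where m0: "m = map_poly to_ac m0" using m(1) by (rule coeffs_in_range_E) auto
    obtain q0 where q0: "q = map_poly to_ac q0" using q(1) by (rule coeffs_in_range_E) auto
    have "map_poly to_ac (specialize P t) = map_poly to_ac (m0 * q0)"
      using q(2) unfolding m0 q0 map_poly_to_ac_mult .
    then have "specialize P t = m0 * q0" by simp
    from Factorial_Ring.irreducibleD[OF t(1) this] have "is_unit m0 \<or> is_unit q0" .
    moreover have "\<not> is_unit m0" using m(4) unfolding m0 by (auto simp: is_unit_poly_iff)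
    ultimately obtain b where b: "q0 = [:b:]" "b \<noteq> 0"
      by (metis dvd_0_left_iff is_unit_poly_iff zero_neq_one)
    have "poly m (\<pi> (\<gamma> \<sigma>)) = 0"
      using root[of \<sigma>] \<sigma> b unfolding q(2) q0 by (auto simp: map_poly_pCons)
    then obtain \<tau> where \<tau>: "endo \<tau>" "\<tau> ?z = \<pi> (\<gamma> \<sigma>)"
      using conjugate_endo[OF intermediate_range m(1,5)] by metis
    \<comment> \<open>\<open>\<tau>\<close> permutes the roots by some \<open>\<rho>\<close> and so
      sends \<open>?z\<close> to \<open>\<pi> (\<gamma> \<rho>)\<close>; distinctness of these
      values identifies \<open>\<rho>\<close> with \<open>\<sigma>\<close>.\<close>
    obtain \<rho> where \<rho>: "\<rho> permutes ?I" "\<And>i. i \<in> ?I \<Longrightarrow> \<tau> (a i) = a (\<rho> i)"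
      using endo_permutes_roots[OF finite_lessThan inja splita \<tau>(1)] by blast
    have "\<tau> ?z = (\<Sum>i<n. to_ac c ^ i * a (\<rho> i))"
      unfolding \<gamma>\<pi>[OF S1] endo_sum[OF \<tau>(1)] endoD(6)[OF \<tau>(1)]
      using \<rho>(2) endoD(2)[OF \<tau>(1), of "c ^ _"] by (intro sum.cong) auto
    then have "\<pi> (\<gamma> \<rho>) = \<pi> (\<gamma> \<sigma>)" using \<gamma>\<pi>[of \<rho>] \<rho>(1) \<tau>(2) by simp
    then have "\<rho> = \<sigma>" using \<pi>\<gamma>_inj \<rho>(1) \<sigma> by (auto dest: inj_onD)
    then show ?thesis using \<rho> \<tau>(1) by (auto simp: galois_perms_def)
  qed
  then show ?thesis using that splita inja by blast
qed

text \<open>Transport along an enumeration of \<open>I\<close>; the roots will be indexed by the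
  points of a hypergraph.\<close>

corollary symmetric_over_hilbertian_indexed:
  fixes I :: "'i set"
  assumes k: "hilbertian TYPE('k::field)" and I: "finite I" "card I \<ge> 3"
  obtains f :: "'k::field poly" and a :: "'i \<Rightarrow> 'k alg_closure" where
    "map_poly to_ac f = (\<Prod>i\<in>I. [:- a i, 1:])" "inj_on a I"
    "\<And>\<sigma>. \<sigma> permutes I \<Longrightarrow> \<sigma> \<in> galois_perms I a"
proof -
  let ?N = "{..<card I}"
  obtain f :: "'k poly" and a where f: "map_poly to_ac f = (\<Prod>i\<in>?N. [:- a i, 1:])" and a: "inj_on a ?N"
    and sym: "\<And>\<sigma>. \<sigma> permutes ?N \<Longrightarrow> \<sigma> \<in> galois_perms ?N a"
    by (rule symmetric_over_hilbertian[OF k I(2)]) (rule that)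
  obtain b where b: "bij_betw b I ?N" using ex_bij_betw_finite_nat[OF I(1)] by (metis atLeast0LessThan)
  have "map_poly to_ac f = (\<Prod>i\<in>I. [:- a (b i), 1:])"
    unfolding f by (rule prod.reindex_bij_betw[OF b, symmetric])
  moreover have "inj_on (a \<circ> b) I"
    using b a by (intro comp_inj_on) (auto simp: bij_betw_def)
  moreover have "\<sigma> \<in> galois_perms I (a \<circ> b)" if \<sigma>: "\<sigma> permutes I" for \<sigma>
  proof -
    define \<rho> where "\<rho> j = (if j \<in> ?N then b (\<sigma> (inv_into I b j)) else j)" for j
    have bi: "inv_into I b (b i) = i" "b i \<in> ?N" if "i \<in> I" for i
      using b that by (auto simp: bij_betw_def)
    have "bij_betw (b \<circ> \<sigma> \<circ> inv_into I b) ?N ?N"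
      using bij_betw_trans[OF bij_betw_trans[OF bij_betw_inv_into[OF b] permutes_imp_bij[OF \<sigma>]] b]
      by (simp add: o_assoc)
    then have "bij_betw \<rho> ?N ?N" by (rule bij_betw_cong[THEN iffD1, rotated]) (auto simp: \<rho>_def)
    then have "\<rho> permutes ?N" by (rule bij_imp_permutes) (simp add: \<rho>_def)
    from sym[OF this] obtain \<tau> where \<tau>: "endo \<tau>" "\<forall>j\<in>?N. \<tau> (a j) = a (\<rho> j)"
      by (auto simp: galois_perms_def)
    have "\<tau> ((a \<circ> b) i) = (a \<circ> b) (\<sigma> i)" if "i \<in> I" for i
      using \<tau>(2) bi[OF that] by (auto simp: \<rho>_def)
    then show ?thesis using \<sigma> \<tau>(1) by (auto simp: galois_perms_def)
  qed
  ultimately show ?thesis using that[of f "a \<circ> b"] by simp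
qed

section \<open>Normalizers in symmetric groups\<close>

text \<open>The condition that \<open>\<sigma> H = H \<sigma>\<close>, written as two elementwise
  inclusions and independent of any group structure on \<open>H\<close>.\<close>

definition perm_normalizer :: "'i set \<Rightarrow> ('i \<Rightarrow> 'i) set \<Rightarrow> ('i \<Rightarrow> 'i) set" where
  "perm_normalizer \<Omega> H = {\<sigma>. \<sigma> permutes \<Omega> \<and> (\<forall>h\<in>H. \<exists>h'\<in>H. \<sigma> \<circ> h = h' \<circ> \<sigma>) \<and> (\<forall>h'\<in>H. \<exists>h\<in>H. \<sigma> \<circ> h = h' \<circ> \<sigma>)}"

lemma perm_normalizerD:
  assumes "\<sigma> \<in> perm_normalizer \<Omega> H"
  shows "\<sigma> permutes \<Omega>" "h \<in> H \<Longrightarrow> \<exists>h'\<in>H. \<sigma> \<circ> h = h' \<circ> \<sigma>" "h' \<in> H \<Longrightarrow> \<exists>h\<in>H. \<sigma> \<circ> h = h' \<circ> \<sigma>"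
  using assms unfolding perm_normalizer_def by blast+

lemma perm_normalizer_comp:
  assumes "\<sigma> \<in> perm_normalizer \<Omega> H" "\<rho> \<in> perm_normalizer \<Omega> H"
  shows "\<sigma> \<circ> \<rho> \<in> perm_normalizer \<Omega> H"
proof -
  have "\<exists>h'\<in>H. \<sigma> \<circ> \<rho> \<circ> h = h' \<circ> (\<sigma> \<circ> \<rho>)" if h: "h \<in> H" for h
  proof -
    obtain h1 where "h1 \<in> H" "\<rho> \<circ> h = h1 \<circ> \<rho>" using perm_normalizerD(2)[OF assms(2)] h by metis
    moreover from this obtain h2 where "h2 \<in> H" "\<sigma> \<circ> h1 = h2 \<circ> \<sigma>"
      using perm_normalizerD(2)[OF assms(1)] by metis
    ultimately show ?thesis by (metis comp_assoc)
  qed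
  moreover have "\<exists>h\<in>H. \<sigma> \<circ> \<rho> \<circ> h = h' \<circ> (\<sigma> \<circ> \<rho>)" if h': "h' \<in> H" for h'
  proof -
    obtain h1 where "h1 \<in> H" "\<sigma> \<circ> h1 = h' \<circ> \<sigma>" using perm_normalizerD(3)[OF assms(1)] h' by metis
    moreover from this obtain h2 where "h2 \<in> H" "\<rho> \<circ> h2 = h1 \<circ> \<rho>"
      using perm_normalizerD(3)[OF assms(2)] by metis
    ultimately show ?thesis by (metis comp_assoc)
  qed
  ultimately show ?thesis
    using permutes_compose[OF perm_normalizerD(1)[OF assms(2)] perm_normalizerD(1)[OF assms(1)]]
    unfolding perm_normalizer_def by blast
qed

lemma perm_normalizer_inv:
  assumes "\<sigma> \<in> perm_normalizer \<Omega> H"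
  shows "inv_into UNIV \<sigma> \<in> perm_normalizer \<Omega> H"
proof -
  let ?i = "inv_into UNIV \<sigma>"
  have p: "\<sigma> permutes \<Omega>" using assms by (simp add: perm_normalizer_def)
  have "?i \<circ> h' = h \<circ> ?i" if "\<sigma> \<circ> h = h' \<circ> \<sigma>" for h h'
    using arg_cong[OF that, of "\<lambda>f. ?i \<circ> f \<circ> ?i"] permutes_inv_o[OF p]
    by (simp add: comp_assoc[symmetric]) (simp add: comp_assoc)
  then show ?thesis using assms permutes_inv[OF p] unfolding perm_normalizer_def by blast
qed

text \<open>
  A hypergraph with vertex weights \<open>s\<close> gives the group \<open>H = \<Prod> Sym (s v)\<close>, acting on the disjoint union of
  the products \<open>\<Prod> {..<s v}\<close> over the vertices of a hyperedge. Its normalizer in the symmetric group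
  of all these points is generated by \<open>H\<close> and the automorphisms of the weighted hypergraph. A point over
  the hyperedge \<open>e\<close> is encoded as a partial function with domain \<open>e\<close>.
\<close>

locale weighted_hypergraph =
  fixes V :: "'v set" and E :: "'v set set" and s :: "'v \<Rightarrow> nat"
  assumes finV: "finite V" and EV: "e \<in> E \<Longrightarrow> e \<subseteq> V \<and> e \<noteq> {}" and sing: "v \<in> V \<Longrightarrow> {v} \<in> E"
    and s3: "v \<in> V \<Longrightarrow> s v \<ge> 3"
begin

definition pts :: "('v \<Rightarrow> nat option) set" where
  "pts = {p. dom p \<in> E \<and> (\<forall>v i. p v = Some i \<longrightarrow> i < s v)}"

text \<open>Acting coordinatewise on points and as the identity elsewhere, as
  \<open>permutes\<close> requires.\<close>

definition act :: "('v \<Rightarrow> nat \<Rightarrow> nat) \<Rightarrow> ('v \<Rightarrow> nat option) \<Rightarrow> ('v \<Rightarrow> nat option)" where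
  "act h p = (if p \<in> pts then (\<lambda>v. map_option (h v) (p v)) else p)"

definition fam :: "('v \<Rightarrow> nat \<Rightarrow> nat) set" where
  "fam = {h. \<forall>v. h v permutes {..<s v}}"

definition H :: "(('v \<Rightarrow> nat option) \<Rightarrow> ('v \<Rightarrow> nat option)) set" where
  "H = act ` fam"

abbreviation single :: "'v \<Rightarrow> nat \<Rightarrow> 'v \<Rightarrow> nat option" where
  "single v i \<equiv> (\<lambda>_. None)(v := Some i)"

lemma famD: "h \<in> fam \<Longrightarrow> h v permutes {..<s v}" "h \<in> fam \<Longrightarrow> h v i < s v \<longleftrightarrow> i < s v"
  "h \<in> fam \<Longrightarrow> h v i = h v j \<longleftrightarrow> i = j"
proof -
  show *: "h v permutes {..<s v}" if "h \<in> fam" using that by (simp add: fam_def)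
  show "h v i < s v \<longleftrightarrow> i < s v" if "h \<in> fam" using permutes_in_image[of "h v" "{..<s v}" i] that by (simp add: fam_def)
  show "h v i = h v j \<longleftrightarrow> i = j" if "h \<in> fam" using permutes_inj[OF *[OF that]] by (simp add: inj_eq)
qed

lemma finite_pts: "finite pts"
proof -
  have "finite E" using finite_subset[of E "Pow V"] EV finV by blast
  moreover have "finite {p :: 'v \<Rightarrow> nat option. dom p = e \<and> ran p \<subseteq> (\<Union>v\<in>V. {..<s v})}" if "e \<in> E" for e
    using EV[OF that] finV by (intro finite_set_of_finite_maps) (auto intro: finite_subset)
  moreover have "pts \<subseteq> (\<Union>e\<in>E. {p. dom p = e \<and> ran p \<subseteq> (\<Union>v\<in>V. {..<s v})})"
    using EV by (fastforce simp: pts_def ran_def)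
  ultimately show ?thesis by (meson finite_UN finite_subset)
qed

lemma dom_act [simp]: "dom (act h p) = dom p"
  by (auto simp: act_def dom_def)

lemma act_in_pts: "h \<in> fam \<Longrightarrow> p \<in> pts \<Longrightarrow> act h p \<in> pts"
  using dom_act[of h p] by (auto simp: pts_def famD(2)) (auto simp: act_def pts_def famD(2))

lemma act_comp: "k \<in> fam \<Longrightarrow> act h \<circ> act k = act (\<lambda>v. h v \<circ> k v)"
proof
  fix p assume k: "k \<in> fam"
  show "(act h \<circ> act k) p = act (\<lambda>v. h v \<circ> k v) p"
    using act_in_pts[OF k, of p] by (cases "p \<in> pts") (auto simp: act_def option.map_comp)
qed

lemma act_permutes: "h \<in> fam \<Longrightarrow> act h permutes pts"
proof -
  assume h: "h \<in> fam"
  have "inj_on (act h) pts"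
  proof (rule inj_onI)
    fix p q assume "p \<in> pts" "q \<in> pts" "act h p = act h q"
    then have "map_option (h v) (p v) = map_option (h v) (q v)" for v by (auto simp: act_def fun_eq_iff)
    then show "p = q" using famD(3)[OF h]
      by (intro ext) (metis (no_types, lifting) injI option.inj_map_strong)
  qed
  then have "bij_betw (act h) pts pts"
    using act_in_pts[OF h] finite_pts by (metis bij_betw_def endo_inj_surj image_subsetI)
  then show ?thesis by (rule bij_imp_permutes) (simp add: act_def)
qed

lemma H_permutes: "h \<in> H \<Longrightarrow> h permutes pts"
  using act_permutes by (auto simp: H_def)

lemma H_dom: "h \<in> H \<Longrightarrow> dom (h p) = dom p"
  unfolding H_def by (metis dom_act imageE)

lemma fam_comp: "h \<in> fam \<Longrightarrow> k \<in> fam \<Longrightarrow> (\<lambda>v. h v \<circ> k v) \<in> fam"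
  by (auto simp: fam_def permutes_compose)

lemma fam_inv: "h \<in> fam \<Longrightarrow> (\<lambda>v. inv_into UNIV (h v)) \<in> fam"
  by (auto simp: fam_def permutes_inv)

lemma H_comp: "a \<in> H \<Longrightarrow> b \<in> H \<Longrightarrow> a \<circ> b \<in> H"
  using act_comp fam_comp by (fastforce simp: H_def)

lemma act_id: "act (\<lambda>v. id) = id"
  by (rule ext) (simp add: act_def option.map_id0)

lemma H_id: "id \<in> H"
proof -
  have "(\<lambda>v. id) \<in> fam" by (simp add: fam_def permutes_id del: id_apply)
  then show ?thesis unfolding H_def by (metis act_id imageI)
qed

lemma H_inv: "a \<in> H \<Longrightarrow> \<exists>b\<in>H. b \<circ> a = id \<and> a \<circ> b = id"
proof -
  assume "a \<in> H"
  then obtain h where h: "h \<in> fam" "a = act h" by (auto simp: H_def)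
  have "act (\<lambda>v. inv_into UNIV (h v)) \<circ> a = id" "a \<circ> act (\<lambda>v. inv_into UNIV (h v)) = id"
    using act_comp[OF h(1)] act_comp[OF fam_inv[OF h(1)]] h(2) permutes_inv_o[OF famD(1)[OF h(1)]] act_id
    by simp_all
  then show ?thesis using fam_inv[OF h(1)] by (auto simp: H_def)
qed

lemma H_in_normalizer: "H \<subseteq> perm_normalizer pts H"
proof
  fix a assume a: "a \<in> H"
  then obtain b where b: "b \<in> H" "b \<circ> a = id" "a \<circ> b = id" using H_inv by blast
  have "a \<circ> h = (a \<circ> h \<circ> b) \<circ> a" "a \<circ> (b \<circ> h \<circ> a) = h \<circ> a" for h
    using b by (metis comp_assoc comp_id, metis comp_assoc id_comp)
  then show "a \<in> perm_normalizer pts H"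
    using H_permutes[OF a] H_comp a b(1) unfolding perm_normalizer_def by blast
qed

section \<open>Orbits and fixed points of \<open>H\<close>\<close>

lemma single_in_pts: "v \<in> V \<Longrightarrow> single v i \<in> pts \<longleftrightarrow> i < s v"
  using sing[of v] by (auto simp: pts_def)

lemma pts_singleE:
  assumes "p \<in> pts" "dom p = {v}"
  obtains i where "i < s v" "p = single v i"
proof -
  obtain i where "p v = Some i" using assms(2) by blast
  moreover have "p w = None" if "w \<noteq> v" for w using assms(2) that by blast
  ultimately have "p = single v i" by (auto simp: fun_eq_iff)
  moreover have "i < s v" using assms(1) \<open>p v = Some i\<close> by (simp add: pts_def)
  ultimately show ?thesis using that by metis
qed

lemma act_single: "v \<in> V \<Longrightarrow> i < s v \<Longrightarrow> act h (single v i) = single v (h v i)"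
  using single_in_pts[of v i] by (auto simp: act_def)

lemma edge_point:
  assumes "e \<in> E"
  obtains p where "p \<in> pts" "dom p = e"
proof -
  define p where "p v = (if v \<in> e then Some (0::nat) else None)" for v
  have "dom p = e" by (auto simp: p_def dom_def)
  moreover have "0 < s v" if "v \<in> e" for v using s3[of v] EV[OF assms] that by auto
  then have "p \<in> pts" unfolding pts_def using assms \<open>dom p = e\<close> by (auto simp: p_def split: if_splits)
  ultimately show ?thesis using that by blast
qed

text \<open>Together with \<open>H_dom\<close> this identifies the orbits of \<open>H\<close> on
  \<open>pts\<close> with the hyperedges. A transposition in each coordinate suffices.\<close>

lemma transitive:
  assumes "p \<in> pts" "q \<in> pts" "dom p = dom q"
  obtains a where "a \<in> H" "a p = q"
proof -
  define h where "h v = (if v \<in> dom p then Transposition.transpose (the (p v)) (the (q v)) else id)" for v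
  have lt: "the (p v) < s v" "the (q v) < s v" if v: "v \<in> dom p" for v
  proof -
    obtain i where "p v = Some i" using v by blast
    then show "the (p v) < s v" using assms(1) by (simp add: pts_def)
    obtain j where "q v = Some j" using v assms(3) by blast
    then show "the (q v) < s v" using assms(2) by (simp add: pts_def)
  qed
  have "h \<in> fam"
    unfolding fam_def h_def using lt by (auto simp: permutes_id intro!: permutes_swap_id)
  moreover have "act h p = q"
  proof
    fix v
    show "act h p v = q v"
    proof (cases "v \<in> dom p")
      case True
      then have "v \<in> dom q" using assms(3) by simp
      then obtain i j where "p v = Some i" "q v = Some j" using True by blast
      then show ?thesis using assms(1) True by (simp add: act_def h_def)
    next
      case False
      then have "p v = None" "q v = None" using assms(3) by (auto simp: domIff)
      then show ?thesis using assms(1) by (simp add: act_def)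
    qed
  qed
  ultimately show ?thesis using that by (auto simp: H_def)
qed

text \<open>Inclusion of hyperedges is expressed by the permutation group \<open>H\<close> alone,
  hence respected by its normalizer. An element fixing all points over \<open>e\<close> is trivial
  in the coordinates of \<open>e\<close>, while a vertex of \<open>f\<close> outside
  \<open>e\<close> can be moved without affecting the points over \<open>e\<close>.\<close>

lemma subset_iff_fixers:
  assumes "e \<in> E" "f \<in> E"
  shows "f \<subseteq> e \<longleftrightarrow> (\<forall>a\<in>H. (\<forall>p\<in>pts. dom p = e \<longrightarrow> a p = p) \<longrightarrow> (\<forall>p\<in>pts. dom p = f \<longrightarrow> a p = p))"
proof
  assume fe: "f \<subseteq> e"
  show "\<forall>a\<in>H. (\<forall>p\<in>pts. dom p = e \<longrightarrow> a p = p) \<longrightarrow> (\<forall>p\<in>pts. dom p = f \<longrightarrow> a p = p)"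
  proof (intro ballI impI)
    fix a p assume a: "a \<in> H" "\<forall>p\<in>pts. dom p = e \<longrightarrow> a p = p" and p: "p \<in> pts" "dom p = f"
    obtain h where h: "h \<in> fam" "a = act h" using a(1) by (auto simp: H_def)
    \<comment> \<open>A point over \<open>f\<close> is extended to one over \<open>e\<close> with
      the filler 0, which is below every weight.\<close>
    define q where "q v = (if v \<in> f then p v else if v \<in> e then Some 0 else None)" for v
    have dq: "dom q = e" using p(2) fe by (auto simp: q_def dom_def)
    have "0 < s v" if "v \<in> e" for v using s3[of v] EV[OF assms(1)] that by auto
    then have "q \<in> pts" unfolding pts_def using p(1) dq assms(1)
      by (auto simp: q_def pts_def split: if_splits)
    then have "act h q = q" using a(2) dq h(2) by blast
    then have hq: "map_option (h v) (q v) = q v" for v using \<open>q \<in> pts\<close> by (simp add: act_def fun_eq_iff)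
    have "map_option (h v) (p v) = p v" for v
    proof (cases "v \<in> f")
      case True
      then show ?thesis using hq[of v] by (simp add: q_def)
    next
      case False
      then have "p v = None" using p(2) by blast
      then show ?thesis by simp
    qed
    then show "a p = p" using h(2) p(1) by (simp add: act_def)
  qed
next
  assume *: "\<forall>a\<in>H. (\<forall>p\<in>pts. dom p = e \<longrightarrow> a p = p) \<longrightarrow> (\<forall>p\<in>pts. dom p = f \<longrightarrow> a p = p)"
  show "f \<subseteq> e"
  proof
    fix v assume v: "v \<in> f"
    then have vV: "v \<in> V" using EV[OF assms(2)] by blast
    show "v \<in> e"
    proof (rule ccontr)
      assume ve: "v \<notin> e"
      obtain p where p: "p \<in> pts" "dom p = f" using edge_point[OF assms(2)] .
      obtain i where i: "p v = Some i" using v p(2) by blast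
      then have "i < s v" using p(1) by (auto simp: pts_def)
      define j where "j = (if i = 0 then 1 else 0 :: nat)"
      have j: "j < s v" "j \<noteq> i" using s3[OF vV] by (auto simp: j_def)
      define h where "h = (\<lambda>_. id)(v := Transposition.transpose i j)"
      have h: "h \<in> fam" using j \<open>i < s v\<close> by (auto simp: h_def fam_def permutes_id intro!: permutes_swap_id)
      have "act h q = q" if "q \<in> pts" "dom q = e" for q
        using that ve by (auto simp: act_def h_def fun_eq_iff option.map_id0 dom_def)
      then have "act h p = p" using * p h by (auto simp: H_def)
      then have "act h p v = Some i" using i by simp
      then show False using p(1) i j(2) by (simp add: act_def h_def)
    qed
  qed
qed

text \<open>A normalizing permutation permutes the orbits of \<open>H\<close>, that is, the
  hyperedges, by a bijection \<open>\<epsilon>\<close> preserving inclusion both ways. Singletons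
  are the minimal hyperedges, so \<open>\<epsilon>\<close> comes from a bijection of the vertices;
  weights are the sizes of the orbits over singletons.\<close>

lemma normalizer_edge_map:
  assumes \<sigma>: "\<sigma> \<in> perm_normalizer pts H"
  obtains \<pi> where "bij_betw \<pi> V V" "\<And>p. p \<in> pts \<Longrightarrow> dom (\<sigma> p) = \<pi> ` dom p"
    "\<And>v. v \<in> V \<Longrightarrow> s (\<pi> v) = s v" "\<And>e. e \<in> E \<Longrightarrow> \<pi> ` e \<in> E"
proof -
  have perm: "\<sigma> permutes pts" using \<sigma> by (simp add: perm_normalizer_def)
  have in_pts: "\<sigma> p \<in> pts \<longleftrightarrow> p \<in> pts" for p using perm by (rule permutes_in_image)
  have surj: "\<exists>p. \<sigma> p = q" for q using permutes_surj[OF perm] by (metis surjD)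
  have n1: "\<exists>h'\<in>H. \<forall>p. \<sigma> (h p) = h' (\<sigma> p)" if "h \<in> H" for h
    using \<sigma> that unfolding perm_normalizer_def fun_eq_iff o_def by blast
  have n2: "\<exists>h\<in>H. \<forall>p. \<sigma> (h p) = h' (\<sigma> p)" if "h' \<in> H" for h'
    using \<sigma> that unfolding perm_normalizer_def fun_eq_iff o_def by blast
  have dom_eq: "dom (\<sigma> p) = dom (\<sigma> q) \<longleftrightarrow> dom p = dom q" if pq: "p \<in> pts" "q \<in> pts" for p q
  proof
    assume "dom p = dom q"
    then obtain a where "a \<in> H" "a p = q" using transitive[OF pq] by metis
    then show "dom (\<sigma> p) = dom (\<sigma> q)" using n1 H_dom by metis
  next
    assume "dom (\<sigma> p) = dom (\<sigma> q)"
    then obtain a where a: "a \<in> H" "a (\<sigma> p) = \<sigma> q" using transitive[of "\<sigma> p" "\<sigma> q"] in_pts pq by metis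
    then obtain b where "b \<in> H" "\<sigma> (b p) = \<sigma> q" using n2 by metis
    then show "dom p = dom q" using H_dom permutes_inj[OF perm] by (metis injD)
  qed
  define \<epsilon> where "\<epsilon> e = dom (\<sigma> (SOME p. p \<in> pts \<and> dom p = e))" for e
  have \<epsilon>: "\<epsilon> (dom p) = dom (\<sigma> p)" if "p \<in> pts" for p
    using someI[of "\<lambda>q. q \<in> pts \<and> dom q = dom p" p] that dom_eq unfolding \<epsilon>_def by auto
  have \<epsilon>E: "\<epsilon> e \<in> E" if e: "e \<in> E" for e
  proof -
    obtain p where p: "p \<in> pts" "dom p = e" using edge_point[OF e] .
    then have "\<sigma> p \<in> pts" using in_pts by simp
    then show ?thesis using \<epsilon>[OF p(1)] p(2) by (simp add: pts_def)
  qed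
  have \<epsilon>surj: "\<exists>e\<in>E. \<epsilon> e = f" if f: "f \<in> E" for f
  proof -
    obtain q where q: "q \<in> pts" "dom q = f" using edge_point[OF f] .
    obtain p where p: "\<sigma> p = q" using surj by blast
    then have "p \<in> pts" using q in_pts by blast
    then show ?thesis using \<epsilon>[of p] p q by (auto simp: pts_def)
  qed
  have fix_iff: "(\<forall>q\<in>pts. dom q = \<epsilon> e \<longrightarrow> a' q = q) \<longleftrightarrow> (\<forall>p\<in>pts. dom p = e \<longrightarrow> a p = p)"
    if e: "e \<in> E" and aa: "\<forall>p. \<sigma> (a p) = a' (\<sigma> p)" for e a a'
  proof -
    obtain p0 where p0: "p0 \<in> pts" "dom p0 = e" using edge_point[OF e] .
    have de: "dom (\<sigma> p) = \<epsilon> e \<longleftrightarrow> dom p = e" if "p \<in> pts" for p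
      using \<epsilon>[OF p0(1)] dom_eq[OF that p0(1)] p0(2) by simp
    have eq: "a' (\<sigma> p) = \<sigma> p \<longleftrightarrow> a p = p" for p using aa permutes_inj[OF perm] by (metis injD)
    show ?thesis using de eq in_pts surj by metis
  qed
  have mono: "\<epsilon> f \<subseteq> \<epsilon> e \<longleftrightarrow> f \<subseteq> e" if ef: "e \<in> E" "f \<in> E" for e f
  proof -
    have "f \<subseteq> e \<longleftrightarrow> (\<forall>a'\<in>H. (\<forall>p\<in>pts. dom p = \<epsilon> e \<longrightarrow> a' p = p) \<longrightarrow> (\<forall>p\<in>pts. dom p = \<epsilon> f \<longrightarrow> a' p = p))"
      unfolding subset_iff_fixers[OF ef]
    proof (intro iffI ballI)
      fix a' assume L: "\<forall>a\<in>H. (\<forall>p\<in>pts. dom p = e \<longrightarrow> a p = p) \<longrightarrow> (\<forall>p\<in>pts. dom p = f \<longrightarrow> a p = p)" and "a' \<in> H"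
      then obtain a where a: "a \<in> H" "\<forall>p. \<sigma> (a p) = a' (\<sigma> p)" using n2 by metis
      show "(\<forall>p\<in>pts. dom p = \<epsilon> e \<longrightarrow> a' p = p) \<longrightarrow> (\<forall>p\<in>pts. dom p = \<epsilon> f \<longrightarrow> a' p = p)"
        unfolding fix_iff[OF ef(1) a(2)] fix_iff[OF ef(2) a(2)] using L a(1) by (rule bspec)
    next
      fix a assume L: "\<forall>a'\<in>H. (\<forall>p\<in>pts. dom p = \<epsilon> e \<longrightarrow> a' p = p) \<longrightarrow> (\<forall>p\<in>pts. dom p = \<epsilon> f \<longrightarrow> a' p = p)" and "a \<in> H"
      then obtain a' where a: "a' \<in> H" "\<forall>p. \<sigma> (a p) = a' (\<sigma> p)" using n1 by metis
      show "(\<forall>p\<in>pts. dom p = e \<longrightarrow> a p = p) \<longrightarrow> (\<forall>p\<in>pts. dom p = f \<longrightarrow> a p = p)"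
        unfolding fix_iff[OF ef(1) a(2), symmetric] fix_iff[OF ef(2) a(2), symmetric] using L a(1) by (rule bspec)
    qed
    then show ?thesis using subset_iff_fixers[OF \<epsilon>E[OF ef(1)] \<epsilon>E[OF ef(2)]] by blast
  qed
  \<comment> \<open>For \<open>w\<close> in \<open>\<epsilon> {v}\<close>, the hyperedge mapped to
    \<open>{w}\<close> must be contained in \<open>{v}\<close>, hence equal to it.\<close>
  have "\<exists>w\<in>V. \<epsilon> {v} = {w}" if v: "v \<in> V" for v
  proof -
    have "\<epsilon> {v} \<in> E" using \<epsilon>E sing[OF v] .
    then obtain w where w: "w \<in> \<epsilon> {v}" "w \<in> V" using EV by blast
    obtain e where e: "e \<in> E" "\<epsilon> e = {w}" using \<epsilon>surj sing[OF w(2)] by blast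
    then have "e \<subseteq> {v}" using mono[OF sing[OF v] e(1)] w(1) by simp
    then have "e = {v}" using EV[OF e(1)] by blast
    then show ?thesis using e(2) w(2) by blast
  qed
  then obtain \<pi> where \<pi>: "\<And>v. v \<in> V \<Longrightarrow> \<pi> v \<in> V" "\<And>v. v \<in> V \<Longrightarrow> \<epsilon> {v} = {\<pi> v}" by metis
  have "inj_on \<pi> V"
  proof (rule inj_onI)
    fix v w assume "v \<in> V" "w \<in> V" "\<pi> v = \<pi> w"
    then have "{v} \<subseteq> {w}" using mono[of "{w}" "{v}"] \<pi>(2) sing by simp
    then show "v = w" by simp
  qed
  then have bij: "bij_betw \<pi> V V"
    using \<pi>(1) finV by (metis bij_betw_def endo_inj_surj image_subsetI)
  have \<epsilon>\<pi>: "\<epsilon> e = \<pi> ` e" if e: "e \<in> E" for e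
  proof -
    have iff: "\<pi> v \<in> \<epsilon> e \<longleftrightarrow> v \<in> e" if "v \<in> V" for v
      using mono[OF e sing[OF that]] \<pi>(2)[OF that] by simp
    have "w \<in> \<epsilon> e \<longleftrightarrow> w \<in> \<pi> ` e" for w
    proof (cases "w \<in> V")
      case True
      then obtain v where "v \<in> V" "w = \<pi> v" using bij by (auto simp: bij_betw_def)
      then show ?thesis
        using iff[of v] inj_on_image_mem_iff[OF \<open>inj_on \<pi> V\<close>, of v e] EV[OF e] by simp
    next
      case False
      moreover have "\<epsilon> e \<subseteq> V" "\<pi> ` e \<subseteq> V" using EV[OF \<epsilon>E[OF e]] EV[OF e] \<pi>(1) by auto
      ultimately show ?thesis by blast
    qed
    then show ?thesis by blast
  qed
  have dom\<pi>: "dom (\<sigma> p) = \<pi> ` dom p" if "p \<in> pts" for p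
    using \<epsilon>[OF that] \<epsilon>\<pi>[of "dom p"] that by (simp add: pts_def)
  have "s (\<pi> v) = s v" if v: "v \<in> V" for v
  proof -
    have card: "card {p \<in> pts. dom p = {w}} = s w" if "w \<in> V" for w
    proof -
      have "{p \<in> pts. dom p = {w}} = single w ` {..<s w}"
      proof (intro equalityI subsetI)
        fix p assume "p \<in> {p \<in> pts. dom p = {w}}"
        then show "p \<in> single w ` {..<s w}" using pts_singleE[of p w] by blast
      next
        fix p assume "p \<in> single w ` {..<s w}"
        then obtain i where "i < s w" "p = single w i" by blast
        then show "p \<in> {p \<in> pts. dom p = {w}}" using single_in_pts[OF that, of i] by simp
      qed
      moreover have "inj_on (single w) {..<s w}" by (auto intro!: inj_onI dest: fun_upd_eqD)
      ultimately show ?thesis by (simp add: card_image)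
    qed
    have "\<sigma> ` {p \<in> pts. dom p = {v}} = {p \<in> pts. dom p = {\<pi> v}}"
    proof (intro equalityI subsetI)
      fix q assume "q \<in> {p \<in> pts. dom p = {\<pi> v}}"
      then have q: "q \<in> pts" "dom q = {\<pi> v}" by auto
      obtain p where p: "\<sigma> p = q" using surj by blast
      then have "p \<in> pts" using q in_pts by blast
      have "\<pi> ` dom p = {\<pi> v}" using dom\<pi>[OF \<open>p \<in> pts\<close>] p q by simp
      moreover have "dom p \<subseteq> V" "dom p \<noteq> {}" using \<open>p \<in> pts\<close> EV by (auto simp: pts_def)
      ultimately have "dom p = {v}" using inj_on_image_eq_iff[OF \<open>inj_on \<pi> V\<close>, of "dom p" "{v}"] v by simp
      then show "q \<in> \<sigma> ` {p \<in> pts. dom p = {v}}" using \<open>p \<in> pts\<close> p by blast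
    next
      fix q assume "q \<in> \<sigma> ` {p \<in> pts. dom p = {v}}"
      then obtain p where p: "p \<in> pts" "dom p = {v}" "q = \<sigma> p" by blast
      then show "q \<in> {p \<in> pts. dom p = {\<pi> v}}" using dom\<pi>[OF p(1)] in_pts[of p] by simp
    qed
    then have "card {p \<in> pts. dom p = {\<pi> v}} = card {p \<in> pts. dom p = {v}}"
      using card_image[OF inj_on_subset[OF permutes_inj[OF perm] subset_UNIV], of "{p \<in> pts. dom p = {v}}"] by simp
    then show ?thesis using card[OF v] card[OF \<pi>(1)[OF v]] by simp
  qed
  moreover have "\<pi> ` e \<in> E" if "e \<in> E" for e using \<epsilon>E \<epsilon>\<pi> that by metis
  ultimately show ?thesis using that[OF bij dom\<pi>] by blast
qed

text \<open>After correction by an element of \<open>H\<close> every point over a singleton is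
  fixed. The corrected \<open>\<tau>\<close> then commutes with each \<open>act k\<close> on points,
  because \<open>act k\<close> is determined by its effect over singletons. If \<open>\<tau>\<close>
  moved a point, some \<open>act k\<close> would fix that point but not its image.\<close>

lemma normalizer_fixing_edges:
  assumes \<sigma>: "\<sigma> \<in> perm_normalizer pts H" and dom: "\<And>v i. v \<in> V \<Longrightarrow> i < s v \<Longrightarrow> dom (\<sigma> (single v i)) = {v}"
    and domp: "\<And>p. p \<in> pts \<Longrightarrow> dom (\<sigma> p) = dom p"
  shows "\<sigma> \<in> H"
proof -
  have perm: "\<sigma> permutes pts" using \<sigma> by (simp add: perm_normalizer_def)
  have "\<exists>j<s v. \<sigma> (single v i) = single v j" if "v \<in> V" "i < s v" for v i
    using dom[OF that] permutes_in_image[OF perm, of "single v i"] single_in_pts that pts_singleE by metis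
  then obtain g where g: "\<And>v i. v \<in> V \<Longrightarrow> i < s v \<Longrightarrow> g v i < s v \<and> \<sigma> (single v i) = single v (g v i)" by metis
  define h where "h v i = (if v \<in> V \<and> i < s v then g v i else i)" for v i
  have "h \<in> fam"
    unfolding fam_def
  proof safe
    fix v
    have "bij_betw (h v) {..<s v} {..<s v}"
    proof (cases "v \<in> V")
      case True
      have "inj_on (h v) {..<s v}"
      proof (rule inj_onI)
        fix i j assume ij: "i \<in> {..<s v}" "j \<in> {..<s v}" "h v i = h v j"
        then have "\<sigma> (single v i) = \<sigma> (single v j)" using g[OF True] True by (simp add: h_def)
        then have "single v i = single v j" using permutes_inj[OF perm] by (metis injD)
        then show "i = j" by (metis fun_upd_same option.inject)
      qed
      moreover have "h v ` {..<s v} \<subseteq> {..<s v}" using g[OF True] True by (auto simp: h_def)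
      ultimately show ?thesis by (metis bij_betw_def endo_inj_surj finite_lessThan)
    qed (auto simp: h_def bij_betw_def inj_on_def)
    then show "h v permutes {..<s v}" by (rule bij_imp_permutes) (auto simp: h_def)
  qed
  then have aH: "act h \<in> H" by (auto simp: H_def)
  then obtain b where b: "b \<in> H" "b \<circ> act h = id" "act h \<circ> b = id" using H_inv by blast
  define \<tau> where "\<tau> = b \<circ> \<sigma>"
  have \<tau>: "\<tau> \<in> perm_normalizer pts H"
    unfolding \<tau>_def using b(1) H_in_normalizer \<sigma> by (intro perm_normalizer_comp) auto
  have \<tau>p: "\<tau> permutes pts" using \<tau> by (simp add: perm_normalizer_def)
  have fix_single: "\<tau> (single v i) = single v i" if "v \<in> V" "i < s v" for v i
  proof -
    have "\<sigma> (single v i) = act h (single v i)" using g[OF that] act_single[OF that, of h] that by (simp add: h_def)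
    then show ?thesis using fun_cong[OF b(2), of "single v i"] by (simp add: \<tau>_def)
  qed
  have "\<tau> p = p" if p: "p \<in> pts" for p
  proof (rule ccontr)
    assume "\<tau> p \<noteq> p"
    define q where "q = \<tau> p"
    have q: "q \<in> pts" using permutes_in_image[OF \<tau>p] p by (simp add: q_def)
    have dq: "dom q = dom p" using domp[OF p] H_dom[OF b(1)] by (simp add: q_def \<tau>_def)
    obtain v where v: "q v \<noteq> p v" using \<open>\<tau> p \<noteq> p\<close> by (auto simp: q_def)
    then have vd: "v \<in> dom p" using dq by (auto simp: dom_def set_eq_iff)
    then obtain i where i: "p v = Some i" by blast
    have "v \<in> dom q" using vd dq by simp
    then obtain j where j: "q v = Some j" by blast
    have ij: "p v = Some i" "q v = Some j" "i \<noteq> j" using v i j by auto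
    have lt: "i < s v" "j < s v" using ij p q by (auto simp: pts_def)
    have vV: "v \<in> V" using vd p EV by (auto simp: pts_def)
    \<comment> \<open>This is where weights at least 3 enter: a third value \<open>l\<close> is
      needed, so that swapping \<open>j\<close> and \<open>l\<close> leaves \<open>i\<close>
      alone.\<close>
    have "card {i, j} < card {..<s v}" using s3[OF vV] by (simp add: card_insert_if)
    then have "{..<s v} - {i, j} \<noteq> {}" by (metis Diff_eq_empty_iff card_mono finite.emptyI finite_insert not_le)
    then obtain l where l: "l < s v" "l \<noteq> i" "l \<noteq> j" by auto
    define k where "k = (\<lambda>_. id)(v := Transposition.transpose j l)"
    have k: "k \<in> fam" using l lt by (auto simp: k_def fam_def permutes_id intro!: permutes_swap_id)
    have "act k \<in> H" using k by (auto simp: H_def)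
    then obtain c where c: "c \<in> H" "\<tau> \<circ> act k = c \<circ> \<tau>" using \<tau> by (auto simp: perm_normalizer_def)
    obtain k' where k': "k' \<in> fam" "c = act k'" using c(1) by (auto simp: H_def)
    have kk: "k' w i = k w i" if "w \<in> V" "i < s w" for w i
    proof -
      have "\<tau> (act k (single w i)) = c (\<tau> (single w i))" using c(2) by (auto simp: fun_eq_iff)
      then have "single w (k w i) = single w (k' w i)"
        using that fix_single famD(2)[OF k, of w i] act_single[OF that] k'(2) by simp
      then show ?thesis by (metis fun_upd_same option.inject)
    qed
    have "c q = act k q"
    proof
      fix w
      have "map_option (k' w) (q w) = map_option (k w) (q w)"
        using kk[of w] q EV by (cases "q w") (auto simp: pts_def dom_def subset_iff)
      then show "c q w = act k q w" using q k'(2) by (simp add: act_def)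
    qed
    moreover have "act k p = p"
      using p ij(1,3) l(2) by (auto simp: act_def k_def fun_eq_iff option.map_id0)
    moreover have "\<tau> (act k p) = c (\<tau> p)" using fun_cong[OF c(2), of p] by simp
    ultimately have "act k q = q" by (simp add: q_def)
    then have "act k q v = Some j" using ij by simp
    then show False using q ij(2) l(3) by (simp add: act_def k_def)
  qed
  moreover have "\<tau> p = p" if "p \<notin> pts" for p using \<tau>p that by (rule permutes_not_in)
  ultimately have "b \<circ> \<sigma> = id" unfolding \<tau>_def fun_eq_iff id_apply by blast
  then have "\<sigma> = act h" using b(3) by (metis comp_assoc comp_id id_comp)
  then show ?thesis using aH by simp
qed

end

text \<open>
  The vertices are pairs of a group element and a level; the weights distinguish the levels. The hyperedges
  \<open>{x} \<times> levels\<close> force an automorphism to act in the same way \<open>\<mu>\<close> on all levels, the hyperedges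
  \<open>{(x c, Some c) | c}\<close> force \<open>\<mu> (x c) = \<mu> (x) c\<close>, so that \<open>\<mu>\<close> is a left translation.
\<close>

theorem normalizer_realization:
  fixes G :: "('g, 'm) monoid_scheme" (structure) and r :: nat
  assumes G: "group G" and fin: "finite (carrier G)"
  obtains \<Omega> :: "('g \<times> 'g option \<Rightarrow> nat option) set" and H \<Psi> C where
    "finite \<Omega>" "card \<Omega> \<ge> 3" "H \<subseteq> perm_normalizer \<Omega> H" "id \<in> H"
    "\<And>\<sigma> \<rho>. \<sigma> \<in> perm_normalizer \<Omega> H \<Longrightarrow> \<rho> \<in> perm_normalizer \<Omega> H \<Longrightarrow> \<Psi> (\<sigma> \<circ> \<rho>) = \<Psi> \<sigma> \<otimes>\<^bsub>G\<^esub> \<Psi> \<rho>"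
    "\<Psi> ` perm_normalizer \<Omega> H = carrier G"
    "\<And>\<sigma>. \<sigma> \<in> perm_normalizer \<Omega> H \<Longrightarrow> \<Psi> \<sigma> = \<one>\<^bsub>G\<^esub> \<longleftrightarrow> \<sigma> \<in> H"
    "finite C" "card C \<ge> r" "\<And>\<sigma>. \<sigma> \<in> C \<Longrightarrow> \<sigma> permutes \<Omega>"
    "\<And>\<sigma> \<rho> h. \<sigma> \<in> C \<Longrightarrow> \<rho> \<in> C \<Longrightarrow> h \<in> H \<Longrightarrow> \<rho> = \<sigma> \<circ> h \<Longrightarrow> \<rho> = \<sigma>"
proof -
  interpret group G by (rule G)
  define L where "L = insert None (Some ` carrier G)"
  define V where "V = carrier G \<times> L"
  obtain idx :: "'g option \<Rightarrow> nat" where idx: "inj_on idx L"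
    using finite_imp_inj_to_nat_seg[of L] fin unfolding L_def by blast
  \<comment> \<open>\<open>idx\<close> makes the weight determine the level, 3 is the minimum
    demanded by the locale, and \<open>r\<close> leaves room for \<open>r\<close> distinct points
    over a single vertex.\<close>
  define s where "s v = r + 3 + idx (snd v)" for v :: "'g \<times> 'g option"
  define d where "d x = {x} \<times> L" for x :: 'g
  define e where "e x = (\<lambda>c. (x \<otimes> c, Some c)) ` carrier G" for x
  define E where "E = (\<lambda>v. {v}) ` V \<union> d ` carrier G \<union> e ` carrier G"
  have e_mem: "(y, l) \<in> e x \<longleftrightarrow> (\<exists>c\<in>carrier G. y = x \<otimes> c \<and> l = Some c)" for x y l by (auto simp: e_def)
  interpret weighted_hypergraph V E s
    by unfold_locales (auto simp: V_def L_def E_def d_def e_def s_def fin)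
  let ?N = "perm_normalizer pts H"
  have translation: "\<exists>g\<in>carrier G. \<forall>x\<in>carrier G. \<forall>l\<in>L. \<pi> (x, l) = (g \<otimes> x, l)"
    if \<pi>: "bij_betw \<pi> V V \<and> (\<forall>v\<in>V. s (\<pi> v) = s v) \<and> (\<forall>e\<in>E. \<pi> ` e \<in> E)" for \<pi>
  proof -
    have lev: "fst (\<pi> (x, l)) \<in> carrier G" "snd (\<pi> (x, l)) = l" if "x \<in> carrier G" "l \<in> L" for x l
    proof -
      have v: "(x, l) \<in> V" using that by (simp add: V_def)
      then have v': "\<pi> (x, l) \<in> V" using \<pi> by (auto simp: bij_betw_def)
      then show "fst (\<pi> (x, l)) \<in> carrier G" by (auto simp: V_def)
      have "idx (snd (\<pi> (x, l))) = idx l" using \<pi> v by (force simp: s_def)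
      then show "snd (\<pi> (x, l)) = l" using idx that(2) v' by (auto simp: V_def dest: inj_onD)
    qed
    define \<mu> where "\<mu> x = fst (\<pi> (x, None))" for x
    have N: "None \<in> L" and Sm: "Some c \<in> L" if "c \<in> carrier G" for c using that by (auto simp: L_def)
    have NL: "None \<in> L" by (simp add: L_def)
    have \<pi>\<mu>: "\<pi> (x, l) = (\<mu> x, l)" if x: "x \<in> carrier G" "l \<in> L" for x l
    proof -
      have "\<pi> ` d x \<in> E" using \<pi> x(1) by (auto simp: E_def)
      \<comment> \<open>The image meets two levels, so it is no singleton, and it meets the level
        \<open>None\<close>, so it is no \<open>e y\<close>; only \<open>d y\<close>
        remains.\<close>
      then have cases: "(\<exists>v. \<pi> ` d x = {v}) \<or> (\<exists>y. \<pi> ` d x = d y) \<or> (\<exists>y. \<pi> ` d x = e y)"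
        unfolding E_def by blast
      have 1: "\<pi> (x, None) \<in> \<pi> ` d x" "\<pi> (x, Some \<one>) \<in> \<pi> ` d x" "\<pi> (x, l) \<in> \<pi> ` d x"
        using x(2) by (auto simp: d_def L_def)
      have 2: "\<pi> (x, None) \<noteq> \<pi> (x, Some \<one>)"
        using lev(2)[OF x(1) NL] lev(2)[OF x(1) Sm[OF one_closed]] by auto
      have 3: "\<pi> (x, None) \<notin> e y" for y using lev(2)[OF x(1) NL] e_mem[of "fst (\<pi> (x, None))" None y]
        by (metis option.distinct(1) prod.collapse)
      have "\<pi> ` d x \<noteq> {v}" "\<pi> ` d x \<noteq> e y" for v y using 1(1,2) 2 3 by (metis singletonD, metis)
      then obtain y where "\<pi> ` d x = d y" using cases by metis
      then have "fst (\<pi> (x, None)) = y" "fst (\<pi> (x, l)) = y" using 1 by (auto simp: d_def)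
      then show ?thesis using lev(2)[OF x] by (metis \<mu>_def prod.collapse)
    qed
    have \<mu>c: "\<mu> x \<in> carrier G" if "x \<in> carrier G" for x using lev(1)[OF that NL] by (simp add: \<mu>_def)
    have "\<mu> c = \<mu> \<one> \<otimes> c" if c: "c \<in> carrier G" for c
    proof -
      have "\<pi> ` e \<one> \<in> E" using \<pi> by (auto simp: E_def)
      moreover have mem: "(\<mu> c, Some c) \<in> \<pi> ` e \<one>" if "c \<in> carrier G" for c
      proof -
        have "(c, Some c) \<in> e \<one>" using that by (auto simp: e_mem)
        then show ?thesis using \<pi>\<mu>[OF that Sm[OF that]] by (metis imageI)
      qed
      moreover have "\<pi> ` e \<one> \<noteq> d y" for y
      proof
        assume "\<pi> ` e \<one> = d y"
        then have "(y, None) \<in> \<pi> ` e \<one>" by (auto simp: d_def L_def)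
        then obtain c where "c \<in> carrier G" "\<pi> (c, Some c) = (y, None)" by (auto simp: e_def)
        then show False using \<pi>\<mu>[OF _ Sm] by auto
      qed
      ultimately consider v where "\<pi> ` e \<one> = {v}" | y where "y \<in> carrier G" "\<pi> ` e \<one> = e y"
        unfolding E_def by blast
      then show ?thesis
      proof cases
        case 1
        then have "(\<mu> c, Some c) = (\<mu> \<one>, Some \<one>)" using mem[OF c] mem[OF one_closed] by auto
        then show ?thesis using \<mu>c by auto
      next
        case 2
        then have "\<mu> c = y \<otimes> c" "\<mu> \<one> = y \<otimes> \<one>" using mem[OF c] mem[OF one_closed] e_mem by auto
        then show ?thesis using 2(1) by simp
      qed
    qed
    then show ?thesis using \<pi>\<mu> \<mu>c[OF one_closed] by metis
  qed
  have "\<exists>g\<in>carrier G. \<forall>p\<in>pts. dom (\<sigma> p) = (\<lambda>(x, l). (g \<otimes> x, l)) ` dom p" if \<sigma>: "\<sigma> \<in> ?N" for \<sigma>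
  proof -
    obtain \<pi> where \<pi>: "bij_betw \<pi> V V" "\<And>p. p \<in> pts \<Longrightarrow> dom (\<sigma> p) = \<pi> ` dom p"
      "\<And>v. v \<in> V \<Longrightarrow> s (\<pi> v) = s v" "\<And>e. e \<in> E \<Longrightarrow> \<pi> ` e \<in> E"
      using normalizer_edge_map[OF \<sigma>] by metis
    then have "bij_betw \<pi> V V \<and> (\<forall>v\<in>V. s (\<pi> v) = s v) \<and> (\<forall>e\<in>E. \<pi> ` e \<in> E)" by blast
    from translation[OF this] obtain g where g: "g \<in> carrier G" "\<forall>x\<in>carrier G. \<forall>l\<in>L. \<pi> (x, l) = (g \<otimes> x, l)"
      by blast
    have "dom (\<sigma> p) = (\<lambda>(x, l). (g \<otimes> x, l)) ` dom p" if p: "p \<in> pts" for p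
    proof -
      have "dom p \<subseteq> V" using p EV by (auto simp: pts_def)
      then show ?thesis unfolding \<pi>(2)[OF p] using g(2) by (intro image_cong) (auto simp: V_def)
    qed
    then show ?thesis using g(1) by blast
  qed
  then obtain \<Psi> where \<Psi>: "\<And>\<sigma>. \<sigma> \<in> ?N \<Longrightarrow> \<Psi> \<sigma> \<in> carrier G"
    "\<And>\<sigma> p. \<sigma> \<in> ?N \<Longrightarrow> p \<in> pts \<Longrightarrow> dom (\<sigma> p) = (\<lambda>(x, l). (\<Psi> \<sigma> \<otimes> x, l)) ` dom p" by metis
  have vV: "(\<one>, None) \<in> V" "(\<one>, Some \<one>) \<in> V" by (auto simp: V_def L_def)
  \<comment> \<open>One test point over the vertex \<open>(\<one>, None)\<close> suffices to read
    off the translation \<open>\<Psi> \<sigma>\<close> from the domain of its image.\<close>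
  define x0 where "x0 = single (\<one>, None) 0"
  have x0: "x0 \<in> pts" unfolding x0_def using single_in_pts[OF vV(1), of 0] s3[OF vV(1)] by simp
  have dx0: "dom (\<sigma> x0) = {(\<Psi> \<sigma>, None)}" if "\<sigma> \<in> ?N" for \<sigma>
    using \<Psi>(2)[OF that x0] \<Psi>(1)[OF that] by (simp add: x0_def)
  have hom: "\<Psi> (\<sigma> \<circ> \<rho>) = \<Psi> \<sigma> \<otimes> \<Psi> \<rho>" if "\<sigma> \<in> ?N" "\<rho> \<in> ?N" for \<sigma> \<rho>
  proof -
    have "\<rho> x0 \<in> pts" using permutes_in_image[OF perm_normalizerD(1)[OF that(2)]] x0 by simp
    from \<Psi>(2)[OF that(1) this] have "dom (\<sigma> (\<rho> x0)) = {(\<Psi> \<sigma> \<otimes> \<Psi> \<rho>, None)}"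
      using dx0[OF that(2)] by simp
    then show ?thesis using dx0[OF perm_normalizer_comp[OF that]] by simp
  qed
  have ker: "\<Psi> \<sigma> = \<one> \<longleftrightarrow> \<sigma> \<in> H" if \<sigma>: "\<sigma> \<in> ?N" for \<sigma>
  proof
    assume "\<sigma> \<in> H"
    then show "\<Psi> \<sigma> = \<one>" using dx0[OF \<sigma>] H_dom[of \<sigma> x0] by (simp add: x0_def)
  next
    assume 1: "\<Psi> \<sigma> = \<one>"
    have "dom (\<sigma> p) = dom p" if p: "p \<in> pts" for p
    proof -
      have "dom p \<subseteq> V" using p EV by (auto simp: pts_def)
      then have "(\<lambda>(x, l). (\<one> \<otimes> x, l)) ` dom p = id ` dom p" by (intro image_cong) (auto simp: V_def)
      then show ?thesis using \<Psi>(2)[OF \<sigma> p] 1 by simp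
    qed
    then show "\<sigma> \<in> H" using normalizer_fixing_edges[OF \<sigma>] single_in_pts by simp
  qed
  have surj: "g \<in> \<Psi> ` ?N" if g: "g \<in> carrier G" for g
  proof -
    define sh where "sh a = (\<lambda>(x :: 'g, l :: 'g option). (a \<otimes> x, l))" for a
    have shV: "sh a v \<in> V \<longleftrightarrow> v \<in> V" if "a \<in> carrier G" "fst v \<in> carrier G" for a v
      using that by (auto simp: sh_def V_def split: prod.splits)
    have sh_inv: "sh (inv a) (sh a v) = v" "sh a (sh (inv a) v) = v" if "a \<in> carrier G" "v \<in> V" for a v
      using that by (auto simp: sh_def V_def m_assoc[symmetric])
    have shbij: "bij_betw (sh a) V V" if "a \<in> carrier G" for a
      using that by (intro bij_betwI[where g = "sh (inv a)"]) (auto simp: sh_inv, auto simp: sh_def V_def)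
    have shE: "sh a ` f \<in> E" if a: "a \<in> carrier G" and f: "f \<in> E" for a f
    proof -
      have "sh a ` d x = d (a \<otimes> x)" for x by (auto simp: sh_def d_def)
      moreover have "sh a ` e x = e (a \<otimes> x)" if "x \<in> carrier G" for x
        unfolding e_def image_image sh_def using a that by (intro image_cong) (auto simp: m_assoc)
      moreover have "sh a ` {v} = {sh a v} \<and> sh a v \<in> V" if "v \<in> V" for v
        using a that by (auto simp: sh_def V_def)
      ultimately show ?thesis using f a unfolding E_def by blast
    qed
    \<comment> \<open>The permutation of points induced by left translation with \<open>a\<close>:
      the coordinates move along, hence the inverse in the argument.\<close>
    define w where "w a p = (if p \<in> pts then (\<lambda>v. if v \<in> V then p (sh (inv a) v) else None) else p)" for a p
    have domw: "dom (w a p) = sh a ` dom p" if a: "a \<in> carrier G" and p: "p \<in> pts" for a p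
    proof -
      have dV: "dom p \<subseteq> V" using p EV by (auto simp: pts_def)
      show ?thesis
      proof (intro equalityI subsetI)
        fix v assume "v \<in> dom (w a p)"
        then have v: "v \<in> V" "sh (inv a) v \<in> dom p" using p by (auto simp: w_def split: if_splits)
        show "v \<in> sh a ` dom p" using imageI[OF v(2), of "sh a"] sh_inv(2)[OF a v(1)] by simp
      next
        fix v assume "v \<in> sh a ` dom p"
        then obtain u where u: "u \<in> dom p" "v = sh a u" by blast
        then have "u \<in> V" using dV by blast
        then have "v \<in> V" "sh (inv a) v = u" using u shbij[OF a] sh_inv(1)[OF a] by (auto simp: bij_betw_def)
        then show "v \<in> dom (w a p)" using u(1) p by (auto simp: w_def)
      qed
    qed
    have w_pts: "w a p \<in> pts" if a: "a \<in> carrier G" and p: "p \<in> pts" for a p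
    proof -
      have ss: "s (sh b v) = s v" for b v by (simp add: s_def sh_def split: prod.splits)
      have "i < s v" if "w a p v = Some i" for v i
      proof -
        have "p (sh (inv a) v) = Some i" using that p by (auto simp: w_def split: if_splits)
        then have "i < s (sh (inv a) v)" using p unfolding pts_def by blast
        then show ?thesis by (simp only: ss)
      qed
      moreover have "dom (w a p) \<in> E" using domw[OF a p] shE[OF a] p by (simp add: pts_def)
      ultimately show ?thesis by (simp add: pts_def)
    qed
    have w_inv: "w (inv a) (w a p) = p" if a: "a \<in> carrier G" for a p
    proof (cases "p \<in> pts")
      case True
      have dV: "dom p \<subseteq> V" using True EV by (auto simp: pts_def)
      show ?thesis
      proof
        fix v
        show "w (inv a) (w a p) v = p v"
        proof (cases "v \<in> V")
          case v: True
          have "sh a v \<in> V" using shbij[OF a] v by (auto simp: bij_betw_def)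
          then show ?thesis using True w_pts[OF a True] v a sh_inv(1)[OF a v] by (simp add: w_def)
        next
          case False
          then have "p v = None" using dV by blast
          then show ?thesis using False w_pts[OF a True] by (simp add: w_def)
        qed
      qed
    qed (simp add: w_def)
    have w_perm: "w g permutes pts"
    proof (rule bij_imp_permutes)
      show "bij_betw (w g) pts pts"
        using w_pts[OF g] w_pts[OF inv_closed[OF g]] w_inv[OF g] w_inv[OF inv_closed[OF g]] g
        by (intro bij_betwI[where g = "w (inv g)"]) auto
    qed (simp add: w_def)
    have conj: "\<exists>h'\<in>fam. w a \<circ> act h = act h' \<circ> w a" if a: "a \<in> carrier G" and h: "h \<in> fam" for a h
    proof -
      define h' where "h' v = h (sh (inv a) v)" for v
      have ss: "s (sh b v) = s v" for b v by (simp add: s_def sh_def split: prod.splits)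
      have "h' v permutes {..<s v}" for v
        using famD(1)[OF h, of "sh (inv a) v"] unfolding h'_def ss .
      then have "h' \<in> fam" unfolding fam_def by blast
      moreover have "w a (act h p) = act h' (w a p)" for p
        using act_in_pts[OF h, of p] w_pts[OF a, of p] by (cases "p \<in> pts") (auto simp: w_def act_def h'_def)
      ultimately show ?thesis by (auto simp: fun_eq_iff)
    qed
    have "w g \<in> ?N"
    proof -
      have "\<exists>h\<in>H. w g \<circ> h = h' \<circ> w g" if h': "h' \<in> H" for h'
      proof -
        obtain h where h: "h \<in> H" "w (inv g) \<circ> h' = h \<circ> w (inv g)"
          using conj[OF inv_closed[OF g]] h' by (force simp: H_def)
        have 1: "w g \<circ> w (inv g) = id" "w (inv g) \<circ> w g = id"
          using w_inv[OF inv_closed[OF g]] w_inv[OF g] g by (auto simp: fun_eq_iff)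
        have "w g \<circ> h = w g \<circ> (h \<circ> w (inv g)) \<circ> w g" by (simp only: comp_assoc 1 comp_id)
        also have "\<dots> = (w g \<circ> w (inv g)) \<circ> h' \<circ> w g" by (simp only: h(2)[symmetric] comp_assoc)
        also have "\<dots> = h' \<circ> w g" by (simp only: 1 id_comp)
        finally show ?thesis using h(1) by blast
      qed
      moreover have "\<exists>h'\<in>H. w g \<circ> h = h' \<circ> w g" if "h \<in> H" for h
        using that conj[OF g] by (force simp: H_def)
      ultimately show ?thesis using w_perm by (auto simp: perm_normalizer_def)
    qed
    moreover have "dom (w g x0) = {(g, None)}" using domw[OF g x0] g by (simp add: x0_def sh_def)
    then have "\<Psi> (w g) = g" using dx0[OF \<open>w g \<in> ?N\<close>] by simp
    ultimately show ?thesis by (metis imageI)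
  qed
  define y where "y j = single (\<one>, Some \<one>) j" for j
  \<comment> \<open>Representatives of distinct left cosets of \<open>H\<close>: for two different
    ones, \<open>\<sigma> \<circ> \<rho>\<close> sends \<open>y i\<close> to \<open>x0\<close>, a
    point over another hyperedge, which no element of \<open>H\<close> does. So \<open>H\<close> has
    index at least \<open>r\<close>.\<close>
  define C where "C = (\<lambda>j. Transposition.transpose x0 (y j)) ` {..<r}"
  have y: "y j \<in> pts" if "j < r" for j unfolding y_def using single_in_pts[OF vV(2), of j] that by (simp add: s_def)
  have y_ne: "x0 \<noteq> y j" "dom (y j) \<noteq> dom x0" for j by (auto simp: x0_def y_def fun_eq_iff)
  have y_inj: "y i = y j \<longleftrightarrow> i = j" for i j by (auto simp: y_def fun_eq_iff)
  have "inj_on (\<lambda>j. Transposition.transpose x0 (y j)) {..<r}"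
    by (rule inj_onI) (metis transpose_apply_first y_inj)
  then have cardC: "card C = r" by (simp add: C_def card_image)
  have C_perm: "\<sigma> permutes pts" if "\<sigma> \<in> C" for \<sigma>
    using that x0 y by (auto simp: C_def intro!: permutes_swap_id)
  have C_cosets: "\<rho> = \<sigma>" if C: "\<sigma> \<in> C" "\<rho> \<in> C" and h: "h \<in> H" "\<rho> = \<sigma> \<circ> h" for \<sigma> \<rho> h
  proof (rule ccontr)
    assume ne: "\<rho> \<noteq> \<sigma>"
    obtain i j where ij: "\<sigma> = Transposition.transpose x0 (y i)" "\<rho> = Transposition.transpose x0 (y j)"
      using C unfolding C_def by blast
    then have "i \<noteq> j" using ne by auto
    have "\<sigma> (\<rho> (y i)) = h (y i)" unfolding h(2) ij(1) by simp
    moreover have "\<rho> (y i) = y i" using ij(2) \<open>i \<noteq> j\<close> y_inj y_ne by (metis transpose_apply_other)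
    ultimately have "h (y i) = x0" using ij(1) by simp
    then show False using H_dom[OF h(1), of "y i"] y_ne by metis
  qed
  have card_pts: "card pts \<ge> 3"
  proof -
    have "single (\<one>, None) i \<in> pts" if "i < 3" for i using single_in_pts[OF vV(1), of i] s3[OF vV(1)] that by simp
    then have sub: "single (\<one>, None) ` {..<3} \<subseteq> pts" by blast
    have "inj_on (single (\<one>, None)) {..<3}" by (rule inj_onI) (metis fun_upd_same option.inject)
    from card_image[OF this] card_mono[OF finite_pts sub] show ?thesis by simp
  qed
  show ?thesis
  proof (rule that)
    show "finite pts" "card pts \<ge> 3" "H \<subseteq> ?N" "id \<in> H"
      by (fact finite_pts card_pts H_in_normalizer H_id)+
    show "\<Psi> ` ?N = carrier G" using \<Psi>(1) surj by blast
    show "finite C" "card C \<ge> r" using cardC by (simp_all add: C_def)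
  qed (fact hom ker C_perm C_cosets)+
qed

section \<open>Intermediate fields of the symmetric extension\<close>

lemma field_type_algebra: "field (ring_of_type_algebra :: 'a::field ring)"
  by (rule field_from_type_algebra)

lemma type_algebra_simps:
  "carrier (ring_of_type_algebra :: 'a::comm_ring_1 ring) = UNIV"
  "x \<oplus>\<^bsub>ring_of_type_algebra\<^esub> y = x + (y :: 'a)" "x \<otimes>\<^bsub>ring_of_type_algebra\<^esub> y = x * y"
  "\<one>\<^bsub>ring_of_type_algebra\<^esub> = (1 :: 'a)" "\<zero>\<^bsub>ring_of_type_algebra\<^esub> = (0 :: 'a)"
  by (simp_all add: ring_of_type_algebra_def)

lemma minus_type_algebra: "\<ominus>\<^bsub>ring_of_type_algebra\<^esub> x = - (x :: 'a::field)"
proof -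
  interpret R: field "ring_of_type_algebra :: 'a ring" by (rule field_type_algebra)
  show ?thesis using R.minus_equality[of "- x" x] by (simp add: type_algebra_simps)
qed

lemma subring_type_algebra:
  fixes K :: "'a::field set"
  assumes "is_subring K"
  shows "subring K ring_of_type_algebra"
proof -
  interpret R: field "ring_of_type_algebra :: 'a ring" by (rule field_type_algebra)
  show ?thesis
    by (rule R.subringI) (use is_subringD[OF assms] in \<open>auto simp: type_algebra_simps minus_type_algebra\<close>)
qed

lemma subfield_type_algebra:
  fixes K :: "'a::field alg_closure set"
  assumes "intermediate K"
  shows "subfield K ring_of_type_algebra"
proof -
  interpret R: field "ring_of_type_algebra :: 'a alg_closure ring" by (rule field_type_algebra)
  show ?thesis
  proof (rule R.subfieldI'[OF subring_type_algebra[OF intermediateD(1)[OF assms]]])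
    fix x assume x: "x \<in> K - {\<zero>\<^bsub>ring_of_type_algebra\<^esub>}"
    then have "inv\<^bsub>ring_of_type_algebra\<^esub> x = inverse x"
      by (intro R.comm_inv_char) (auto simp: type_algebra_simps)
    then show "inv\<^bsub>ring_of_type_algebra\<^esub> x \<in> K" using intermediate_inverse[OF assms] x by simp
  qed
qed

lemma algebraic_type_algebra:
  fixes x :: "'a::field alg_closure"
  shows "(ring.algebraic ring_of_type_algebra over range to_ac) x"
proof -
  interpret R: field "ring_of_type_algebra :: 'a alg_closure ring" by (rule field_type_algebra)
  obtain p :: "'a poly" where p: "p \<noteq> 0" "poly (map_poly to_ac p) x = 0" by (rule alg_closure_algebraic)
  define ys where "ys = coeffs (map_poly to_ac p)"
  have pow: "x [^]\<^bsub>ring_of_type_algebra\<^esub> n = x ^ n" for n :: nat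
    by (induction n) (simp_all add: type_algebra_simps mult.commute)
  \<comment> \<open>HOL-Algebra lists coefficients from the leading one downwards,
    \<open>coeffs\<close> from the constant one upwards.\<close>
  have "R.eval (rev zs) x = poly (Poly zs) x" for zs
    by (induction zs rule: rev_induct) (simp_all add: type_algebra_simps pow Poly_append poly_monom)
  then have "R.eval (rev ys) x = 0" using p(2) by (simp add: ys_def)
  moreover have nz: "map_poly to_ac p \<noteq> 0" using p(1) by (simp add: map_poly_eq_0_iff)
  then have ne: "ys \<noteq> []" by (simp add: ys_def)
  moreover have "set ys \<subseteq> range to_ac"
    unfolding ys_def using range_coeff[of "map_poly to_ac p"] by (auto simp: coeff_map_poly)
  moreover have "hd (rev ys) \<noteq> 0"
    using nz leading_coeff_0_iff[of "map_poly to_ac p"]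
    unfolding ys_def by (simp only: hd_rev last_coeffs_eq_coeff_degree not_False_eq_True)
  ultimately show ?thesis
    by (intro R.algebraicI[of "rev ys"]) (auto simp: univ_poly_def polynomial_def type_algebra_simps)
qed

text \<open>Inside the finite-dimensional extension generated by the algebraic elements of
  \<open>A\<close>, every intermediate \<open>L\<close> is a subspace.\<close>

lemma finite_extension_subfield:
  fixes L :: "'a::field alg_closure set"
  assumes A: "finite A" and L: "intermediate L" "L \<subseteq> adjoin (range to_ac) A"
  shows "finite_extension L"
proof -
  interpret R: field "ring_of_type_algebra :: 'a alg_closure ring" by (rule field_type_algebra)
  let ?B = "range to_ac :: 'a alg_closure set"
  obtain xs where xs: "set xs = A" using finite_list[OF A] by blast
  have B: "subfield ?B ring_of_type_algebra" by (rule subfield_type_algebra[OF intermediate_range])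
  have car: "set xs \<subseteq> carrier ring_of_type_algebra" by (simp add: type_algebra_simps)
  let ?F = "R.finite_extension ?B xs"
  have sub: "subring ?F ring_of_type_algebra"
    by (rule R.finite_extension_is_subring[OF subfieldE(1)[OF B] car])
  have "is_subring ?F"
    unfolding is_subring_def using subringE(3,6,7)[OF sub] subringE(5)[OF sub]
    by (auto simp: type_algebra_simps minus_type_algebra)
  then have "adjoin ?B A \<subseteq> ?F"
    using R.finite_extension_incl[OF subfieldE(3)[OF B] car]
      R.finite_extension_mem[OF subfieldE(1)[OF B] car] xs by (intro adjoin_minimal) auto
  then have LF: "L \<subseteq> ?F" using L(2) by blast
  have "R.finite_dimension ?B ?F"
    by (rule R.finite_extension_finite_dimension(1)[OF B car]) (rule algebraic_type_algebra)
  moreover have "subalgebra ?B L ring_of_type_algebra"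
  proof (rule subalgebra.intro)
    show "subgroup L (add_monoid ring_of_type_algebra)"
      using subring.axioms(1)[OF subring_type_algebra[OF intermediateD(1)[OF L(1)]]] .
    show "subalgebra_axioms ?B L ring_of_type_algebra"
      using is_subringD(4)[OF intermediateD(1)[OF L(1)]] intermediateD(2)[OF L(1)]
      by (auto simp: subalgebra_axioms_def type_algebra_simps)
  qed
  ultimately have "R.finite_dimension ?B L"
    using R.subalbegra_incl_imp_finite_dimension[OF B _ _ LF] by blast
  then show ?thesis
    using L(1) subfield_type_algebra[OF L(1)] by (simp add: finite_extension_def intermediate_def)
qed

section \<open>Automorphisms and embeddings of the fixed field\<close>

lemma endo_eq_on_adjoin:
  assumes "endo \<sigma>" "endo \<tau>" "\<And>a. a \<in> A \<Longrightarrow> \<sigma> a = \<tau> a" "x \<in> adjoin (range to_ac) A"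
  shows "\<sigma> x = \<tau> x"
proof -
  have "is_subring {x. \<sigma> x = \<tau> x}"
    using assms(1,2) by (auto simp: is_subring_def endoD)
  then have "adjoin (range to_ac) A \<subseteq> {x. \<sigma> x = \<tau> x}"
    using assms(1-3) by (intro adjoin_minimal) (auto simp: endoD)
  then show ?thesis using assms(4) by blast
qed

lemma endo_adjoin:
  assumes "endo \<tau>" "\<And>a. a \<in> A \<Longrightarrow> \<tau> a \<in> A" "x \<in> adjoin (range to_ac) A"
  shows "\<tau> x \<in> adjoin (range to_ac) A"
proof -
  let ?E = "adjoin (range to_ac) A"
  have "is_subring {x. \<tau> x \<in> ?E}"
    using assms(1) is_subringD[OF is_subring_adjoin[of "range to_ac" A]] by (auto simp: is_subring_def endoD)
  moreover have "range to_ac \<subseteq> ?E" "A \<subseteq> ?E" by (rule adjoin_mem)+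
  ultimately have "?E \<subseteq> {x. \<tau> x \<in> ?E}"
    using assms(1,2) by (intro adjoin_minimal) (auto simp: endoD)
  then show ?thesis using assms(3) by blast
qed

text \<open>\<open>Aut L\<close> and \<open>G\<close> are both images of the normalizer of
  \<open>H\<close> with kernel \<open>H\<close>, so both are isomorphic to the same quotient. The
  embeddings of \<open>L\<close> correspond to left cosets of \<open>H\<close>, of which
  \<open>C\<close> supplies at least \<open>r\<close>.\<close>

theorem realization:
  fixes G :: "('g, 'm) monoid_scheme"
  assumes k: "hilbertian TYPE('k::field)" and G: "group G" "finite (carrier G)"
  obtains L :: "'k::field alg_closure set" where "finite_extension L" "Aut L \<cong> G"
    "r \<le> card {restrict \<tau> L |\<tau>. endo \<tau>}"
proof -
  let ?B = "range to_ac :: 'k alg_closure set"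
  obtain \<Omega> :: "('g \<times> 'g option \<Rightarrow> nat option) set" and H \<Psi> C where
    \<Omega>: "finite \<Omega>" "card \<Omega> \<ge> 3" and H: "H \<subseteq> perm_normalizer \<Omega> H" "id \<in> H"
    and \<Psi>: "\<And>\<sigma> \<rho>. \<sigma> \<in> perm_normalizer \<Omega> H \<Longrightarrow> \<rho> \<in> perm_normalizer \<Omega> H \<Longrightarrow> \<Psi> (\<sigma> \<circ> \<rho>) = \<Psi> \<sigma> \<otimes>\<^bsub>G\<^esub> \<Psi> \<rho>"
      "\<Psi> ` perm_normalizer \<Omega> H = carrier G"
      "\<And>\<sigma>. \<sigma> \<in> perm_normalizer \<Omega> H \<Longrightarrow> \<Psi> \<sigma> = \<one>\<^bsub>G\<^esub> \<longleftrightarrow> \<sigma> \<in> H"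
    and C: "finite C" "card C \<ge> r" "\<And>\<sigma>. \<sigma> \<in> C \<Longrightarrow> \<sigma> permutes \<Omega>"
      "\<And>\<sigma> \<rho> h. \<sigma> \<in> C \<Longrightarrow> \<rho> \<in> C \<Longrightarrow> h \<in> H \<Longrightarrow> \<rho> = \<sigma> \<circ> h \<Longrightarrow> \<rho> = \<sigma>"
    by (rule normalizer_realization[OF G, of r]) (rule that)
  let ?N = "perm_normalizer \<Omega> H"
  let ?S = "{\<sigma>. \<sigma> permutes \<Omega>}"
  interpret G: group G by (rule G)
  have NS: "\<sigma> \<in> ?S" if "\<sigma> \<in> ?N" for \<sigma> using perm_normalizerD(1)[OF that] by simp
  have HS: "h \<in> ?S" if "h \<in> H" for h using NS H(1) that by blast
  have H_comp: "g \<circ> h \<in> H" if "g \<in> H" "h \<in> H" for g h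
  proof -
    have gh: "g \<in> ?N" "h \<in> ?N" using H(1) that by auto
    then have "\<Psi> (g \<circ> h) = \<one>\<^bsub>G\<^esub>" using \<Psi>(1)[OF gh] \<Psi>(3)[OF gh(1)] \<Psi>(3)[OF gh(2)] that by simp
    then show ?thesis using \<Psi>(3)[OF perm_normalizer_comp[OF gh]] by simp
  qed
  obtain f :: "'k poly" and \<alpha> where f: "map_poly to_ac f = (\<Prod>i\<in>\<Omega>. [:- \<alpha> i, 1:])" and inj: "inj_on \<alpha> \<Omega>"
    and sym: "\<And>\<sigma>. \<sigma> permutes \<Omega> \<Longrightarrow> \<sigma> \<in> galois_perms \<Omega> \<alpha>"
    by (rule symmetric_over_hilbertian_indexed[OF k \<Omega>]) (rule that)
  have "\<forall>\<sigma>\<in>?S. \<exists>\<tau>. endo \<tau> \<and> (\<forall>i\<in>\<Omega>. \<tau> (\<alpha> i) = \<alpha> (\<sigma> i))"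
    using sym by (auto simp: galois_perms_def)
  \<comment> \<open>\<open>T \<sigma>\<close> is one chosen endomorphism inducing
    \<open>\<sigma>\<close>; only its values on \<open>?E\<close> are determined, so composition
    laws hold there.\<close>
  then obtain T where T: "\<And>\<sigma>. \<sigma> \<in> ?S \<Longrightarrow> endo (T \<sigma>)" "\<And>\<sigma> i. \<sigma> \<in> ?S \<Longrightarrow> i \<in> \<Omega> \<Longrightarrow> T \<sigma> (\<alpha> i) = \<alpha> (\<sigma> i)"
    by metis
  let ?E = "adjoin ?B (\<alpha> ` \<Omega>)"
  have E: "is_subring ?E" "intermediate ?E"
    by (rule is_subring_adjoin, rule intermediate_adjoin[OF intermediate_range])
  have S_in: "\<sigma> i \<in> \<Omega>" if "\<sigma> \<in> ?S" "i \<in> \<Omega>" for \<sigma> i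
    using that(2) permutes_in_image[of \<sigma> \<Omega> i] that(1) by simp
  have S_comp: "\<sigma> \<circ> \<rho> \<in> ?S" if "\<sigma> \<in> ?S" "\<rho> \<in> ?S" for \<sigma> \<rho> using that permutes_compose by blast
  have S_inv: "inv_into UNIV \<sigma> \<in> ?S" if "\<sigma> \<in> ?S" for \<sigma> using that permutes_inv by blast
  have agree: "\<tau> x = T \<sigma> x" if "endo \<tau>" "\<sigma> \<in> ?S" "\<And>i. i \<in> \<Omega> \<Longrightarrow> \<tau> (\<alpha> i) = \<alpha> (\<sigma> i)" "x \<in> ?E" for \<tau> \<sigma> x
    by (rule endo_eq_on_adjoin[OF that(1) T(1)[OF that(2)] _ that(4)]) (use T(2)[OF that(2)] that(3) in auto)
  have TE: "T \<sigma> x \<in> ?E" if "\<sigma> \<in> ?S" "x \<in> ?E" for \<sigma> x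
    by (rule endo_adjoin[OF T(1)[OF that(1)] _ that(2)]) (use T(2)[OF that(1)] S_in[OF that(1)] in auto)
  have T_comp: "T (\<sigma> \<circ> \<rho>) x = T \<sigma> (T \<rho> x)" if "\<sigma> \<in> ?S" "\<rho> \<in> ?S" "x \<in> ?E" for \<sigma> \<rho> x
  proof -
    have "(T \<sigma> \<circ> T \<rho>) x = T (\<sigma> \<circ> \<rho>) x"
      by (rule agree[OF endo_comp[OF T(1)[OF that(1)] T(1)[OF that(2)]] S_comp[OF that(1,2)] _ that(3)])
         (use T(2)[OF that(1)] T(2)[OF that(2)] S_in[OF that(2)] in simp)
    then show ?thesis by simp
  qed
  have T_id: "T id x = x" if "x \<in> ?E" for x
  proof -
    have "id x = T id x" by (rule agree[OF endo_id _ _ that]) (simp_all add: permutes_id del: id_apply, simp)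
    then show ?thesis by simp
  qed
  have T_inv: "T \<sigma> (T (inv_into UNIV \<sigma>) x) = x" "T (inv_into UNIV \<sigma>) (T \<sigma> x) = x" if "\<sigma> \<in> ?S" "x \<in> ?E" for \<sigma> x
    using T_comp[OF that(1) S_inv[OF that(1)] that(2)] T_comp[OF S_inv[OF that(1)] that] T_id[OF that(2)]
      permutes_inv_o[of \<sigma> \<Omega>] that(1) by auto
  define L where "L = {x \<in> ?E. \<forall>h\<in>H. T h x = x}"
  have LE: "x \<in> ?E" if "x \<in> L" for x using that by (simp add: L_def)
  have L: "intermediate L"
  proof -
    have "intermediate {x. \<forall>\<tau>\<in>T ` H. endo \<tau> \<longrightarrow> \<tau> x = x}" by (rule intermediate_fixed)
    moreover have "L = ?E \<inter> {x. \<forall>\<tau>\<in>T ` H. endo \<tau> \<longrightarrow> \<tau> x = x}" using T(1)[OF HS] by (auto simp: L_def)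
    ultimately show ?thesis using E(2) is_subring_Int unfolding intermediate_def by blast
  qed
  have fin: "finite_extension L"
    by (rule finite_extension_subfield[OF finite_imageI[OF \<Omega>(1)] L]) (use LE in blast)

  \<comment> \<open>Artin's theorem by a resolvent: the product \<open>Q\<close> of the
    \<open>X - \<gamma> h\<close> over \<open>H\<close> has coefficients in \<open>L\<close>, so
    \<open>T \<sigma>\<close> fixes \<open>Q\<close> and \<open>\<gamma> \<sigma>\<close> is one of
    its roots, that is, \<open>\<sigma>\<close> is some \<open>h\<close>.\<close>
  have artin: "\<sigma> \<in> H" if \<sigma>: "\<sigma> \<in> ?S" and fixL: "\<And>x. x \<in> L \<Longrightarrow> T \<sigma> x = x" for \<sigma>
  proof -
    obtain b :: "('g \<times> 'g option \<Rightarrow> nat option) \<Rightarrow> nat" where b: "inj_on b \<Omega>" using finite_imp_inj_to_nat_seg[OF \<Omega>(1)] by blast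
    have "infinite (UNIV :: 'k set)"
      by (rule hilbertian_irreducible[OF k, of 2]) auto
    then have "infinite ?B" by (subst finite_image_iff) (auto simp: inj_to_ac)
    from distinct_power_sums[OF \<Omega>(1) b inj this] obtain c :: 'k where
      c: "inj_on (\<lambda>\<sigma>. \<Sum>i\<in>\<Omega>. to_ac c ^ b i * \<alpha> (\<sigma> i)) ?S" by blast
    define \<gamma> where "\<gamma> \<sigma> = (\<Sum>i\<in>\<Omega>. to_ac c ^ b i * \<alpha> (\<sigma> i))" for \<sigma>
    have T\<gamma>: "T \<rho> (\<gamma> \<sigma>) = \<gamma> (\<rho> \<circ> \<sigma>)" if "\<rho> \<in> ?S" "\<sigma> \<in> ?S" for \<rho> \<sigma>
    proof -
      have "T \<rho> (to_ac c ^ m) = to_ac c ^ m" for m using endoD(2)[OF T(1)[OF that(1)], of "c ^ m"] by simp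
      then show ?thesis
        unfolding \<gamma>_def endo_sum[OF T(1)[OF that(1)]] endoD(6)[OF T(1)[OF that(1)]]
        using T(2)[OF that(1)] S_in[OF that(2)] by simp
    qed
    have \<gamma>E: "\<gamma> \<sigma> \<in> ?E" if "\<sigma> \<in> ?S" for \<sigma>
      unfolding \<gamma>_def using S_in[OF that] adjoin_mem(2)[of "\<alpha> ` \<Omega>" ?B]
      by (intro is_subring_sum is_subringD(4) is_subring_power E intermediateD(2)[OF E(2)]) auto
    have finH: "finite H" using HS finite_permutations[OF \<Omega>(1)] by (metis finite_subset subsetI)
    define Q where "Q = (\<Prod>h\<in>H. [:- \<gamma> h, 1:])"
    have TQ: "map_poly (T \<rho>) Q = (\<Prod>h\<in>H. [:- \<gamma> (\<rho> \<circ> h), 1:])" if "\<rho> \<in> ?S" for \<rho>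
    proof -
      have "map_poly (T \<rho>) Q = (\<Prod>h\<in>H. [:- T \<rho> (\<gamma> h), 1:])"
        unfolding Q_def by (rule map_poly_prod_linear[OF endoD(1)[OF T(1)[OF that]]]) auto
      also have "\<dots> = (\<Prod>h\<in>H. [:- \<gamma> (\<rho> \<circ> h), 1:])" using T\<gamma>[OF that HS] by (intro prod.cong) auto
      finally show ?thesis .
    qed
    have "coeff Q m \<in> L" for m
    proof -
      have "coeff Q m \<in> ?E"
        using coeffs_in_prod_linear[OF E(1), of H \<gamma>] \<gamma>E[OF HS] by (auto simp: Q_def coeffs_in_def)
      moreover have "T g (coeff Q m) = coeff Q m" if g: "g \<in> H" for g
      proof -
        have "inj_on ((\<circ>) g) H"
          using inj_on_subset[OF fun.inj_map[OF permutes_inj] subset_UNIV] HS[OF g] by blast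
        moreover have "(\<circ>) g ` H \<subseteq> H" using H_comp[OF g] by blast
        ultimately have "bij_betw ((\<circ>) g) H H" using finH by (metis bij_betw_def endo_inj_surj)
        from prod.reindex_bij_betw[OF this, of "\<lambda>h. [:- \<gamma> h, 1:]"]
        have "map_poly (T g) Q = Q" using TQ[OF HS[OF g]] by (simp add: Q_def)
        then show ?thesis using endoD(4)[OF T(1)[OF HS[OF g]]] by (metis coeff_map_poly)
      qed
      ultimately show ?thesis by (simp add: L_def)
    qed
    then have "map_poly (T \<sigma>) Q = Q"
      using fixL endoD(4)[OF T(1)[OF \<sigma>]] by (intro poly_eqI) (simp add: coeff_map_poly)
    moreover have "poly (map_poly (T \<sigma>) Q) (\<gamma> \<sigma>) = 0"
      unfolding TQ[OF \<sigma>] using finH H(2) by (auto simp: poly_prod intro!: bexI[of _ id])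
    ultimately obtain h where h: "h \<in> H" "\<gamma> \<sigma> = \<gamma> h" using finH by (auto simp: Q_def poly_prod)
    then have "\<sigma> = h" using c \<sigma> HS[OF h(1)] unfolding \<gamma>_def inj_on_def by blast
    then show ?thesis using h(1) by simp
  qed

  have TL: "T \<sigma> x \<in> L" if \<sigma>: "\<sigma> \<in> ?N" and x: "x \<in> L" for \<sigma> x
  proof -
    have "T h (T \<sigma> x) = T \<sigma> x" if h: "h \<in> H" for h
    proof -
      obtain h' where h': "h' \<in> H" "\<sigma> \<circ> h' = h \<circ> \<sigma>" using perm_normalizerD(3)[OF \<sigma> h] by blast
      have "T h (T \<sigma> x) = T (\<sigma> \<circ> h') x" using T_comp[OF HS[OF h] NS[OF \<sigma>] LE[OF x]] h'(2) by simp
      also have "\<dots> = T \<sigma> x" using T_comp[OF NS[OF \<sigma>] HS[OF h'(1)] LE[OF x]] x h'(1) by (simp add: L_def)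
      finally show ?thesis .
    qed
    then show ?thesis using TE[OF NS[OF \<sigma>] LE[OF x]] by (simp add: L_def)
  qed
  define \<Theta> where "\<Theta> \<sigma> = restrict (T \<sigma>) L" for \<sigma>
  have \<Theta>_aut: "\<Theta> \<sigma> \<in> field_aut L" if \<sigma>: "\<sigma> \<in> ?N" for \<sigma>
  proof -
    note i = perm_normalizer_inv[OF \<sigma>]
    have "bij_betw (T \<sigma>) L L"
      by (rule bij_betwI[where g = "T (inv_into UNIV \<sigma>)"])
         (use TL[OF \<sigma>] TL[OF i] T_inv[OF NS[OF \<sigma>] LE] in auto)
    then have "\<Theta> \<sigma> \<in> Bij L" by (simp add: Bij_def \<Theta>_def bij_betw_restrict_eq)
    then show ?thesis
      using is_subringD(3,4)[OF intermediateD(1)[OF L]] intermediateD(2)[OF L] endoD[OF T(1)[OF NS[OF \<sigma>]]]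
      by (simp add: field_aut_def \<Theta>_def)
  qed
  \<comment> \<open>Extend \<open>s\<close> to the algebraic closure and let \<open>\<sigma>\<close>
    be the induced permutation. As \<open>s\<close> maps \<open>L\<close> onto itself, the
    conjugates of elements of \<open>H\<close> by \<open>\<sigma>\<close> fix \<open>L\<close>
    pointwise and lie in \<open>H\<close> by \<open>artin\<close>.\<close>
  have ext: "\<exists>\<sigma>\<in>?N. \<Theta> \<sigma> = s" if s: "s \<in> field_aut L" for s
  proof -
    have sb: "s \<in> Bij L" and hom: "\<And>x y. x \<in> L \<Longrightarrow> y \<in> L \<Longrightarrow> s (x + y) = s x + s y \<and> s (x * y) = s x * s y"
      and base: "\<And>c. s (to_ac c) = to_ac c" using s by (auto simp: field_aut_def)
    have "hom_on L s" using hom base[of 1] by (simp add: hom_on_def)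
    then obtain \<tau> where \<tau>: "hom_on UNIV \<tau>" "\<And>x. x \<in> L \<Longrightarrow> \<tau> x = s x"
      using extend_to_alg_closure[OF L] by blast
    have "endo \<tau>" using \<tau> base intermediateD(2)[OF L] by (simp add: endo_def)
    then obtain \<sigma> where \<sigma>: "\<sigma> \<in> ?S" "\<And>i. i \<in> \<Omega> \<Longrightarrow> \<tau> (\<alpha> i) = \<alpha> (\<sigma> i)"
      using endo_permutes_roots[OF \<Omega>(1) inj f] by (metis mem_Collect_eq)
    have Ts: "T \<sigma> x = s x" if "x \<in> L" for x using agree[OF \<open>endo \<tau>\<close> \<sigma> LE[OF that]] \<tau>(2)[OF that] by simp
    have sL: "s ` L = L" using sb by (simp add: Bij_def bij_betw_def)
    let ?i = "inv_into UNIV \<sigma>"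
    have i: "?i \<in> ?S" using S_inv[OF \<sigma>(1)] .
    have o: "\<sigma> \<circ> ?i = id" "?i \<circ> \<sigma> = id" using permutes_inv_o \<sigma>(1) by auto
    have c1: "\<sigma> \<circ> h \<circ> ?i \<in> H" if h: "h \<in> H" for h
    proof (rule artin)
      show S: "\<sigma> \<circ> h \<circ> ?i \<in> ?S" using S_comp[OF S_comp[OF \<sigma>(1) HS[OF h]] i] .
      fix x assume "x \<in> L"
      then obtain y where y: "y \<in> L" "x = T \<sigma> y" using sL Ts by (metis imageE)
      have "T (\<sigma> \<circ> h \<circ> ?i) x = T (\<sigma> \<circ> h) (T ?i (T \<sigma> y))"
        unfolding y(2) by (rule T_comp[OF S_comp[OF \<sigma>(1) HS[OF h]] i TE[OF \<sigma>(1) LE[OF y(1)]]])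
      also have "\<dots> = T \<sigma> (T h y)" using T_inv(2)[OF \<sigma>(1) LE[OF y(1)]] T_comp[OF \<sigma>(1) HS[OF h] LE[OF y(1)]] by simp
      also have "\<dots> = x" using y h by (simp add: L_def)
      finally show "T (\<sigma> \<circ> h \<circ> ?i) x = x" .
    qed
    have c2: "?i \<circ> h \<circ> \<sigma> \<in> H" if h: "h \<in> H" for h
    proof (rule artin)
      show S: "?i \<circ> h \<circ> \<sigma> \<in> ?S" using S_comp[OF S_comp[OF i HS[OF h]] \<sigma>(1)] .
      fix x assume x: "x \<in> L"
      then have "T \<sigma> x \<in> L" using Ts sL by auto
      then have "T h (T \<sigma> x) = T \<sigma> x" using h by (simp add: L_def)
      then show "T (?i \<circ> h \<circ> \<sigma>) x = x"
        using T_comp[OF S_comp[OF i HS[OF h]] \<sigma>(1) LE[OF x]] T_comp[OF i HS[OF h] TE[OF \<sigma>(1) LE[OF x]]]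
          T_inv(2)[OF \<sigma>(1) LE[OF x]] by simp
    qed
    have "\<sigma> \<circ> h = (\<sigma> \<circ> h \<circ> ?i) \<circ> \<sigma>" "\<sigma> \<circ> (?i \<circ> h \<circ> \<sigma>) = h \<circ> \<sigma>" for h
      using o by (metis comp_assoc comp_id, metis comp_assoc id_comp)
    then have "\<sigma> \<in> ?N" using \<sigma>(1) c1 c2 unfolding perm_normalizer_def by blast
    moreover have "\<Theta> \<sigma> = s"
      using Ts sb by (auto simp: \<Theta>_def Bij_def extensional_def restrict_def)
    ultimately show ?thesis by blast
  qed

  define NN :: "(('g \<times> 'g option \<Rightarrow> nat option) \<Rightarrow> 'g \<times> 'g option \<Rightarrow> nat option) monoid"
    where "NN = \<lparr>carrier = ?N, monoid.mult = (\<circ>), one = id\<rparr>"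
  have "group NN"
  proof (rule groupI)
    fix \<sigma> assume "\<sigma> \<in> carrier NN"
    then have \<sigma>: "\<sigma> \<in> ?N" by (simp add: NN_def)
    show "\<exists>\<rho>\<in>carrier NN. \<rho> \<otimes>\<^bsub>NN\<^esub> \<sigma> = \<one>\<^bsub>NN\<^esub>"
      using perm_normalizer_inv[OF \<sigma>] permutes_inv_o(2)[OF perm_normalizerD(1)[OF \<sigma>]] by (auto simp: NN_def)
  qed (use H in \<open>auto simp: NN_def perm_normalizer_comp comp_assoc\<close>)
  have "\<Theta> \<in> hom NN (Aut L)"
  proof (rule homI)
    fix \<sigma> \<rho> assume "\<sigma> \<in> carrier NN" "\<rho> \<in> carrier NN"
    then have sr: "\<sigma> \<in> ?N" "\<rho> \<in> ?N" by (auto simp: NN_def)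
    have "\<Theta> (\<sigma> \<circ> \<rho>) = compose L (\<Theta> \<sigma>) (\<Theta> \<rho>)"
      using T_comp[OF NS[OF sr(1)] NS[OF sr(2)] LE] TL[OF sr(2)] by (auto simp: \<Theta>_def compose_def)
    then show "\<Theta> (\<sigma> \<otimes>\<^bsub>NN\<^esub> \<rho>) = \<Theta> \<sigma> \<otimes>\<^bsub>Aut L\<^esub> \<Theta> \<rho>"
      using \<Theta>_aut[OF sr(1)] \<Theta>_aut[OF sr(2)] by (simp add: NN_def Aut_def BijGroup_def field_aut_def)
  qed (use \<Theta>_aut in \<open>simp add: NN_def Aut_def\<close>)
  then interpret \<Theta>: group_hom NN "Aut L" \<Theta>
    using \<open>group NN\<close> group_Aut[OF fin] by (simp add: group_hom_def group_hom_axioms_def)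
  have "\<Psi> \<in> hom NN G" using \<Psi> by (auto simp: hom_def NN_def)
  then interpret \<Psi>: group_hom NN G \<Psi>
    using \<open>group NN\<close> G(1) by (simp add: group_hom_def group_hom_axioms_def)
  have "kernel NN G \<Psi> = H" using \<Psi>(3) H(1) by (auto simp: kernel_def NN_def)
  moreover have "kernel NN (Aut L) \<Theta> = H"
  proof -
    have "\<Theta> \<sigma> = (\<lambda>x\<in>L. x) \<longleftrightarrow> \<sigma> \<in> H" if "\<sigma> \<in> ?N" for \<sigma>
    proof
      assume "\<Theta> \<sigma> = (\<lambda>x\<in>L. x)"
      then have "T \<sigma> x = x" if "x \<in> L" for x using that unfolding \<Theta>_def by (metis restrict_apply')
      then show "\<sigma> \<in> H" using artin[OF NS[OF that]] by blast
    next
      assume "\<sigma> \<in> H"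
      then show "\<Theta> \<sigma> = (\<lambda>x\<in>L. x)" by (auto simp: \<Theta>_def L_def)
    qed
    then show ?thesis using H(1) by (auto simp: kernel_def NN_def Aut_def BijGroup_def)
  qed
  moreover have "\<Theta> ` carrier NN = carrier (Aut L)"
    using \<Theta>_aut ext by (force simp: NN_def Aut_def)
  moreover have "\<Psi> ` carrier NN = carrier G" using \<Psi>(2) by (simp add: NN_def)
  ultimately have iso: "NN Mod H \<cong> Aut L" "NN Mod H \<cong> G"
    using \<Theta>.FactGroup_iso \<Psi>.FactGroup_iso by simp_all
  have "group (NN Mod H)" using normal.factorgroup_is_group[OF \<Psi>.normal_kernel] \<open>kernel NN G \<Psi> = H\<close> by simp
  then have "Aut L \<cong> G" using group.iso_sym[OF _ iso(1)] iso(2) iso_trans by blast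

  moreover have "r \<le> card {restrict \<tau> L |\<tau>. endo \<tau>}"
  proof -
    \<comment> \<open>Every embedding arises from a permutation. This gives finiteness, without
      which \<open>card\<close> would carry no lower bound.\<close>
    have "{restrict \<tau> L |\<tau>. endo \<tau>} \<subseteq> \<Theta> ` ?S"
    proof clarify
      fix \<tau> :: "'k alg_closure \<Rightarrow> 'k alg_closure" assume \<tau>: "endo \<tau>"
      obtain \<sigma> where \<sigma>: "\<sigma> \<in> ?S" "\<And>i. i \<in> \<Omega> \<Longrightarrow> \<tau> (\<alpha> i) = \<alpha> (\<sigma> i)"
        using endo_permutes_roots[OF \<Omega>(1) inj f \<tau>] by (metis mem_Collect_eq)
      have "restrict \<tau> L = \<Theta> \<sigma>" unfolding \<Theta>_def by (rule restrict_ext) (use agree[OF \<tau> \<sigma>] LE in blast)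
      then show "restrict \<tau> L \<in> \<Theta> ` ?S" using \<sigma>(1) by blast
    qed
    then have fin: "finite {restrict \<tau> L |\<tau>. endo \<tau>}"
      using finite_permutations[OF \<Omega>(1)] finite_subset by blast
    \<comment> \<open>Permutations with the same restriction to \<open>L\<close> differ on the right
      by an element of \<open>H\<close>, again by \<open>artin\<close>.\<close>
    have "inj_on \<Theta> C"
    proof (rule inj_onI)
      fix \<sigma> \<rho> assume sr: "\<sigma> \<in> C" "\<rho> \<in> C" "\<Theta> \<sigma> = \<Theta> \<rho>"
      have S: "\<sigma> \<in> ?S" "\<rho> \<in> ?S" using C(3) sr by auto
      let ?h = "inv_into UNIV \<sigma> \<circ> \<rho>"
      have "?h \<in> H"
      proof (rule artin)
        show "?h \<in> ?S" using S_comp[OF S_inv[OF S(1)] S(2)] .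
        fix x assume x: "x \<in> L"
        have "T \<rho> x = T \<sigma> x" using fun_cong[OF sr(3), of x] x by (simp add: \<Theta>_def)
        then show "T ?h x = x" using T_comp[OF S_inv[OF S(1)] S(2) LE[OF x]] T_inv(2)[OF S(1) LE[OF x]] by simp
      qed
      moreover have "\<rho> = \<sigma> \<circ> ?h" using permutes_inv_o(1)[of \<sigma> \<Omega>] S(1) by (simp add: comp_assoc[symmetric])
      ultimately show "\<sigma> = \<rho>" using C(4)[OF sr(1,2)] by metis
    qed
    then have "card C = card (\<Theta> ` C)" by (simp add: card_image)
    also have "\<dots> \<le> card {restrict \<tau> L |\<tau>. endo \<tau>}"
      using T(1) C(3) by (intro card_mono[OF fin]) (auto simp: \<Theta>_def)
    finally show ?thesis using C(2) by simp
  qed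
  ultimately show ?thesis using that fin by blast
qed

theorem theorem1p1:
  fixes G :: "('g, 'm) monoid_scheme"
  assumes "hilbertian TYPE('k::field)"
    and "group G"
    and "finite (carrier G)"
  shows "infinite {L :: 'k alg_closure set. finite_extension L \<and> Aut L \<cong> G}"
proof
  let ?\<L> = "{L :: 'k alg_closure set. finite_extension L \<and> Aut L \<cong> G}"
  let ?emb = "\<lambda>L :: 'k alg_closure set. card {restrict \<tau> L |\<tau>. endo \<tau>}"
  assume fin: "finite ?\<L>"
  \<comment> \<open>If only finitely many fields occurred, the sum of their embedding numbers would
    bound each of them; a realization with one more embedding contradicts this.\<close>
  obtain L :: "'k alg_closure set" where L: "L \<in> ?\<L>" "Suc (\<Sum>L\<in>?\<L>. ?emb L) \<le> ?emb L"
    by (rule realization[OF assms, of "Suc (\<Sum>L\<in>?\<L>. ?emb L)"]) auto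
  have "?emb L \<le> (\<Sum>L\<in>?\<L>. ?emb L)" using fin L(1) by (intro member_le_sum) auto
  then show False using L(2) by simp
qed

end
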